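(* Let $G$ be of type $C_n$, let $\mathbf{i}_0=(1\,2\cdots n)^n$, and let $c=(c^{(1)}_1,c^{(1)}_2,\dots,c^{(1)}_n,c^{(2)}_1,\dots,c^{(n)}_{n-1},c^{(n)}_n)\in(\mathbb{C}^\times)^{n^2}$. Put $c^{(m)}_0=1$. Then for $k=1,\dots,n-1$, $$\Delta_{w_0\Lambda_k,s_k\Lambda_k}(\Theta^-_{\mathbf{i}_0}(c))=\sum_{j=1}^{n}\frac{c^{(k)}_j}{c^{(k+1)}_{j-1}}+\sum_{j=k+1}^{n}\frac{c^{(n+k-j+1)}_{j-1}}{c^{(n+k-j+1)}_{j}},$$ that is, it equals $$c^{(k)}_1+\frac{c^{(k)}_2}{c^{(k+1)}_1}+\cdots+\frac{c^{(k)}_n}{c^{(k+1)}_{n-1}}+\frac{c^{(k+1)}_{n-1}}{c^{(k+1)}_n}+\frac{c^{(k+2)}_{n-2}}{c^{(k+2)}_{n-1}}+\cdots+\frac{c^{(n)}_k}{c^{(n)}_{k+1}},$$ and for $k=n$, $\Delta_{w_0\Lambda_n,s_n\Lambda_n}(\Theta^-_{\mathbf{i}_0}(c))=c^{(n)}_n$.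
   Context: $G$ is the simply connected simple algebraic group over $\mathbb{C}$ of type $C_n$ ($n\ge2$), $I=\{1,\dots,n\}$, with Chevalley generators $e_i,f_i,h_i$ of its Lie algebra, simple roots $\alpha_i$, fundamental weights $\Lambda_i$ ($\Lambda_i(h_j)=\delta_{ij}$), and Cartan matrix $a_{ij}=\alpha_j(h_i)$ given by $a_{ii}=2$, $a_{n-1,n}=-2$, $a_{ij}=-1$ for other $|i-j|=1$, and $0$ otherwise ($\alpha_n$ is the long root). $T$ is the maximal torus, $U^{\pm}$ the unipotent subgroups generated by $x_i(t)=\exp(te_i)$, resp. $y_i(t)=\exp(tf_i)$; $\alpha_i^\vee:\mathbb{C}^\times\to T$ is the coroot one-parameter subgroup. $W$ is the Weyl group, $s_i$ the simple reflections, $w_0$ the longest element. Set $\overline{s}_i=x_i(-1)y_i(1)x_i(-1)$ and $\overline{w}=\overline{s}_{i_1}\cdots\overline{s}_{i_l}$ for any reduced expression $w=s_{i_1}\cdots s_{i_l}$. Generalized minors: $\Delta_{\Lambda_i}$ is the regular function on $G$ with $\Delta_{\Lambda_i}(u^-tu^+)=\Lambda_i(t)$ for $u^\pm\in U^\pm$, $t\in T$; for $u,v\in W$, $\Delta_{u\Lambda_i,v\Lambda_i}(g)=\Delta_{\Lambda_i}(\overline{u}^{-1}g\,\overline{v})$. Set $\mathbf{y}_i(c)=y_i(c)\alpha_i^\vee(c^{-1})$. The word $\mathbf{i}_0=(12\cdots n)^n$ is a reduced word of $w_0$ and $$\Theta^-_{\mathbf{i}_0}(c)=\prod_{m=1}^{n}\mathbf{y}_1(c^{(m)}_1)\mathbf{y}_2(c^{(m)}_2)\cdots\mathbf{y}_n(c^{(m)}_n),$$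 the factors for $m=1,2,\dots,n$ being multiplied from left to right. *)

theory Defs
  imports Complex_Main "HOL-Library.FuncSet" "HOL-Algebra.Generated_Groups"
    "Jordan_Normal_Form.Matrix"
begin

text \<open>The simply connected group of type \<open>C\<^sub>n\<close> is realised as the symplectic group of
  size \<open>2n\<close>, for the alternating form with anti-diagonal Gram matrix \<open>1, -1, 1, -1, \<dots>\<close>.
  Rows and columns are numbered from \<open>0\<close>, and the order of the basis is
  \<open>v\<^sub>1, \<dots>, v\<^sub>n, v\<^sub>-\<^sub>n, \<dots>, v\<^sub>-\<^sub>1\<close>.\<close>

definition symp_form :: "nat \<Rightarrow> complex mat" where
  "symp_form n = mat (2*n) (2*n) (\<lambda>(r,s). if r + s + 1 = 2*n then (-1)^r else 0)"

definition Sp :: "nat \<Rightarrow> complex mat monoid" where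
  "Sp n = \<lparr>carrier = {g \<in> carrier_mat (2*n) (2*n).
                        transpose_mat g * symp_form n * g = symp_form n},
           monoid.mult = (*), one = 1\<^sub>m (2*n)\<rparr>"

definition cartan :: "nat \<Rightarrow> nat \<Rightarrow> nat \<Rightarrow> int" where
  "cartan n i j =
     (if i \<notin> {1..n} \<or> j \<notin> {1..n} then 0
      else if i = j then 2
      else if i + 1 = n \<and> j = n then -2
      else if i + 1 = j \<or> j + 1 = i then -1
      else 0)"

text \<open>For \<open>i < n\<close> this is \<open>E\<^sub>i\<^sub>,\<^sub>i\<^sub>+\<^sub>1 + E\<^sub>-\<^sub>(\<^sub>i\<^sub>+\<^sub>1\<^sub>)\<^sub>,\<^sub>-\<^sub>i\<close>; for \<open>i = n\<close> the two positions
  coincide and it is \<open>E\<^sub>n\<^sub>,\<^sub>-\<^sub>n\<close>, with coefficient one.\<close>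

definition chev_e :: "nat \<Rightarrow> nat \<Rightarrow> complex mat" where
  "chev_e n i = mat (2*n) (2*n)
     (\<lambda>(r,s). if s = r + 1 \<and> (r + 1 = i \<or> r + 1 + i = 2*n) then 1 else 0)"

definition chev_f :: "nat \<Rightarrow> nat \<Rightarrow> complex mat" where
  "chev_f n i = transpose_mat (chev_e n i)"

definition chev_h :: "nat \<Rightarrow> nat \<Rightarrow> complex mat" where
  "chev_h n i = chev_e n i * chev_f n i - chev_f n i * chev_e n i"

text \<open>The eigenvalue of \<open>h\<^sub>i\<close> on the basis vector with number \<open>r\<close>.\<close>

definition h_eigenvalue :: "nat \<Rightarrow> nat \<Rightarrow> nat \<Rightarrow> int" where
  "h_eigenvalue n i r =
     (if r + 1 = i \<or> r + 1 + i = 2*n then 1 else 0) - (if r = i \<or> r + i = 2*n then 1 else 0)"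

definition mat_exp :: "complex mat \<Rightarrow> complex mat" where
  "mat_exp A = mat (dim_row A) (dim_row A) (\<lambda>(r,s). \<Sum>k. (A ^\<^sub>m k) $$ (r,s) / fact k)"

definition x_elt :: "nat \<Rightarrow> nat \<Rightarrow> complex \<Rightarrow> complex mat" where
  "x_elt n i t = mat_exp (t \<cdot>\<^sub>m chev_e n i)"

definition y_elt :: "nat \<Rightarrow> nat \<Rightarrow> complex \<Rightarrow> complex mat" where
  "y_elt n i t = mat_exp (t \<cdot>\<^sub>m chev_f n i)"

text \<open>The homomorphism from the multiplicative group to the torus with differential \<open>h\<^sub>i\<close>.\<close>

definition coroot :: "nat \<Rightarrow> nat \<Rightarrow> complex \<Rightarrow> complex mat" where
  "coroot n i c = mat_diag (2*n) (\<lambda>r. c powi h_eigenvalue n i r)"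

definition Uplus :: "nat \<Rightarrow> complex mat set" where
  "Uplus n = generate (Sp n) {x_elt n i t | i t. i \<in> {1..n}}"

definition Uminus :: "nat \<Rightarrow> complex mat set" where
  "Uminus n = generate (Sp n) {y_elt n i t | i t. i \<in> {1..n}}"

definition torus :: "nat \<Rightarrow> complex mat set" where
  "torus n = {t \<in> carrier (Sp n). diagonal_mat t}"

lemma chev_h_diag:
  assumes "i \<in> {1..n}"
  shows "chev_h n i = mat_diag (2*n) (\<lambda>r. of_int (h_eigenvalue n i r))"
proof -
  have "(\<Sum>k = 0..<2*n. (if k = r + 1 \<and> (r + 1 = i \<or> r + 1 + i = 2*n) then 1 else 0) * (if k = s + 1 \<and> (s + 1 = i \<or> s + 1 + i = 2*n) then 1 else 0))
     = (if r = s \<and> (r + 1 = i \<or> r + 1 + i = 2*n) then 1 else (0::complex))" if "r < 2*n" "s < 2*n" for r s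
  proof -
    have "?thesis = ((\<Sum>k = 0..<2*n. if k = r + 1 then (if r = s \<and> (r + 1 = i \<or> r + 1 + i = 2*n) then 1 else 0) else 0)
     = (if r = s \<and> (r + 1 = i \<or> r + 1 + i = 2*n) then 1 else (0::complex)))"
      by (intro arg_cong2[where f="(=)"] sum.cong refl) auto
    also have "\<dots>" using assms that by simp presburger
    finally show ?thesis by simp
  qed
  moreover have "(\<Sum>k = 0..<2*n. (if r = k + 1 \<and> (k + 1 = i \<or> k + 1 + i = 2*n) then 1 else 0) * (if s = k + 1 \<and> (k + 1 = i \<or> k + 1 + i = 2*n) then 1 else 0))
     = (if r = s \<and> (r = i \<or> r + i = 2*n) then 1 else (0::complex))" if "r < 2*n" "s < 2*n" for r s
  proof -
    have "?thesis = ((\<Sum>k = 0..<2*n. if k = r - 1 then (if r = s \<and> (r = i \<or> r + i = 2*n) then 1 else 0) else 0)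
     = (if r = s \<and> (r = i \<or> r + i = 2*n) then 1 else (0::complex)))"
      using assms that by (intro arg_cong2[where f="(=)"] sum.cong refl) (auto, arith+)
    also have "\<dots>" using assms that by auto
    finally show ?thesis by simp
  qed
  ultimately show ?thesis
    by (intro eq_matI)
      (auto simp: chev_h_def chev_f_def chev_e_def mat_diag_def h_eigenvalue_def scalar_prod_def)
qed

lemma chev_he:
  assumes "i \<in> {1..n}" "j \<in> {1..n}"
  shows "chev_h n i * chev_e n j - chev_e n j * chev_h n i = of_int (cartan n i j) \<cdot>\<^sub>m chev_e n j"
  unfolding chev_h_diag[OF assms(1)]
  by (subst mat_diag_mult_left[of _ "2*n" "2*n"], simp add: chev_e_def,
      subst mat_diag_mult_right[of _ "2*n" "2*n"], simp add: chev_e_def, rule eq_matI)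
    (use assms in \<open>auto simp: chev_e_def h_eigenvalue_def cartan_def\<close>, presburger+)

text \<open>The Weyl group is represented by its action on weights. A weight \<open>\<lambda>\<close> is given by its
  coordinates \<open>\<lambda>(h\<^sub>j)\<close>, so the simple root \<open>\<alpha>\<^sub>i\<close> has coordinates \<open>a\<^sub>j\<^sub>i\<close>; the coordinates
  outside \<open>{1..n}\<close> play no role and are left fixed.\<close>

definition simple_root :: "nat \<Rightarrow> nat \<Rightarrow> nat \<Rightarrow> int" where
  "simple_root n i = (\<lambda>j. cartan n j i)"

definition simple_refl :: "nat \<Rightarrow> nat \<Rightarrow> (nat \<Rightarrow> int) \<Rightarrow> (nat \<Rightarrow> int)" where
  "simple_refl n i l = (\<lambda>j. l j - l i * simple_root n i j)"

definition word_elt :: "nat \<Rightarrow> nat list \<Rightarrow> (nat \<Rightarrow> int) \<Rightarrow> (nat \<Rightarrow> int)" where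
  "word_elt n is = foldr (\<lambda>i w. simple_refl n i \<circ> w) is id"

definition weyl_group :: "nat \<Rightarrow> ((nat \<Rightarrow> int) \<Rightarrow> (nat \<Rightarrow> int)) set" where
  "weyl_group n = word_elt n ` lists {1..n}"

definition weyl_length :: "nat \<Rightarrow> ((nat \<Rightarrow> int) \<Rightarrow> (nat \<Rightarrow> int)) \<Rightarrow> nat" where
  "weyl_length n w = (LEAST l. \<exists>is \<in> lists {1..n}. word_elt n is = w \<and> length is = l)"

definition reduced_word :: "nat \<Rightarrow> ((nat \<Rightarrow> int) \<Rightarrow> (nat \<Rightarrow> int)) \<Rightarrow> nat list \<Rightarrow> bool" where
  "reduced_word n w is \<longleftrightarrow>
     is \<in> lists {1..n} \<and> word_elt n is = w \<and> length is = weyl_length n w"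

definition longest_elt :: "nat \<Rightarrow> (nat \<Rightarrow> int) \<Rightarrow> (nat \<Rightarrow> int)" where
  "longest_elt n =
     (THE w. w \<in> weyl_group n \<and> (\<forall>v \<in> weyl_group n. weyl_length n v \<le> weyl_length n w))"

definition s_bar :: "nat \<Rightarrow> nat \<Rightarrow> complex mat" where
  "s_bar n i = x_elt n i (-1) * y_elt n i 1 * x_elt n i (-1)"

text \<open>By the braid relations between the \<open>s_bar n i\<close>, the lift of a Weyl group element does
  not depend on the reduced word that is chosen.\<close>

definition weyl_lift :: "nat \<Rightarrow> ((nat \<Rightarrow> int) \<Rightarrow> (nat \<Rightarrow> int)) \<Rightarrow> complex mat" where
  "weyl_lift n w = foldr (\<lambda>i g. s_bar n i * g) (SOME is. reduced_word n w is) (1\<^sub>m (2*n))"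

text \<open>The group is simply connected, so the character of the torus belonging to \<open>\<Lambda>\<^sub>i\<close>
  is determined by \<open>\<Lambda>\<^sub>i(h\<^sub>j) = \<delta>\<^sub>i\<^sub>j\<close>, that is, by its values on the coroot subgroups.\<close>

definition fund_weight :: "nat \<Rightarrow> nat \<Rightarrow> complex mat \<Rightarrow> complex" where
  "fund_weight n i = (THE \<chi>. \<chi> \<in> torus n \<rightarrow>\<^sub>E UNIV - {0} \<and>
     (\<forall>s \<in> torus n. \<forall>t \<in> torus n. \<chi> (s * t) = \<chi> s * \<chi> t) \<and>
     (\<forall>j \<in> {1..n}. \<forall>c. c \<noteq> 0 \<longrightarrow> \<chi> (coroot n j c) = (if i = j then c else 1)))"

inductive_set poly_funs :: "nat \<Rightarrow> (complex mat \<Rightarrow> complex) set" for d :: nat where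
  const: "(\<lambda>g. a) \<in> poly_funs d"
| entry: "r < d \<Longrightarrow> s < d \<Longrightarrow> (\<lambda>g. g $$ (r,s)) \<in> poly_funs d"
| add: "p \<in> poly_funs d \<Longrightarrow> q \<in> poly_funs d \<Longrightarrow> (\<lambda>g. p g + q g) \<in> poly_funs d"
| mult: "p \<in> poly_funs d \<Longrightarrow> q \<in> poly_funs d \<Longrightarrow> (\<lambda>g. p g * q g) \<in> poly_funs d"

text \<open>As the symplectic group is Zariski closed in the space of all matrices, its regular
  functions are the restrictions of polynomials in the matrix entries.\<close>

definition regular_funs :: "nat \<Rightarrow> (complex mat \<Rightarrow> complex) set" where
  "regular_funs n = (\<lambda>p. restrict p (carrier (Sp n))) ` poly_funs (2*n)"

text \<open>The condition fixes a regular function because the big cell \<open>U\<^sup>-TU\<^sup>+\<close> is dense.\<close>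

definition principal_minor :: "nat \<Rightarrow> nat \<Rightarrow> complex mat \<Rightarrow> complex" where
  "principal_minor n i = (THE f. f \<in> regular_funs n \<and>
     (\<forall>u \<in> Uminus n. \<forall>t \<in> torus n. \<forall>v \<in> Uplus n. f (u * t * v) = fund_weight n i t))"

text \<open>The value at \<open>g\<close> of the minor with index \<open>u\<Lambda>\<^sub>i, v\<Lambda>\<^sub>i\<close>.\<close>

definition gen_minor :: "nat \<Rightarrow> ((nat \<Rightarrow> int) \<Rightarrow> (nat \<Rightarrow> int)) \<Rightarrow> ((nat \<Rightarrow> int) \<Rightarrow> (nat \<Rightarrow> int)) \<Rightarrow>
    nat \<Rightarrow> complex mat \<Rightarrow> complex" where
  "gen_minor n u v i g =
     principal_minor n i (inv\<^bsub>Sp n\<^esub> (weyl_lift n u) * g * weyl_lift n v)"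

definition y_bold :: "nat \<Rightarrow> nat \<Rightarrow> complex \<Rightarrow> complex mat" where
  "y_bold n i c = y_elt n i c * coroot n i (inverse c)"

definition Theta_minus :: "nat \<Rightarrow> nat list \<Rightarrow> complex list \<Rightarrow> complex mat" where
  "Theta_minus n is cs = foldr (\<lambda>(i,c) g. y_bold n i c * g) (zip is cs) (1\<^sub>m (2*n))"

definition word_i0 :: "nat \<Rightarrow> nat list" where
  "word_i0 n = concat (replicate n [1..<Suc n])"

text \<open>The coordinates \<open>c m j\<close> in the order
  \<open>c 1 1, \<dots>, c 1 n, c 2 1, \<dots>, c n n\<close>.\<close>

definition coord_list :: "nat \<Rightarrow> (nat \<Rightarrow> nat \<Rightarrow> complex) \<Rightarrow> complex list" where
  "coord_list n c = concat (map (\<lambda>m. map (c m) [1..<Suc n]) [1..<Suc n])"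

end

theory Submission
  imports Defs "Jordan_Normal_Form.Determinant"
begin

text \<open>A polynomial function on \<open>Sp\<^sub>2\<^sub>n\<close> is determined by its values on \<open>U\<^sup>-TU\<^sup>+\<close>: for \<open>w\<close> in this cell,
  \<open>x\<^sub>i(s) w\<close> stays in it for all but finitely many \<open>s\<close>, so a polynomial vanishing on the cell
  vanishes on everything reached from the torus by the \<open>x\<^sub>i(s)\<close> and \<open>y\<^sub>i(s)\<close>, and by Gaussian elimination
  this is the whole group. Hence \<open>\<Delta>\<close> at \<open>\<Lambda>\<^sub>k\<close> is the leading \<open>k \<times> k\<close> minor. The lift of a Weyl group
  element is its permutation matrix with signs given by the inversions in type \<open>A\<^sub>2\<^sub>n\<^sub>-\<^sub>1\<close>, so the lift
  of \<open>w\<^sub>0\<close> is the inverse of the Gram matrix, and the minor in question has the last \<open>k\<close> rows and the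
  columns \<open>1, \<dots>, k - 1, k + 1\<close> of \<open>\<Theta>\<close>.

  Let \<open>R\<^sub>m\<close> be the product of the blocks \<open>m, \<dots>, n\<close> of \<open>\<Theta>\<close>. Up to sign, the row of \<open>R\<^sub>m\<close> at height
  \<open>r + 1\<close> from the bottom is the row of \<open>R\<^sub>m\<^sub>+\<^sub>1\<close> at height \<open>r\<close> plus a multiple of the row of \<open>R\<^sub>m\<close> at
  height \<open>r\<close>. By unitriangular row operations the last \<open>k\<close> rows of \<open>\<Theta> = R\<^sub>1\<close> therefore become the last
  rows of \<open>R\<^sub>1, \<dots>, R\<^sub>k\<close>; the last row of \<open>R\<^sub>m\<close> starts with \<open>m - 1\<close> zeros followed by a one, and its
  next entry is the asserted value.\<close>

section \<open>Reduced words in type \<open>C\<close>\<close>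

text \<open>Several notions are given by a definite description or by a choice: the longest element,
  the fundamental characters, the principal minors and the reduced word behind a lift. Each needs a
  uniqueness argument before anything can be computed. For lifts the braid relations are avoided:
  along every reduced word the product of the \<open>s_bar n i\<close> is computed outright, and its
  signs depend on the permutation alone. A Weyl group element can be replaced by its permutation
  because it is determined by its action on rho. Density of the cell rests on an explicit
  commutation of x_i(s) with lower unipotent elements, which is used for left multiplication only.
  The elimination must therefore do without column operations; instead, the relation g^T J g = J
  turns a cleared column into a cleared row. The row relation between R_m and R_(m+1) has a simple
  origin: within one block, the lower rows are tail sums divided by a coordinate, and two
  neighbouring tail sums differ by a single term.\<close>

definition sg :: "nat \<Rightarrow> nat \<Rightarrow> nat \<Rightarrow> nat" where
  "sg n i r = (if r + 1 = i \<or> r + 1 + i = 2*n then r + 1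
     else if r = i \<or> r + i = 2*n then r - 1 else r)"

text \<open>The number of the basis vector that the Weyl group element of the word sends to a multiple of
  the one with number \<open>r\<close>.\<close>

fun pos :: "nat \<Rightarrow> nat list \<Rightarrow> nat \<Rightarrow> nat" where
  "pos n [] r = r"
| "pos n (i # is) r = pos n is (sg n i r)"

lemma sg_eqs:
  assumes "i \<in> {1..n}"
  shows "sg n i (i - Suc 0) = i" "sg n i i = i - Suc 0"
    "sg n i (2*n - Suc i) = 2*n - i" "sg n i (2*n - i) = 2*n - Suc i"
    "\<lbrakk>r \<noteq> i - Suc 0; r \<noteq> i; r \<noteq> 2*n - Suc i; r \<noteq> 2*n - i\<rbrakk> \<Longrightarrow> sg n i r = r"
proof -
  \<comment> \<open>Parity keeps the two defining conditions of \<open>sg\<close> apart at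
    \<open>r = i\<close>.\<close>
  have "i + 1 + i \<noteq> 2*n" by presburger
  then show "sg n i i = i - Suc 0" "sg n i (2*n - i) = 2*n - Suc i"
    using assms unfolding sg_def by auto
qed (use assms in \<open>auto simp: sg_def\<close>)

lemma sg_cases:
  obtains "r = i - Suc 0" | "r = i" | "r = 2*n - Suc i" | "r = 2*n - i"
    | "r \<noteq> i - Suc 0" "r \<noteq> i" "r \<noteq> 2*n - Suc i" "r \<noteq> 2*n - (i::nat)"
  by blast

lemma sg_sg:
  assumes "i \<in> {1..n}"
  shows "sg n i (sg n i r) = r"
  by (rule sg_cases[where r = r and i = i and n = n]) (use assms in \<open>auto simp: sg_eqs[OF assms] \<close>)

lemma sg_less:
  assumes "i \<in> {1..n}" "r < 2*n"
  shows "sg n i r < 2*n"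
  by (rule sg_cases[where r = r and i = i and n = n]) (use assms in \<open>auto simp: sg_eqs[OF assms(1)] \<close>)

lemma sg_mirror:
  assumes "i \<in> {1..n}" "r < 2*n"
  shows "sg n i (2*n - Suc r) = 2*n - Suc (sg n i r)"
proof (rule sg_cases[where r = r and i = i and n = n])
  assume "r \<noteq> i - Suc 0" "r \<noteq> i" "r \<noteq> 2*n - Suc i" "r \<noteq> 2*n - i"
  then have ne: "r + 1 \<noteq> i" "r \<noteq> i" "r + i + 1 \<noteq> 2*n" "r + i \<noteq> 2*n" using assms by auto
  define m where "m = 2*n - Suc r"
  have m: "r + m + 1 = 2*n" using assms unfolding m_def by auto
  have "m + 1 \<noteq> i" "m \<noteq> i" "m + i + 1 \<noteq> 2*n" "m + i \<noteq> 2*n" using ne m by linarith+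
  then have "sg n i m = m" by (simp add: sg_def)
  moreover have "sg n i r = r" using ne by (simp add: sg_def)
  ultimately show ?thesis by (simp add: m_def)
next
  assume "r = i - Suc 0"
  moreover have "2*n - Suc (i - Suc 0) = 2*n - i" using assms by auto
  ultimately show ?thesis by (simp add: sg_eqs[OF assms(1)])
next
  assume r: "r = 2*n - Suc i"
  moreover have "2*n - Suc r = i" "2*n - Suc (2*n - i) = i - Suc 0" using assms r by auto
  ultimately show ?thesis by (simp add: sg_eqs[OF assms(1)])
next
  assume r: "r = 2*n - i"
  moreover have "2*n - Suc r = i - Suc 0" "2*n - Suc (2*n - Suc i) = i" using assms r by auto
  ultimately show ?thesis by (simp add: sg_eqs[OF assms(1)])
next
  assume r: "r = i"
  moreover have "2*n - Suc (i - Suc 0) = 2*n - i" using assms by auto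
  ultimately show ?thesis by (simp add: sg_eqs[OF assms(1)])
qed

lemma pos_less:
  assumes "is \<in> lists {1..n}" "r < 2*n"
  shows "pos n is r < 2*n"
  using assms by (induction "is" arbitrary: r) (auto simp: sg_less)

lemma pos_mirror:
  assumes "is \<in> lists {1..n}" "r < 2*n"
  shows "pos n is (2*n - Suc r) = 2*n - Suc (pos n is r)"
  using assms
proof (induction "is" arbitrary: r)
  case (Cons i js)
  then show ?case using sg_mirror[of i n r] sg_less[of i n r] by auto
qed simp

lemma pos_inj:
  assumes "is \<in> lists {1..n}"
  shows "inj_on (pos n is) {..<2*n}"
  using assms
proof (induction "is")
  case (Cons i js)
  have i: "i \<in> {1..n}" using Cons.hyps by simp
  have "inj_on (sg n i) {..<2*n}"
    by (rule inj_on_inverseI[where g = "sg n i"]) (rule sg_sg[OF i])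
  moreover have "sg n i ` {..<2*n} \<subseteq> {..<2*n}" using sg_less[OF i] by auto
  ultimately have "inj_on (pos n js \<circ> sg n i) {..<2*n}"
    using Cons by (metis comp_inj_on inj_on_subset Cons_in_lists_iff)
  then show ?case by (simp add: comp_def)
qed simp

text \<open>The coordinates \<open>x\<^sub>1, \<dots>, x\<^sub>n, -x\<^sub>n, \<dots>, -x\<^sub>1\<close> of a weight with respect to the weights of the
  standard representation; the Weyl group permutes them.\<close>

definition eps_coord :: "nat \<Rightarrow> (nat \<Rightarrow> int) \<Rightarrow> nat \<Rightarrow> int" where
  "eps_coord n l r = (if r < n then \<Sum>j=r+1..n. l j else - (\<Sum>j=2*n-r..n. l j))"

text \<open>The sum from m on is the m-th standard coordinate of a weight, so the right-hand side is
  read off from alpha_i = eps_i - eps_(i+1) for i < n and alpha_n = 2 eps_n.\<close>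

lemma sum_simple_root:
  assumes "i \<in> {1..n}" "m \<ge> 1"
  shows "(\<Sum>j=m..n. simple_root n i j) =
     (if m = i then if i = n then 2 else 1 else if m = i + 1 \<and> i < n then -1 else 0)"
proof -
  have "simple_root n i j = (if j = i then 2 else 0)
      + (if j = i - 1 then if j = 0 then 0 else if i = n then -2 else -1 else 0)
      + (if j = i + 1 then -1 else 0)" if "m \<le> j" "j \<le> n" for j
  proof -
    consider "j = i" | "j + 1 = i" | "j = i + 1" | "j \<noteq> i" "j + 1 \<noteq> i" "j \<noteq> i + 1" by blast
    then show ?thesis
      by cases (use assms that in \<open>auto simp: simple_root_def cartan_def\<close>)
  qed
  then have "(\<Sum>j=m..n. simple_root n i j) = (\<Sum>j=m..n. (if j = i then 2 else 0)
      + (if j = i - 1 then if j = 0 then 0 else if i = n then -2 else -1 else 0)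
      + (if j = i + 1 then -1 else 0))"
    by (intro sum.cong refl) auto
  also have "\<dots> = (if i \<in> {m..n} then 2 else 0)
      + (if i - 1 \<in> {m..n} then if i - 1 = 0 then 0 else if i = n then -2 else -1 else 0)
      + (if i + 1 \<in> {m..n} then -1 else 0)"
    by (simp only: sum.distrib sum.delta finite_atLeastAtMost)
  also have "\<dots> = (if m = i then if i = n then 2 else 1 else if m = i + 1 \<and> i < n then -1 else 0)"
  proof -
    consider "m = i" | "m = i + 1" | "m < i" | "m > i + 1" by linarith
    then show ?thesis by cases (use assms in auto)
  qed
  finally show ?thesis .
qed

text \<open>Subtracting l_i alpha_i moves only the coordinates x_i and x_(i+1), and l_i is their
  difference, so they are interchanged. For i = n the coordinate x_n = l_n loses 2 l_n and becomes
  -x_n.\<close>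

lemma eps_coord_simple_refl:
  assumes "i \<in> {1..n}" "r < 2*n"
  shows "eps_coord n (simple_refl n i l) r = eps_coord n l (sg n i r)"
proof -
  have S: "(\<Sum>j=m..n. simple_refl n i l j) = (\<Sum>j=m..n. l j) -
      l i * (if m = i then if i = n then 2 else 1 else if m = i + 1 \<and> i < n then -1 else 0)"
    if "m \<ge> 1" for m
    unfolding simple_refl_def sum_subtractf sum_distrib_left[symmetric]
      sum_simple_root[OF assms(1) that] ..
  have T: "(\<Sum>j=m..n. l j) = l m + (\<Sum>j=m+1..n. l j)" if "m \<le> n" for m
    using that sum.atLeast_Suc_atMost[of m n l] by simp
  have i_cases: "i < n \<or> i = n" using assms(1) by auto
  show ?thesis
  proof (cases "r < n")
    case True
    have E: "eps_coord n l' r' = (\<Sum>j=r'+1..n. l' j)" if "r' < n" for l' r'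
      using that by (simp add: eps_coord_def)
    consider "r + 1 = i" "i < n" | "r + 1 = i" "i = n" | "r = i" | "r + 1 \<noteq> i" "r \<noteq> i"
      using i_cases by blast
    then show ?thesis
    proof cases
      case 1
      then have "sg n i r = i" using sg_eqs(1)[OF assms(1)] by auto
      then show ?thesis using 1 True S[of "r+1"] T[of i] by (simp add: E)
    next
      case 2
      then have "sg n i r = n" using sg_eqs(1)[OF assms(1)] by auto
      moreover have "eps_coord n l n = - (\<Sum>j=n..n. l j)" unfolding eps_coord_def by simp
      ultimately show ?thesis using 2 True S[of "r+1"] by (simp add: E)
    next
      case 3
      then have "sg n i r = i - 1" using sg_eqs(2)[OF assms(1)] by auto
      moreover have "i - 1 < n" "i - 1 + 1 = i" using assms(1) by auto
      ultimately show ?thesis using 3 True S[of "i+1"] T[of i] by (simp add: E)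
    next
      case 4
      then have "sg n i r = r" using sg_eqs(5)[OF assms(1), of r] True assms(1) by auto
      then show ?thesis using 4 True S[of "r+1"] by (simp add: E)
    qed
  next
    case False
    define m where "m = 2*n - r"
    have r: "r = 2*n - m" "1 \<le> m" "m \<le> n" using False assms unfolding m_def by auto
    have E: "eps_coord n l' (2*n - m') = - (\<Sum>j=m'..n. l' j)" if "1 \<le> m'" "m' \<le> n" for l' m'
      using that by (simp add: eps_coord_def)
    consider "m = i + 1" | "m = i" "i < n" | "m = i" "i = n" | "m \<noteq> i + 1" "m \<noteq> i"
      using i_cases by blast
    then show ?thesis
    proof cases
      case 1
      then have "sg n i r = 2*n - i" using sg_eqs(3)[OF assms(1)] r by auto
      then show ?thesis using assms(1) r 1 S[of "i+1"] T[of i] by (simp add: E)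
    next
      case 2
      then have "sg n i r = 2*n - (i + 1)" using sg_eqs(4)[OF assms(1)] r by auto
      moreover have "1 \<le> i + 1" "i + 1 \<le> n" "1 \<le> i" "i \<le> n" using 2 assms(1) by auto
      ultimately show ?thesis unfolding r(1) using r 2 S[of i] T[of i]
        by (simp only: E) simp
    next
      case 3
      then have "sg n i r = n - 1" using sg_eqs(4)[OF assms(1)] r by auto
      moreover have "eps_coord n l (n - 1) = (\<Sum>j=n..n. l j)"
        using 3 r by (simp add: eps_coord_def)
      moreover have "r = n" "eps_coord n (simple_refl n i l) n = - (\<Sum>j=n..n. simple_refl n i l j)"
        using 3 r by (simp_all add: eps_coord_def)
      ultimately show ?thesis using 3 S[of n] r(2) by simp
    next
      case 4
      then have "sg n i r = r" using sg_eqs(5)[OF assms(1), of r] r assms(1) by auto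
      then show ?thesis using 4 r S[of m] by (simp add: E)
    qed
  qed
qed

lemma word_elt_Cons: "word_elt n (i # is) l = simple_refl n i (word_elt n is l)"
  by (simp add: word_elt_def)

lemma word_elt_Nil: "word_elt n [] l = l"
  by (simp add: word_elt_def)

text \<open>The first letter acts last on the weight but first on the index, since reading off a
  coordinate reverses the order; this is the order built into \<open>pos\<close>.\<close>

lemma eps_coord_word:
  assumes "is \<in> lists {1..n}" "r < 2*n"
  shows "eps_coord n (word_elt n is l) r = eps_coord n l (pos n is r)"
  using assms by (induction "is" arbitrary: r)
    (auto simp: word_elt_Cons word_elt_Nil eps_coord_simple_refl sg_less)

lemma word_elt_outside:
  assumes "is \<in> lists {1..n}" "j \<notin> {1..n}"
  shows "word_elt n is l j = l j"
  using assms by (induction "is")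
    (auto simp: word_elt_Cons word_elt_Nil simple_refl_def simple_root_def cartan_def)

text \<open>Index n carries -x_n, so the last difference is x_n - (-x_n) = 2 l_n; hence the factor
  two.\<close>

lemma eps_coord_diff:
  assumes "j \<in> {1..n}"
  shows "eps_coord n l (j - 1) - eps_coord n l j = (if j = n then 2 else 1) * l j"
  using assms sum.atLeast_Suc_atMost[of j n l] unfolding eps_coord_def by auto

text \<open>The constant weight is rho. Its coordinates n, ..., 1, -1, ..., -n are distinct, so rho
  has trivial stabiliser.\<close>

lemma eps_coord_inj:
  "inj_on (eps_coord n (\<lambda>_. 1)) {..<2*n}"
proof -
  have "eps_coord n (\<lambda>_. 1) r = (if r < n then int n - int r else int n - 1 - int r)" if "r < 2*n" for r
    using that unfolding eps_coord_def by (auto simp: of_nat_diff)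
  then show ?thesis by (auto simp: inj_on_def split: if_splits)
qed

text \<open>Evaluation at rho recovers the permutation. Conversely, differences of neighbouring
  coordinates recover every l_j with j in 1..n, and the remaining coordinates are never
  moved.\<close>

lemma word_elt_eq_iff:
  assumes "is \<in> lists {1..n}" "js \<in> lists {1..n}"
  shows "word_elt n is = word_elt n js \<longleftrightarrow> (\<forall>r<2*n. pos n is r = pos n js r)"
proof
  assume eq: "word_elt n is = word_elt n js"
  show "\<forall>r<2*n. pos n is r = pos n js r"
  proof (intro allI impI)
    fix r assume r: "r < 2*n"
    have "eps_coord n (\<lambda>_. 1) (pos n is r) = eps_coord n (\<lambda>_. 1) (pos n js r)"
      using eps_coord_word[OF assms(1) r] eps_coord_word[OF assms(2) r] eq by metis
    then show "pos n is r = pos n js r"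
      using eps_coord_inj r pos_less assms by (metis inj_onD lessThan_iff)
  qed
next
  assume eq: "\<forall>r<2*n. pos n is r = pos n js r"
  show "word_elt n is = word_elt n js"
  proof (intro ext)
    fix l j
    show "word_elt n is l j = word_elt n js l j"
    proof (cases "j \<in> {1..n}")
      case True
      have "eps_coord n (word_elt n is l) r = eps_coord n (word_elt n js l) r" if "r < 2*n" for r
        using that eq assms by (simp add: eps_coord_word)
      from this[of j] this[of "j - 1"] True
      show ?thesis
        using eps_coord_diff[OF True, of "word_elt n is l"] eps_coord_diff[OF True, of "word_elt n js l"]
        by (auto split: if_splits)
    next
      case False
      then show ?thesis using assms by (simp add: word_elt_outside)
    qed
  qed
qed

section \<open>Inversions and the length function of type C\<close>

text \<open>Inversions are recorded index by index and not only in total, because the parity of the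
  count at r is the sign of row r in the lift.\<close>

definition inv_count :: "nat \<Rightarrow> (nat \<Rightarrow> nat) \<Rightarrow> nat \<Rightarrow> nat" where
  "inv_count M q r = card {r'. r < r' \<and> r' < M \<and> q r' < q r}"

definition swap_adj :: "nat \<Rightarrow> nat \<Rightarrow> nat" where
  "swap_adj a r = (if r = a then a + 1 else if r = a + 1 then a else r)"

text \<open>Only the values at a and a + 1 change their relative order. The new inversion is charged
  to its left end a; all other counts travel with their values.\<close>

lemma inv_count_swap:
  assumes "a + 1 < M" "q a < q (a + 1)"
  shows "inv_count M (q \<circ> swap_adj a) r = (if r = a then inv_count M q (a + 1) + 1
     else if r = a + 1 then inv_count M q a else inv_count M q r)"
proof -
  consider "r = a" | "r = a + 1" | "r \<noteq> a" "r \<noteq> a + 1" by blast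
  then show ?thesis
  proof cases
    case 1
    have "{r'. r < r' \<and> r' < M \<and> (q \<circ> swap_adj a) r' < (q \<circ> swap_adj a) r} =
      insert (a + 1) {r'. a + 1 < r' \<and> r' < M \<and> q r' < q (a + 1)}"
      using 1 assms by (auto simp: swap_adj_def)
    then show ?thesis using 1 by (simp add: inv_count_def)
  next
    case 2
    have "{r'. r < r' \<and> r' < M \<and> (q \<circ> swap_adj a) r' < (q \<circ> swap_adj a) r} =
      {r'. a < r' \<and> r' < M \<and> q r' < q a}"
      using 2 assms by (auto simp: swap_adj_def)
    then show ?thesis using 2 by (simp add: inv_count_def)
  next
    case 3
    \<comment> \<open>Both swapped positions lie on the same side of r, so the swap is a bijection
      between the two inversion sets.\<close>
    have "{r'. r < r' \<and> r' < M \<and> (q \<circ> swap_adj a) r' < (q \<circ> swap_adj a) r} =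
      swap_adj a ` {r'. r < r' \<and> r' < M \<and> q r' < q r}" (is "?A = _ ` ?B")
    proof
      show "?A \<subseteq> swap_adj a ` ?B"
      proof
        fix x assume "x \<in> ?A"
        then have "swap_adj a x \<in> ?B" "x = swap_adj a (swap_adj a x)"
          using 3 assms by (auto simp: swap_adj_def split: if_splits)
        then show "x \<in> swap_adj a ` ?B" by blast
      qed
    qed (use 3 assms in \<open>auto simp: swap_adj_def split: if_splits\<close>)
    moreover have "inj_on (swap_adj a) ?B" by (auto simp: inj_on_def swap_adj_def split: if_splits)
    ultimately show ?thesis using 3 by (simp add: inv_count_def card_image)
  qed
qed

lemma sum_inv_count_swap:
  assumes "a + 1 < M" "q a < q (a + 1)"
  shows "(\<Sum>r<M. inv_count M (q \<circ> swap_adj a) r) = (\<Sum>r<M. inv_count M q r) + 1"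
proof -
  have M: "{..<M} = insert a (insert (a + 1) ({..<M} - {a, a + 1}))" using assms by auto
  have "(\<Sum>r\<in>{..<M} - {a, a + 1}. inv_count M (q \<circ> swap_adj a) r)
     = (\<Sum>r\<in>{..<M} - {a, a + 1}. inv_count M q r)"
    using assms by (intro sum.cong refl) (auto simp: inv_count_swap)
  then show ?thesis
    by (subst (1 2) M) (simp add: inv_count_swap[OF assms])
qed

text \<open>Twice the Coxeter length of type \<open>C\<close>: an inversion of the permutation of the \<open>2n\<close> basis
  vectors and its mirror image belong to the same root, except for those of the long roots.\<close>

definition len2 :: "nat \<Rightarrow> (nat \<Rightarrow> nat) \<Rightarrow> nat" where
  "len2 n q = (\<Sum>r<2*n. inv_count (2*n) q r) + card {a. a < n \<and> n \<le> q a}"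

text \<open>These are the signed permutations written on 2n letters: r and
  \<open>2*n - Suc r\<close> stand for opposite weights of the standard representation.\<close>

definition sym_perm :: "nat \<Rightarrow> (nat \<Rightarrow> nat) \<Rightarrow> bool" where
  "sym_perm n q \<longleftrightarrow> inj_on q {..<2*n} \<and> (\<forall>r<2*n. q r < 2*n \<and> q (2*n - Suc r) = 2*n - Suc (q r))"

lemma sym_permD:
  assumes "sym_perm n q" "r < 2*n"
  shows "q r < 2*n" "q (2*n - Suc r) = 2*n - Suc (q r)"
  using assms unfolding sym_perm_def by blast+

lemma sym_perm_pos: "is \<in> lists {1..n} \<Longrightarrow> sym_perm n (pos n is)"
  unfolding sym_perm_def using pos_less pos_inj pos_mirror by blast

lemma pos_Cons_comp: "pos n (i # is) = pos n is \<circ> sg n i"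
  by auto

lemma sg_last: "n \<ge> 1 \<Longrightarrow> sg n n = swap_adj (n - 1)"
  by (auto simp: sg_def swap_adj_def fun_eq_iff)

lemma sg_short:
  "i \<in> {1..n} \<Longrightarrow> i < n \<Longrightarrow> sg n i = swap_adj (i - 1) \<circ> swap_adj (2*n - Suc i)"
proof
  fix r
  assume i: "i \<in> {1..n}" "i < n"
  define a b where "a = i - Suc 0" and "b = 2*n - Suc i"
  have ab: "i = Suc a" "2*n - i = Suc b" "i - Suc 0 = a" "2*n - Suc i = b" "Suc a < b"
    using i unfolding a_def b_def by auto
  note sg = sg_eqs[OF i(1), unfolded ab(2,3,4), unfolded ab(1)]
  show "sg n i r = (swap_adj (i - 1) \<circ> swap_adj (2*n - Suc i)) r"
  proof -
    consider "r = a" | "r = Suc a" | "r = b" | "r = Suc b" | "r \<noteq> a" "r \<noteq> Suc a" "r \<noteq> b" "r \<noteq> Suc b"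
      by blast
    then show ?thesis
      unfolding ab(4) unfolding ab(1) using ab(5) sg(1-4) sg(5)[of r]
      by cases (simp_all add: swap_adj_def)
  qed
qed

lemma swap_adj_swap_adj: "swap_adj a (swap_adj a r) = r"
  by (simp add: swap_adj_def)

lemma sym_perm_mirror_less:
  assumes "sym_perm n q" "i \<in> {1..n}" "q (i - 1) < q i"
  shows "q (2*n - Suc i) < q (2*n - i)"
proof -
  have "q (2*n - Suc i) = 2*n - Suc (q i)" "q (2*n - i) = 2*n - Suc (q (i - 1))" "q i < 2*n"
    using sym_permD[OF assms(1), of i] sym_permD[OF assms(1), of "i - 1"] assms(2)
    by auto
  then show ?thesis using assms(3) by auto
qed

text \<open>For i = n one inversion appears and, by the mirror symmetry, index n - 1 newly takes a
  value of at least n. For i < n the two disjoint transpositions give one inversion each, while the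
  indices below n are only permuted among themselves.\<close>

lemma len2_ascent:
  assumes q: "sym_perm n q" and i: "i \<in> {1..n}" and less: "q (i - 1) < q i"
  shows "len2 n (q \<circ> sg n i) = len2 n q + 2"
proof (cases "i = n")
  case True
  have m: "q n = 2*n - Suc (q (n - 1))" "q (n-1) < 2*n"
    using sym_permD[OF q, of "n - 1"] i True by auto
  have s: "sg n i = swap_adj (n - 1)" using True sg_last i by auto
  have "(\<Sum>r<2*n. inv_count (2*n) (q \<circ> sg n i) r) = (\<Sum>r<2*n. inv_count (2*n) q r) + 1"
    unfolding s using True i less by (intro sum_inv_count_swap) auto
  moreover have "{a. a < n \<and> n \<le> (q \<circ> sg n i) a} = insert (n - 1) {a. a < n \<and> n \<le> q a}"
  proof -
    have "q (n - 1) < n" "n \<le> q n" using m less True i by auto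
    moreover have "{a. a < n \<and> P a} = {a. a < n - 1 \<and> P a} \<union> {a. a = n - 1 \<and> P a}" for P
      using i by auto
    moreover have "(q \<circ> sg n i) a = q a" if "a < n - 1" for a
    proof -
      have "a \<noteq> n - 1" "a \<noteq> n - 1 + 1" using that by linarith+
      then show ?thesis unfolding s by (simp add: swap_adj_def)
    qed
    moreover have "(q \<circ> sg n i) (n - 1) = q n"
      using i True unfolding s by (simp add: swap_adj_def)
    ultimately show ?thesis by auto
  qed
  moreover have "n - 1 \<notin> {a. a < n \<and> n \<le> q a}" using m less True by auto
  ultimately show ?thesis by (simp add: len2_def)
next
  case False
  then have i': "i < n" using i by auto
  note s = sg_short[OF i i']
  let ?q = "q \<circ> swap_adj (i - 1)"
  have "i - 1 + 1 = i" "2*n - Suc i + 1 = 2*n - i" "i - 1 < 2*n - Suc i" "i < 2*n - Suc i"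
    using i i' by auto
  then have q': "?q (2*n - Suc i) = q (2*n - Suc i)" "?q (2*n - Suc i + 1) = q (2*n - i)"
    unfolding swap_adj_def comp_def by simp_all
  have "(\<Sum>r<2*n. inv_count (2*n) ?q r) = (\<Sum>r<2*n. inv_count (2*n) q r) + 1"
    using less i i' by (intro sum_inv_count_swap) auto
  moreover have "(\<Sum>r<2*n. inv_count (2*n) (?q \<circ> swap_adj (2*n - Suc i)) r)
      = (\<Sum>r<2*n. inv_count (2*n) ?q r) + 1"
    by (intro sum_inv_count_swap) (use q' sym_perm_mirror_less[OF q i less] i i' in auto)
  moreover have "card {a. a < n \<and> n \<le> (q \<circ> sg n i) a} = card {a. a < n \<and> n \<le> q a}"
  proof -
    have 1: "(q \<circ> sg n i) a = q (swap_adj (i - 1) a)" if "a < n" for a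
    proof -
      have "a \<noteq> 2*n - Suc i" "a \<noteq> 2*n - Suc i + 1" using that i' by linarith+
      then show ?thesis unfolding s comp_def swap_adj_def[of "2*n - Suc i"] by (simp only: if_False)
    qed
    have 2: "swap_adj (i - 1) a < n \<longleftrightarrow> a < n" for a
      using i i' by (auto simp: swap_adj_def)
    have "{a. a < n \<and> n \<le> (q \<circ> sg n i) a} = swap_adj (i - 1) ` {a. a < n \<and> n \<le> q a}"
    proof (intro Set.set_eqI iffI)
      fix x assume "x \<in> {a. a < n \<and> n \<le> (q \<circ> sg n i) a}"
      then have "swap_adj (i - 1) x \<in> {a. a < n \<and> n \<le> q a}" using 1[of x] 2[of x] by simp
      then show "x \<in> swap_adj (i - 1) ` {a. a < n \<and> n \<le> q a}"
        by (rule rev_image_eqI) (rule swap_adj_swap_adj[symmetric])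
    next
      fix x assume "x \<in> swap_adj (i - 1) ` {a. a < n \<and> n \<le> q a}"
      then obtain a where "x = swap_adj (i - 1) a" "a < n" "n \<le> q a" by blast
      then show "x \<in> {a. a < n \<and> n \<le> (q \<circ> sg n i) a}"
        using 1[of x] 2[of a] by (simp add: swap_adj_swap_adj)
    qed
    moreover have "inj (swap_adj (i - 1))" by (rule injI) (metis swap_adj_swap_adj)
    ultimately show ?thesis by (simp add: card_image inj_on_subset)
  qed
  ultimately show ?thesis by (simp add: len2_def s comp_assoc)
qed

lemma inv_count_le: "inv_count M q r \<le> M - Suc r"
proof -
  have "card {r'. r < r' \<and> r' < M \<and> q r' < q r} \<le> card {r<..<M}" by (intro card_mono) auto
  then show ?thesis by (simp add: inv_count_def)
qed

lemma sum_rev_nat: "(\<Sum>r<2*n. 2*n - Suc r) = n * (2*n - 1)"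
proof -
  have "(\<Sum>r<2*n. 2*n - Suc r) = (\<Sum>r<2*n. r)"
    using sum.nat_diff_reindex[of "\<lambda>r. r" "2*n"] by simp
  also have "\<dots> = n * (2*n - 1)" using gauss_sum_nat[of "2*n-1"]
    by (cases n) (auto simp: lessThan_Suc_atMost atMost_atLeast0)
  finally show ?thesis .
qed

text \<open>At most n(2n - 1) inversions and n long roots: the bound is twice the number of positive
  roots.\<close>

lemma len2_le: "len2 n q \<le> 2*n^2"
proof -
  have "(\<Sum>r<2*n. inv_count (2*n) q r) \<le> n * (2*n - 1)"
    unfolding sum_rev_nat[symmetric] by (intro sum_mono inv_count_le)
  moreover have "card {a. a < n \<and> n \<le> q a} \<le> card {..<n}" by (intro card_mono) auto
  ultimately show ?thesis unfolding len2_def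
    by (cases n) (auto simp: power2_eq_square algebra_simps)
qed

text \<open>The mirror symmetry extends the ascents to all neighbouring indices, so r never exceeds
  q r. The same inequality at the mirrored index is the reverse one.\<close>

lemma sym_perm_ascending:
  assumes q: "sym_perm n q" and "\<And>i. i \<in> {1..n} \<Longrightarrow> q (i - 1) < q i" and r: "r < 2*n"
  shows "q r = r"
proof -
  have step: "q r < q (r + 1)" if "r + 1 < 2*n" for r
  proof (cases "r < n")
    case True then show ?thesis using assms(2)[of "r+1"] by auto
  next
    case False
    have i: "2*n - Suc r \<in> {1..n}" "2*n - Suc (2*n - Suc r) = r" "2*n - (2*n - Suc r) = r + 1"
      using that False by auto
    show ?thesis using sym_perm_mirror_less[OF q i(1) assms(2)[OF i(1)]] unfolding i(2,3) .
  qed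
  have ge: "r < 2*n \<Longrightarrow> r \<le> q r" for r
    by (induction r) (use step in \<open>force+\<close>)
  from ge[OF r] ge[of "2*n - Suc r"] q r show ?thesis unfolding sym_perm_def by fastforce
qed

lemma sym_perm_descending:
  assumes q: "sym_perm n q" and "\<And>i. i \<in> {1..n} \<Longrightarrow> q i < q (i - 1)" and r: "r < 2*n"
  shows "q r = 2*n - Suc r"
proof -
  \<comment> \<open>Complementing the values turns descents into ascents and keeps the mirror
    symmetry.\<close>
  have "sym_perm n (\<lambda>r. 2*n - Suc (q r))" unfolding sym_perm_def
  proof (intro conjI inj_onI allI impI)
    fix x y assume *: "x \<in> {..<2*n}" "y \<in> {..<2*n}" "2*n - Suc (q x) = 2*n - Suc (q y)"
    then have "q x = q y" using sym_permD(1)[OF q, of x] sym_permD(1)[OF q, of y] by auto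
    then show "x = y" using * q unfolding sym_perm_def by (metis inj_onD)
  next
    fix r assume r: "r < 2*n"
    then show "2*n - Suc (q r) < 2*n" by auto
    show "2*n - Suc (q (2*n - Suc r)) = 2*n - Suc (2*n - Suc (q r))"
      using sym_permD[OF q r] by simp
  qed
  moreover have "2*n - Suc (q (i - 1)) < 2*n - Suc (q i)" if "i \<in> {1..n}" for i
  proof -
    have "i - 1 < 2*n" using that by auto
    then show ?thesis using assms(2)[OF that] sym_permD(1)[OF q, of "i - 1"] by linarith
  qed
  ultimately have "2*n - Suc (q r) = r" using sym_perm_ascending r by blast
  then show ?thesis using q r unfolding sym_perm_def by auto
qed

lemma len2_cong: "(\<And>r. r < 2*n \<Longrightarrow> q r = q' r) \<Longrightarrow> len2 n q = len2 n q'"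
proof -
  assume eq: "\<And>r. r < 2*n \<Longrightarrow> q r = q' r"
  have "inv_count (2*n) q r = inv_count (2*n) q' r" if "r < 2*n" for r
    using eq that unfolding inv_count_def by (intro arg_cong[where f = card]) auto
  moreover have "{a. a < n \<and> n \<le> q a} = {a. a < n \<and> n \<le> q' a}" using eq by auto
  ultimately show ?thesis unfolding len2_def by simp
qed

lemma sym_perm_neq_adj:
  assumes "sym_perm n q" "i \<in> {1..n}"
  shows "q i \<noteq> q (i - 1)"
proof
  assume "q i = q (i - 1)"
  moreover have "i \<in> {..<2*n}" "i - 1 \<in> {..<2*n}" using assms(2) by auto
  ultimately have "i = i - 1" using assms(1) unfolding sym_perm_def by (metis inj_onD)
  then show False using assms(2) by auto
qed

text \<open>Any ascent would allow one more letter and push \<open>len2\<close> above its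
  bound.\<close>

lemma len2_max:
  assumes q: "sym_perm n q" and "len2 n q = 2*n^2" and r: "r < 2*n"
  shows "q r = 2*n - Suc r"
proof (rule ccontr)
  assume "q r \<noteq> 2*n - Suc r"
  then obtain i where i: "i \<in> {1..n}" "\<not> q i < q (i - 1)"
    using sym_perm_descending[OF q _ r] by blast
  moreover have "q i \<noteq> q (i - 1)" using sym_perm_neq_adj[OF q i(1)] .
  ultimately have "len2 n (q \<circ> sg n i) = len2 n q + 2" using q i by (intro len2_ascent) auto
  then show False using len2_le[of n "q \<circ> sg n i"] assms by simp
qed

lemma len2_descent:
  assumes is_l: "is \<in> lists {1..n}" and i: "i \<in> {1..n}" and less: "pos n is i < pos n is (i - 1)"
  shows "len2 n (pos n is) = len2 n (pos n (i # is)) + 2"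
proof -
  have "len2 n (pos n (i # is) \<circ> sg n i) = len2 n (pos n (i # is)) + 2"
    using is_l i less by (intro len2_ascent sym_perm_pos) (auto simp: sg_eqs)
  moreover have "len2 n (pos n (i # is) \<circ> sg n i) = len2 n (pos n is)"
    using i by (intro len2_cong) (auto simp: sg_sg)
  ultimately show ?thesis by simp
qed

lemma pos_neq_adj: "is \<in> lists {1..n} \<Longrightarrow> i \<in> {1..n} \<Longrightarrow> pos n is i \<noteq> pos n is (i - 1)"
  using sym_perm_neq_adj sym_perm_pos by blast

lemma len2_id: "len2 n (\<lambda>r. r) = 0"
  by (auto simp: len2_def inv_count_def)

section \<open>Reduced words and the longest element\<close>

lemma len2_word_le:
  assumes "is \<in> lists {1..n}"
  shows "len2 n (pos n is) \<le> 2 * length is"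
  using assms
proof (induction "is")
  case Nil
  then show ?case by (simp add: len2_id[unfolded] flip: id_def) (simp add: len2_def inv_count_def)
next
  case (Cons i js)
  show ?case
  proof (cases "pos n js (i - 1) < pos n js i")
    case True
    then have "len2 n (pos n (i # js)) = len2 n (pos n js) + 2"
      unfolding pos_Cons_comp using Cons by (intro len2_ascent sym_perm_pos) auto
    then show ?thesis using Cons by (simp del: pos.simps)
  next
    case False
    then have "pos n js i < pos n js (i - 1)" using pos_neq_adj[of js n i] Cons.hyps by auto
    then show ?thesis using len2_descent[of js n i] Cons by (simp del: pos.simps)
  qed
qed

text \<open>Prepending a letter at a descent lowers \<open>len2\<close> by two, so the induction
  ends at a permutation without descents, the identity. As the generators are involutions, the same
  letter prepended to the shorter word gives back the original element.\<close>

lemma exists_short_word: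
  assumes "is \<in> lists {1..n}"
  shows "\<exists>js \<in> lists {1..n}. word_elt n js = word_elt n is \<and> 2 * length js = len2 n (pos n is)"
  using assms
proof (induction "len2 n (pos n is)" arbitrary: "is" rule: less_induct)
  case less
  show ?case
  proof (cases "\<forall>i \<in> {1..n}. pos n is (i - 1) < pos n is i")
    case True
    then have id: "pos n is r = r" if "r < 2*n" for r
      using sym_perm_ascending[OF sym_perm_pos[OF less.prems] _ that] by blast
    then have "len2 n (pos n is) = 0" using len2_cong[of n "pos n is" "\<lambda>r. r"] len2_id by simp
    moreover have "word_elt n [] = word_elt n is"
      using id less.prems by (subst word_elt_eq_iff) auto
    ultimately show ?thesis by (intro bexI[of _ "[]"]) auto
  next
    case False
    then obtain i where i: "i \<in> {1..n}" "pos n is i < pos n is (i - 1)"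
      using pos_neq_adj[OF less.prems] by (metis linorder_neqE_nat)
    then have d: "len2 n (pos n is) = len2 n (pos n (i # is)) + 2"
      using len2_descent less.prems by blast
    with less(1)[of "i # is"] less.prems i obtain js where js: "js \<in> lists {1..n}"
      "word_elt n js = word_elt n (i # is)" "2 * length js = len2 n (pos n (i # is))" by auto
    have "\<forall>r<2*n. pos n js r = pos n (i # is) r"
      using js less.prems i word_elt_eq_iff by (metis Cons_in_lists_iff)
    then have "word_elt n (i # js) = word_elt n is"
      using js less.prems i by (subst word_elt_eq_iff) (auto simp: sg_less sg_sg)
    then show ?thesis using js d i by (intro bexI[of _ "i # js"]) auto
  qed
qed

lemma weyl_length_word:
  assumes "is \<in> lists {1..n}"
  shows "2 * weyl_length n (word_elt n is) = len2 n (pos n is)"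
proof -
  obtain js where js: "js \<in> lists {1..n}" "word_elt n js = word_elt n is"
    "2 * length js = len2 n (pos n is)" using exists_short_word[OF assms] by blast
  have "weyl_length n (word_elt n is) = length js" unfolding weyl_length_def
  proof (rule Least_equality)
    fix l assume "\<exists>ks\<in>lists {1..n}. word_elt n ks = word_elt n is \<and> length ks = l"
    then obtain ks where ks: "ks \<in> lists {1..n}" "word_elt n ks = word_elt n is" "length ks = l" by blast
    then have "len2 n (pos n ks) = len2 n (pos n is)"
      using assms by (intro len2_cong) (auto simp: word_elt_eq_iff)
    then show "length js \<le> l" using len2_word_le[OF ks(1)] ks(3) js(3) by simp
  qed (use js in blast)
  then show ?thesis using js(3) by simp
qed

lemma reduced_word_iff:
  assumes "is \<in> lists {1..n}"
  shows "reduced_word n (word_elt n is) js \<longleftrightarrow> js \<in> lists {1..n} \<and>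
    (\<forall>r<2*n. pos n js r = pos n is r) \<and> 2 * length js = len2 n (pos n js)"
proof (cases "js \<in> lists {1..n}")
  case True
  then show ?thesis
    using weyl_length_word[OF assms] weyl_length_word[OF True] word_elt_eq_iff[OF True assms]
    unfolding reduced_word_def by auto
qed (simp add: reduced_word_def)

lemma exists_reduced_word:
  assumes "is \<in> lists {1..n}"
  shows "\<exists>js. reduced_word n (word_elt n is) js"
  using exists_short_word[OF assms] weyl_length_word[OF assms] unfolding reduced_word_def by auto

text \<open>A letter adds at most two to \<open>len2\<close>. Equality for the whole word therefore
  forces equality for the rest of it and an ascent at the first letter, which is what an induction
  along a reduced word needs.\<close>

lemma reduced_word_Cons:
  assumes "i # js \<in> lists {1..n}" "2 * length (i # js) = len2 n (pos n (i # js))"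
  shows "pos n js (i - 1) < pos n js i" "2 * length js = len2 n (pos n js)"
proof -
  show *: "pos n js (i - 1) < pos n js i"
  proof (rule ccontr)
    assume "\<not> ?thesis"
    then have "pos n js i < pos n js (i - 1)" using pos_neq_adj[of js n i] assms by auto
    then show False using len2_descent[of js n i] len2_word_le[of js n] assms by auto
  qed
  show "2 * length js = len2 n (pos n js)"
    using * len2_ascent[OF sym_perm_pos, of js n i] assms
    by (auto simp: pos_Cons_comp simp del: pos.simps)
qed

lemma exists_longest_word:
  "\<exists>is \<in> lists {1..n}. \<forall>r<2*n. pos n is r = 2*n - Suc r"
proof -
  have "\<exists>js \<in> lists {1..n}. \<forall>r<2*n. pos n js r = 2*n - Suc r" if "is \<in> lists {1..n}" for "is"
    using that
  \<comment> \<open>The measure is the distance to the bound in \<open>len2_le\<close>: while there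
    is an ascent, a letter can be prepended.\<close>
  proof (induction "2*n^2 - len2 n (pos n is)" arbitrary: "is" rule: less_induct)
    case less
    show ?case
    proof (cases "\<forall>i \<in> {1..n}. pos n is i < pos n is (i - 1)")
      case True
      then show ?thesis
        using sym_perm_descending[OF sym_perm_pos[OF less.prems]] less.prems by blast
    next
      case False
      then obtain i where i: "i \<in> {1..n}" "pos n is (i - 1) < pos n is i"
        using pos_neq_adj[OF less.prems] by (metis linorder_neqE_nat)
      then have "len2 n (pos n (i # is)) = len2 n (pos n is) + 2"
        using len2_ascent[OF sym_perm_pos] less.prems unfolding pos_Cons_comp by blast
      then show ?thesis
        using less(1)[of "i # is"] less.prems i len2_le[of n "pos n (i # is)"] by auto
    qed
  qed
  from this[of "[]"] show ?thesis by simp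
qed

text \<open>The reversal attains the largest possible length n^2, and by \<open>len2_max\<close> it
  is the only element that does, as the definite description requires.\<close>

lemma longest_elt_eq:
  assumes is_l: "is \<in> lists {1..n}" and rev: "\<And>r. r < 2*n \<Longrightarrow> pos n is r = 2*n - Suc r"
  shows "longest_elt n = word_elt n is"
proof -
  have "len2 n (pos n is) = 2*n^2"
  proof -
    have "inv_count (2*n) (pos n is) r = 2*n - Suc r" if "r < 2*n" for r
    proof -
      have "{r'. r < r' \<and> r' < 2*n \<and> pos n is r' < pos n is r} = {r<..<2*n}" using rev that by auto
      then show ?thesis by (simp add: inv_count_def)
    qed
    then have "(\<Sum>r<2*n. inv_count (2*n) (pos n is) r) = n * (2*n - 1)"
      using sum_rev_nat[of n] by simp
    moreover have "{a. a < n \<and> n \<le> pos n is a} = {..<n}" using rev by auto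
    ultimately show ?thesis unfolding len2_def by (cases n) (auto simp: power2_eq_square algebra_simps)
  qed
  then have len: "weyl_length n (word_elt n is) = n^2" using weyl_length_word[OF is_l] by simp
  have le: "weyl_length n (word_elt n js) \<le> n^2" if "js \<in> lists {1..n}" for js
    using weyl_length_word[OF that] len2_le[of n "pos n js"] by simp
  show ?thesis unfolding longest_elt_def
  proof (rule the_equality)
    fix w assume w: "w \<in> weyl_group n \<and> (\<forall>v\<in>weyl_group n. weyl_length n v \<le> weyl_length n w)"
    then obtain js where js: "js \<in> lists {1..n}" "w = word_elt n js" unfolding weyl_group_def by blast
    have "n^2 \<le> weyl_length n w" using w is_l len unfolding weyl_group_def by force
    then have "len2 n (pos n js) = 2*n^2" using le[OF js(1)] weyl_length_word[OF js(1)] js(2) by simp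
    then have "pos n js r = 2*n - Suc r" if "r < 2*n" for r
      using len2_max[OF sym_perm_pos[OF js(1)]] that by blast
    then show "w = word_elt n is" using js rev is_l by (simp add: word_elt_eq_iff)
  qed (use is_l le len in \<open>auto simp: weyl_group_def\<close>)
qed

section \<open>Root subgroups, torus and lifts of Weyl group elements\<close>

text \<open>The generator \<open>e\<^sub>i\<close> adds row \<open>r + 1\<close> to row \<open>r\<close> if \<open>up n i r\<close>, and \<open>f\<^sub>i\<close> adds row \<open>r - 1\<close> to row \<open>r\<close> if
  \<open>dn n i r\<close>.\<close>

definition up :: "nat \<Rightarrow> nat \<Rightarrow> nat \<Rightarrow> bool" where
  "up n i r \<longleftrightarrow> r + 1 = i \<or> r + 1 + i = 2*n"

definition dn :: "nat \<Rightarrow> nat \<Rightarrow> nat \<Rightarrow> bool" where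
  "dn n i r \<longleftrightarrow> r = i \<or> r + i = 2*n"

lemma up_not_dn: "up n i r \<Longrightarrow> \<not> dn n i r"
  unfolding up_def dn_def by presburger

lemma dn_Suc [simp]: "dn n i (Suc r) \<longleftrightarrow> up n i r"
  unfolding up_def dn_def by auto

lemma up_pred: "i \<in> {1..n} \<Longrightarrow> dn n i r \<Longrightarrow> up n i (r - 1)"
  unfolding up_def dn_def by auto

lemma dn_pos: "i \<in> {1..n} \<Longrightarrow> r < 2*n \<Longrightarrow> dn n i r \<Longrightarrow> 0 < r"
  unfolding dn_def by auto

lemma up_less: "i \<in> {1..n} \<Longrightarrow> up n i r \<Longrightarrow> Suc r < 2*n"
  unfolding up_def by auto

lemma up_unique: "i \<in> {1..n} \<Longrightarrow> j \<in> {1..n} \<Longrightarrow> up n i r \<Longrightarrow> up n j r \<Longrightarrow> i = j"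
  unfolding up_def by auto

lemma up_mirror: "i \<in> {1..n} \<Longrightarrow> r < 2*n \<Longrightarrow> up n i (2*n - Suc r) \<longleftrightarrow> dn n i r"
  unfolding up_def dn_def by auto

lemma dn_mirror: "i \<in> {1..n} \<Longrightarrow> r < 2*n \<Longrightarrow> dn n i (2*n - Suc r) \<longleftrightarrow> up n i r"
  unfolding up_def dn_def by auto

lemma sg_up_dn: "sg n i r = (if up n i r then r + 1 else if dn n i r then r - 1 else r)"
  unfolding sg_def up_def dn_def by simp

lemma h_eigenvalue_up_dn:
  "h_eigenvalue n i r = (if up n i r then 1 else if dn n i r then -1 else 0)"
  using up_not_dn[of n i r] unfolding h_eigenvalue_def up_def dn_def by auto

section \<open>Root subgroups as row operations\<close>

lemma chev_e_carrier [simp]: "chev_e n i \<in> carrier_mat (2*n) (2*n)"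
  by (simp add: chev_e_def)

lemma chev_f_carrier [simp]: "chev_f n i \<in> carrier_mat (2*n) (2*n)"
  by (simp add: chev_f_def)

lemma chev_dim [simp]:
  "dim_row (chev_e n i) = 2*n" "dim_col (chev_e n i) = 2*n"
  "dim_row (chev_f n i) = 2*n" "dim_col (chev_f n i) = 2*n"
  by (simp_all add: chev_e_def chev_f_def)

lemma chev_e_index:
  "r < 2*n \<Longrightarrow> s < 2*n \<Longrightarrow> chev_e n i $$ (r,s) = (if s = Suc r \<and> up n i r then 1 else 0)"
  by (simp add: chev_e_def up_def)

lemma chev_f_index:
  "r < 2*n \<Longrightarrow> s < 2*n \<Longrightarrow> chev_f n i $$ (r,s) = (if r = Suc s \<and> dn n i r then 1 else 0)"
  by (auto simp: chev_f_def chev_e_index)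

lemma mult_index_sum:
  assumes "A \<in> carrier_mat m k" "B \<in> carrier_mat k l" "r < m" "s < l"
  shows "(A * B) $$ (r,s) = (\<Sum>j<k. A $$ (r,j) * B $$ (j,s))"
  using assms by (simp add: scalar_prod_def lessThan_atLeast0)

lemma sum_single_index:
  fixes f :: "nat \<Rightarrow> 'a::comm_monoid_add"
  assumes "a < m" "\<And>j. j < m \<Longrightarrow> j \<noteq> a \<Longrightarrow> f j = 0"
  shows "(\<Sum>j<m. f j) = f a"
proof -
  have "(\<Sum>j<m. f j) = (\<Sum>j\<in>{a}. f j)"
    by (rule sum.mono_neutral_right) (use assms in auto)
  then show ?thesis by simp
qed

lemma chev_e_mult_index:
  assumes i: "i \<in> {1..n}" and M: "M \<in> carrier_mat (2*n) l" and rs: "r < 2*n" "s < l"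
  shows "(chev_e n i * M) $$ (r,s) = (if up n i r then M $$ (Suc r,s) else 0)"
proof (cases "up n i r")
  case True
  have "(chev_e n i * M) $$ (r,s) = (\<Sum>j<2*n. chev_e n i $$ (r,j) * M $$ (j,s))"
    using M rs by (intro mult_index_sum) auto
  also have "\<dots> = chev_e n i $$ (r,Suc r) * M $$ (Suc r,s)"
    using up_less[OF i True] rs by (intro sum_single_index) (auto simp: chev_e_index)
  finally show ?thesis using up_less[OF i True] rs True by (simp add: chev_e_index)
next
  case False
  have "(chev_e n i * M) $$ (r,s) = (\<Sum>j<2*n. chev_e n i $$ (r,j) * M $$ (j,s))"
    using M rs by (intro mult_index_sum) auto
  then show ?thesis using False rs by (simp add: chev_e_index)
qed

lemma chev_f_mult_index:
  assumes i: "i \<in> {1..n}" and M: "M \<in> carrier_mat (2*n) l" and rs: "r < 2*n" "s < l"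
  shows "(chev_f n i * M) $$ (r,s) = (if dn n i r then M $$ (r - 1,s) else 0)"
proof (cases "dn n i r")
  case True
  have r: "r - 1 < 2*n" "r = Suc (r - 1)" using dn_pos[OF i rs(1) True] rs by auto
  have "(chev_f n i * M) $$ (r,s) = (\<Sum>j<2*n. chev_f n i $$ (r,j) * M $$ (j,s))"
    using M rs by (intro mult_index_sum) auto
  also have "\<dots> = chev_f n i $$ (r,r - 1) * M $$ (r - 1,s)"
    using r rs by (intro sum_single_index) (auto simp: chev_f_index)
  finally show ?thesis using r rs True by (simp add: chev_f_index)
next
  case False
  have "(chev_f n i * M) $$ (r,s) = (\<Sum>j<2*n. chev_f n i $$ (r,j) * M $$ (j,s))"
    using M rs by (intro mult_index_sum) auto
  then show ?thesis using False rs by (simp add: chev_f_index)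
qed

text \<open>Row r + 1, which e_i copies to row r, itself receives nothing from e_i. Consequently the
  exponential series stops after its linear term.\<close>

lemma chev_e_square: "i \<in> {1..n} \<Longrightarrow> chev_e n i * chev_e n i = 0\<^sub>m (2*n) (2*n)"
  by (rule eq_matI) (use up_less up_not_dn[of n i] in
    \<open>auto simp: chev_e_mult_index[where l = "2*n"] chev_e_index carrier_matD[OF chev_e_carrier]
      simp del: index_mult_mat(1) simp flip: dn_Suc\<close>)

lemma chev_f_square: "i \<in> {1..n} \<Longrightarrow> chev_f n i * chev_f n i = 0\<^sub>m (2*n) (2*n)"
  using chev_e_square[of i n] transpose_mult[OF chev_e_carrier chev_e_carrier, of n i i]
  unfolding chev_f_def by (simp add: transpose_mat_def zero_mat_def) (auto simp: mat_eq_iff)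

lemma mat_exp_square_zero:
  assumes A: "A \<in> carrier_mat m m" and sq: "A * A = 0\<^sub>m m m"
  shows "mat_exp A = 1\<^sub>m m + A"
proof (rule eq_matI)
  fix r s assume rs: "r < dim_row (1\<^sub>m m + A)" "s < dim_col (1\<^sub>m m + A)"
  have 0: "A ^\<^sub>m k = 0\<^sub>m m m" if k: "k \<notin> {0,1}" for k
  proof -
    obtain j where j: "k = Suc (Suc j)" using k by (metis insert_iff not0_implies_Suc One_nat_def)
    have "A ^\<^sub>m k = A ^\<^sub>m j * (A * A)" using assoc_mult_mat[of "A ^\<^sub>m j" m m A m A m] A unfolding j by simp
    then show ?thesis using A sq by simp
  qed
  have "(\<Sum>k. (A ^\<^sub>m k) $$ (r,s) / fact k) = (\<Sum>k\<in>{0,1}. (A ^\<^sub>m k) $$ (r,s) / fact k)"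
    by (rule suminf_finite) (use A rs 0 in auto)
  then show "mat_exp A $$ (r,s) = (1\<^sub>m m + A) $$ (r,s)"
    using A rs by (simp add: mat_exp_def)
qed (use A in \<open>auto simp: mat_exp_def\<close>)

lemma x_elt_eq: "i \<in> {1..n} \<Longrightarrow> x_elt n i t = 1\<^sub>m (2*n) + t \<cdot>\<^sub>m chev_e n i"
  unfolding x_elt_def
  by (rule mat_exp_square_zero)
    (auto simp: chev_e_square mult_smult_assoc_mat[of _ "2*n" "2*n" _ "2*n"] mult_smult_distrib[of _ "2*n" "2*n" _ "2*n"])

lemma y_elt_eq: "i \<in> {1..n} \<Longrightarrow> y_elt n i t = 1\<^sub>m (2*n) + t \<cdot>\<^sub>m chev_f n i"
  unfolding y_elt_def
  by (rule mat_exp_square_zero)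
    (auto simp: chev_f_square mult_smult_assoc_mat[of _ "2*n" "2*n" _ "2*n"] mult_smult_distrib[of _ "2*n" "2*n" _ "2*n"])

lemma x_elt_carrier [simp]: "x_elt n i t \<in> carrier_mat (2*n) (2*n)"
  by (auto simp: x_elt_def mat_exp_def chev_e_def)

lemma y_elt_carrier [simp]: "y_elt n i t \<in> carrier_mat (2*n) (2*n)"
  by (auto simp: y_elt_def mat_exp_def chev_f_def chev_e_def)

lemma coroot_carrier [simp]: "coroot n i c \<in> carrier_mat (2*n) (2*n)"
  by (auto simp: coroot_def mat_diag_def)

lemma x_elt_mult_index:
  assumes "i \<in> {1..n}" "M \<in> carrier_mat (2*n) l" "r < 2*n" "s < l"
  shows "(x_elt n i t * M) $$ (r,s) = M $$ (r,s) + (if up n i r then t * M $$ (Suc r,s) else 0)"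
proof -
  have "x_elt n i t * M = M + t \<cdot>\<^sub>m (chev_e n i * M)"
    unfolding x_elt_eq[OF assms(1)] using assms(2)
    by (simp add: add_mult_distrib_mat[of _ "2*n" "2*n"] mult_smult_assoc_mat[of _ "2*n" "2*n"])
  then show ?thesis using assms by (simp add: chev_e_mult_index del: index_mult_mat(1))
qed

lemma y_elt_mult_index:
  assumes "i \<in> {1..n}" "M \<in> carrier_mat (2*n) l" "r < 2*n" "s < l"
  shows "(y_elt n i t * M) $$ (r,s) = M $$ (r,s) + (if dn n i r then t * M $$ (r - 1,s) else 0)"
proof -
  have "y_elt n i t * M = M + t \<cdot>\<^sub>m (chev_f n i * M)"
    unfolding y_elt_eq[OF assms(1)] using assms(2)
    by (simp add: add_mult_distrib_mat[of _ "2*n" "2*n"] mult_smult_assoc_mat[of _ "2*n" "2*n"])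
  then show ?thesis using assms by (simp add: chev_f_mult_index del: index_mult_mat(1))
qed

lemma coroot_mult_index:
  assumes "M \<in> carrier_mat (2*n) l" "r < 2*n" "s < l"
  shows "(coroot n i c * M) $$ (r,s) =
    (if up n i r then c else if dn n i r then inverse c else 1) * M $$ (r,s)"
  using assms unfolding coroot_def
  by (subst mat_diag_mult_left[of _ "2*n" l]) (auto simp: h_eigenvalue_up_dn power_int_minus)

lemma x_elt_index:
  assumes "i \<in> {1..n}" "r < 2*n" "s < 2*n"
  shows "x_elt n i t $$ (r,s) = (if r = s then 1 else if up n i r \<and> s = Suc r then t else 0)"
  using assms by (simp add: x_elt_eq chev_e_index carrier_matD[OF chev_e_carrier])

lemma y_elt_index:
  assumes "i \<in> {1..n}" "r < 2*n" "s < 2*n"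
  shows "y_elt n i t $$ (r,s) = (if r = s then 1 else if dn n i r \<and> r = Suc s then t else 0)"
  using assms by (auto simp: y_elt_eq chev_f_index)

lemma mult_eqI:
  assumes "A \<in> carrier_mat (2*n) (2*n)" "B \<in> carrier_mat (2*n) (2*n)"
    and "\<And>r s. r < 2*n \<Longrightarrow> s < 2*n \<Longrightarrow> A $$ (r,s) = B $$ (r,s)"
  shows "A = B"
  using assms by (intro eq_matI) auto

lemma square_mult_carrier [simp]:
  assumes "A \<in> carrier_mat m m" "B \<in> carrier_mat m m"
  shows "A * B \<in> carrier_mat m m"
  using assms by (rule mult_carrier_mat)

lemma x_elt_add:
  assumes "i \<in> {1..n}"
  shows "x_elt n i a * x_elt n i b = x_elt n i (a + b)"
  by (rule mult_eqI[of _ n]) (use assms up_less[OF assms] up_not_dn[of n i] in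
    \<open>auto simp: x_elt_mult_index[where l = "2*n"] x_elt_index simp del: index_mult_mat(1) simp flip: dn_Suc\<close>)

lemma y_elt_add:
  assumes "i \<in> {1..n}"
  shows "y_elt n i a * y_elt n i b = y_elt n i (a + b)"
proof (rule mult_eqI[of _ n])
  fix r s assume rs: "r < 2*n" "s < 2*n"
  show "(y_elt n i a * y_elt n i b) $$ (r,s) = y_elt n i (a + b) $$ (r,s)"
  proof (cases "dn n i r")
    case True
    then obtain r' where r': "r = Suc r'" using dn_pos[OF assms rs(1)] by (metis not0_implies_Suc neq0_conv)
    then show ?thesis using True rs assms up_not_dn[of n i r']
      by (auto simp: y_elt_mult_index[where l = "2*n"] y_elt_index simp del: index_mult_mat(1))
  next
    case False
    then show ?thesis using rs assms
      by (auto simp: y_elt_mult_index[where l = "2*n"] y_elt_index simp del: index_mult_mat(1))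
  qed
qed auto

lemma x_elt_0: "i \<in> {1..n} \<Longrightarrow> x_elt n i 0 = 1\<^sub>m (2*n)"
  by (rule mult_eqI[of _ n]) (auto simp: x_elt_index)

lemma y_elt_0: "i \<in> {1..n} \<Longrightarrow> y_elt n i 0 = 1\<^sub>m (2*n)"
  by (rule mult_eqI[of _ n]) (auto simp: y_elt_index)

section \<open>The symplectic group\<close>

lemma symp_form_carrier [simp]: "symp_form n \<in> carrier_mat (2*n) (2*n)"
  by (simp add: symp_form_def)

lemma symp_form_dim [simp]: "dim_row (symp_form n) = 2*n" "dim_col (symp_form n) = 2*n"
  by (simp_all add: symp_form_def)

lemma symp_form_index:
  "r < 2*n \<Longrightarrow> s < 2*n \<Longrightarrow> symp_form n $$ (r,s) = (if s = 2*n - Suc r then (-1)^r else 0)"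
  by (auto simp: symp_form_def)

lemma symp_form_mult_index:
  assumes "M \<in> carrier_mat (2*n) l" "r < 2*n" "s < l"
  shows "(symp_form n * M) $$ (r,s) = (-1)^r * M $$ (2*n - Suc r,s)"
proof -
  have "(symp_form n * M) $$ (r,s) = (\<Sum>j<2*n. symp_form n $$ (r,j) * M $$ (j,s))"
    using assms by (intro mult_index_sum) auto
  also have "\<dots> = symp_form n $$ (r,2*n - Suc r) * M $$ (2*n - Suc r,s)"
    using assms by (intro sum_single_index) (auto simp: symp_form_index)
  finally show ?thesis using assms by (simp add: symp_form_index)
qed

lemma neg_one_power_mirror: "r < 2*n \<Longrightarrow> (-1::complex) ^ (2*n - Suc r) = - ((-1) ^ r)"
  by (cases "even r") auto

lemma symp_form_square: "symp_form n * symp_form n = - 1\<^sub>m (2*n)"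
  by (rule mult_eqI[of _ n])
    (auto simp: symp_form_mult_index[where l = "2*n"] symp_form_index neg_one_power_mirror
      simp del: index_mult_mat(1))

lemma symp_form_transpose: "transpose_mat (symp_form n) = - symp_form n"
proof (rule mult_eqI[of _ n])
  fix r s assume rs: "r < 2*n" "s < 2*n"
  have "transpose_mat (symp_form n) $$ (r,s) = symp_form n $$ (s,r)"
    using rs carrier_matD[OF symp_form_carrier] by simp
  moreover have "(- symp_form n) $$ (r,s) = - (symp_form n $$ (r,s))"
    using rs carrier_matD[OF symp_form_carrier] by simp
  moreover have "r = 2*n - Suc s \<longleftrightarrow> s = 2*n - Suc r" using rs by auto
  ultimately show "transpose_mat (symp_form n) $$ (r,s) = (- symp_form n) $$ (r,s)"
    using rs neg_one_power_mirror[of r n] by (auto simp: symp_form_index)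
qed auto

lemma carrier_Sp: "g \<in> carrier (Sp n) \<longleftrightarrow> g \<in> carrier_mat (2*n) (2*n) \<and>
    transpose_mat g * symp_form n * g = symp_form n"
  by (simp add: Sp_def)

lemma mult_Sp [simp]: "g \<otimes>\<^bsub>Sp n\<^esub> h = g * h" and one_Sp [simp]: "\<one>\<^bsub>Sp n\<^esub> = 1\<^sub>m (2*n)"
  by (simp_all add: Sp_def)

lemma Sp_mat: "g \<in> carrier (Sp n) \<Longrightarrow> g \<in> carrier_mat (2*n) (2*n)"
  by (simp add: carrier_Sp)

lemma Sp_mult_closed:
  assumes "g \<in> carrier (Sp n)" "h \<in> carrier (Sp n)"
  shows "g * h \<in> carrier (Sp n)"
proof -
  note [simp] = assoc_mult_mat[of _ "2*n" "2*n" _ "2*n" _ "2*n"]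
  have g: "g \<in> carrier_mat (2*n) (2*n)" and h: "h \<in> carrier_mat (2*n) (2*n)"
    and eq: "transpose_mat g * symp_form n * g = symp_form n" "transpose_mat h * symp_form n * h = symp_form n"
    using assms by (auto simp: carrier_Sp)
  have "transpose_mat (g * h) * symp_form n * (g * h) = transpose_mat h * (transpose_mat g * symp_form n * g) * h"
    using g h by (simp add: transpose_mult[of _ "2*n" "2*n" _ "2*n"])
  then show ?thesis using g h eq by (simp add: carrier_Sp)
qed

lemma group_Sp: "group (Sp n)"
proof (rule groupI)
  fix g assume g: "g \<in> carrier (Sp n)"
  note [simp] = assoc_mult_mat[of _ "2*n" "2*n" _ "2*n" _ "2*n"]
  let ?J = "symp_form n"
  \<comment> \<open>Since J^2 = -1, multiplying g^T J g = J by -J from the left gives (-J g^T J) g =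
    1.\<close>
  define h where "h = - (?J * transpose_mat g * ?J)"
  have gc: "g \<in> carrier_mat (2*n) (2*n)" and eq: "transpose_mat g * (?J * g) = ?J"
    using g by (auto simp: carrier_Sp)
  have hg: "h * g = 1\<^sub>m (2*n)" unfolding h_def using gc
    by (simp add: eq symp_form_square del: uminus_mult_left_mat uminus_mult_right_mat)
      (simp add: eq symp_form_square)
  have hc: "h \<in> carrier_mat (2*n) (2*n)" unfolding h_def using gc by simp
  then have gh: "g * h = 1\<^sub>m (2*n)" using hg gc mat_mult_left_right_inverse by blast
  have "transpose_mat h * transpose_mat g = 1\<^sub>m (2*n)"
    using gc hc gh by (metis transpose_mult transpose_one)
  then have "transpose_mat h * (transpose_mat g * (?J * (g * h))) = ?J"
    using gc hc gh assoc_mult_mat[of "transpose_mat h" "2*n" "2*n" "transpose_mat g" "2*n" ?J "2*n"]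
    by simp
  then have "transpose_mat h * ((transpose_mat g * (?J * g)) * h) = ?J" using gc hc by simp
  then have "h \<in> carrier (Sp n)" using hc unfolding eq by (simp add: carrier_Sp)
  then show "\<exists>h \<in> carrier (Sp n). h \<otimes>\<^bsub>Sp n\<^esub> g = \<one>\<^bsub>Sp n\<^esub>" using hg by auto
next
  fix g h assume "g \<in> carrier (Sp n)" "h \<in> carrier (Sp n)"
  then show "g \<otimes>\<^bsub>Sp n\<^esub> h \<in> carrier (Sp n)" by (simp add: Sp_mult_closed)
qed (auto simp: carrier_Sp intro: assoc_mult_mat)

text \<open>By skewness the transpose of 1 + tA becomes 1 - tA when it is moved across J, and as A^2
  = 0 this is the inverse of 1 + tA. The lemma serves the simple root elements and the long root
  elements alike.\<close>

lemma square_zero_Sp: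
  assumes A: "A \<in> carrier_mat (2*n) (2*n)" and sq: "A * A = 0\<^sub>m (2*n) (2*n)"
    and skew: "transpose_mat A * symp_form n = - (symp_form n * A)"
  shows "1\<^sub>m (2*n) + t \<cdot>\<^sub>m A \<in> carrier (Sp n)"
proof -
  note [simp] = assoc_mult_mat[of _ "2*n" "2*n" _ "2*n" _ "2*n"]
  let ?J = "symp_form n"
  let ?x = "1\<^sub>m (2*n) + t \<cdot>\<^sub>m A"
  have "transpose_mat ?x = 1\<^sub>m (2*n) + t \<cdot>\<^sub>m transpose_mat A"
    using A by (intro eq_matI) auto
  then have "transpose_mat ?x * ?J = ?J + t \<cdot>\<^sub>m (transpose_mat A * ?J)"
    using A add_mult_distrib_mat[of "1\<^sub>m (2*n)" "2*n" "2*n" "t \<cdot>\<^sub>m transpose_mat A" ?J "2*n"]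
      mult_smult_assoc_mat[of "transpose_mat A" "2*n" "2*n" ?J "2*n" t] by simp
  also have "\<dots> = ?J * (1\<^sub>m (2*n) - t \<cdot>\<^sub>m A)"
  proof -
    have "?J * (1\<^sub>m (2*n) - t \<cdot>\<^sub>m A) = ?J - t \<cdot>\<^sub>m (?J * A)"
      using A mult_minus_distrib_mat[of ?J "2*n" "2*n" "1\<^sub>m (2*n)" "2*n" "t \<cdot>\<^sub>m A"]
        mult_smult_distrib[of ?J "2*n" "2*n" A "2*n" t] by simp
    also have "\<dots> = ?J + t \<cdot>\<^sub>m (transpose_mat A * ?J)"
      unfolding skew using A by (intro eq_matI) (auto simp del: index_mult_mat(1))
    finally show ?thesis by simp
  qed
  finally have "transpose_mat ?x * ?J * ?x = ?J * ((1\<^sub>m (2*n) - t \<cdot>\<^sub>m A) * ?x)"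
    using A assoc_mult_mat[of ?J "2*n" "2*n" "1\<^sub>m (2*n) - t \<cdot>\<^sub>m A" "2*n" ?x "2*n"]
    by (simp add: minus_carrier_mat)
  also have "(1\<^sub>m (2*n) - t \<cdot>\<^sub>m A) * ?x = ?x - t \<cdot>\<^sub>m (A * ?x)"
    using A minus_mult_distrib_mat[of "1\<^sub>m (2*n)" "2*n" "2*n" "t \<cdot>\<^sub>m A" ?x "2*n"]
      mult_smult_assoc_mat[of A "2*n" "2*n" ?x "2*n" t] by simp
  also have "A * ?x = A"
    using A sq mult_add_distrib_mat[of A "2*n" "2*n" "1\<^sub>m (2*n)" "2*n" "t \<cdot>\<^sub>m A"]
      mult_smult_distrib[of A "2*n" "2*n" A "2*n" t] by simp
  also have "?x - t \<cdot>\<^sub>m A = 1\<^sub>m (2*n)" using A by (intro eq_matI) auto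
  finally show ?thesis using A by (simp add: carrier_Sp)
qed

lemma mult_symp_form_index:
  assumes "M \<in> carrier_mat l (2*n)" "r < l" "s < 2*n"
  shows "(M * symp_form n) $$ (r,s) = - ((-1)^s * M $$ (r,2*n - Suc s))"
proof -
  have "(M * symp_form n) $$ (r,s) = (\<Sum>j<2*n. M $$ (r,j) * symp_form n $$ (j,s))"
    using assms by (intro mult_index_sum) auto
  also have "\<dots> = M $$ (r,2*n - Suc s) * symp_form n $$ (2*n - Suc s,s)"
    using assms by (intro sum_single_index) (auto simp: symp_form_index)
  finally show ?thesis using assms by (simp add: symp_form_index neg_one_power_mirror)
qed

lemma x_elt_Sp:
  assumes i: "i \<in> {1..n}"
  shows "x_elt n i t \<in> carrier (Sp n)"
proof -
  have "transpose_mat (chev_e n i) * symp_form n = - (symp_form n * chev_e n i)"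
  proof (rule mult_eqI[of _ n])
    fix r s assume rs: "r < 2*n" "s < 2*n"
    have "(transpose_mat (chev_e n i) * symp_form n) $$ (r,s) = - ((-1)^s * chev_e n i $$ (2*n - Suc s,r))"
      using rs by (subst mult_symp_form_index) auto
    moreover have "(- (symp_form n * chev_e n i)) $$ (r,s) = - ((-1)^r * chev_e n i $$ (2*n - Suc r,s))"
      using rs by (simp add: symp_form_mult_index[where l = "2*n"] carrier_matD[OF symp_form_carrier] del: index_mult_mat(1))
    moreover have "r = Suc (2*n - Suc s) \<longleftrightarrow> s = Suc (2*n - Suc r)" using rs by auto
    \<comment> \<open>Here r + s = 2n, so r and s have the same parity. The alternating signs of the
      form are what allows both entries of e_i to be one.\<close>
    moreover have "(-1::complex)^s = (-1)^r \<and> (dn n i r \<longleftrightarrow> dn n i s)" if "r = Suc (2*n - Suc s)"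
    proof -
      have "up n i (2*n - Suc s) \<longleftrightarrow> dn n i r" using that by (metis dn_Suc)
      then show ?thesis using up_mirror[OF i rs(2)] that rs
        by (cases "even s") auto
    qed
    ultimately show "(transpose_mat (chev_e n i) * symp_form n) $$ (r,s) = (- (symp_form n * chev_e n i)) $$ (r,s)"
      using rs up_mirror[OF i] by (auto simp: chev_e_index)
  qed auto
  then show ?thesis unfolding x_elt_eq[OF i]
    by (intro square_zero_Sp chev_e_square i) auto
qed

lemma y_elt_Sp:
  assumes i: "i \<in> {1..n}"
  shows "y_elt n i t \<in> carrier (Sp n)"
proof -
  have "transpose_mat (chev_f n i) * symp_form n = - (symp_form n * chev_f n i)"
  proof (rule mult_eqI[of _ n])
    fix r s assume rs: "r < 2*n" "s < 2*n"
    have "(transpose_mat (chev_f n i) * symp_form n) $$ (r,s) = - ((-1)^s * chev_f n i $$ (2*n - Suc s,r))"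
      using rs by (subst mult_symp_form_index) auto
    moreover have "(- (symp_form n * chev_f n i)) $$ (r,s) = - ((-1)^r * chev_f n i $$ (2*n - Suc r,s))"
      using rs by (simp add: symp_form_mult_index[where l = "2*n"] carrier_matD[OF symp_form_carrier] del: index_mult_mat(1))
    moreover have "2*n - Suc s = Suc r \<longleftrightarrow> 2*n - Suc r = Suc s" using rs by auto
    moreover have "(-1::complex)^s = (-1)^r \<and> (up n i r \<longleftrightarrow> up n i s)" if "2*n - Suc s = Suc r"
    proof -
      have "dn n i (2*n - Suc s) \<longleftrightarrow> up n i r" using that by (metis dn_Suc)
      moreover have "even s = even r" using that rs by presburger
      ultimately show ?thesis using dn_mirror[OF i rs(2)] by (cases "even s") auto
    qed
    ultimately show "(transpose_mat (chev_f n i) * symp_form n) $$ (r,s) = (- (symp_form n * chev_f n i)) $$ (r,s)"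
      using rs dn_mirror[OF i] by (auto simp: chev_f_index)
  qed auto
  then show ?thesis unfolding y_elt_eq[OF i]
    by (intro square_zero_Sp chev_f_square i) auto
qed

section \<open>The torus and its fundamental characters\<close>

lemma diagonal_Sp_iff:
  assumes t: "t \<in> carrier_mat (2*n) (2*n)" "diagonal_mat t"
  shows "t \<in> carrier (Sp n) \<longleftrightarrow> (\<forall>r<2*n. t $$ (r,r) * t $$ (2*n - Suc r,2*n - Suc r) = 1)"
proof -
  have d: "t $$ (r,s) = (if r = s then t $$ (r,r) else 0)" if "r < 2*n" "s < 2*n" for r s
    using t that unfolding diagonal_mat_def by auto
  have e: "(transpose_mat t * symp_form n * t) $$ (r,s)
      = (if s = 2*n - Suc r then (-1)^r * (t $$ (r,r) * t $$ (2*n - Suc r,2*n - Suc r)) else 0)"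
    if rs: "r < 2*n" "s < 2*n" for r s
  proof -
    have "(transpose_mat t * symp_form n * t) $$ (r,s)
      = (\<Sum>j<2*n. (transpose_mat t * symp_form n) $$ (r,j) * t $$ (j,s))"
      using t rs by (intro mult_index_sum[where k = "2*n" and l = "2*n"]) auto
    also have "\<dots> = (transpose_mat t * symp_form n) $$ (r,s) * t $$ (s,s)"
      using rs d by (intro sum_single_index) auto
    also have "(transpose_mat t * symp_form n) $$ (r,s) = - ((-1)^s * t $$ (2*n - Suc s, r))"
      using t rs by (subst mult_symp_form_index) auto
    also have "t $$ (2*n - Suc s, r) = (if s = 2*n - Suc r then t $$ (r,r) else 0)"
      using rs d[of "2*n - Suc s" r] by auto
    finally show ?thesis using rs by (auto simp: neg_one_power_mirror)
  qed
  have "transpose_mat t * symp_form n * t = symp_form n \<longleftrightarrow>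
    (\<forall>r<2*n. \<forall>s<2*n. (transpose_mat t * symp_form n * t) $$ (r,s) = symp_form n $$ (r,s))"
    using t by (intro iffI mult_eqI[of _ n]) auto
  also have "\<dots> \<longleftrightarrow> (\<forall>r<2*n. t $$ (r,r) * t $$ (2*n - Suc r,2*n - Suc r) = 1)"
    by (auto simp: e symp_form_index simp del: index_mult_mat(1))
  finally show ?thesis using t by (simp add: carrier_Sp)
qed

lemma torus_iff: "t \<in> torus n \<longleftrightarrow> t \<in> carrier_mat (2*n) (2*n) \<and> diagonal_mat t \<and>
    (\<forall>r<2*n. t $$ (r,r) * t $$ (2*n - Suc r,2*n - Suc r) = 1)"
  using diagonal_Sp_iff[of t n] Sp_mat[of t n] unfolding torus_def by auto

lemma torus_mult_index:
  assumes "t \<in> torus n" "M \<in> carrier_mat (2*n) l" "r < 2*n" "s < l"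
  shows "(t * M) $$ (r,s) = t $$ (r,r) * M $$ (r,s)"
proof -
  have "(t * M) $$ (r,s) = (\<Sum>j<2*n. t $$ (r,j) * M $$ (j,s))"
    using assms by (intro mult_index_sum) (auto simp: torus_iff)
  also have "\<dots> = t $$ (r,r) * M $$ (r,s)"
    using assms by (intro sum_single_index) (auto simp: torus_iff diagonal_mat_def)
  finally show ?thesis .
qed

lemma mult_torus_index:
  assumes "t \<in> torus n" "M \<in> carrier_mat l (2*n)" "r < l" "s < 2*n"
  shows "(M * t) $$ (r,s) = M $$ (r,s) * t $$ (s,s)"
proof -
  have "(M * t) $$ (r,s) = (\<Sum>j<2*n. M $$ (r,j) * t $$ (j,s))"
    using assms by (intro mult_index_sum) (auto simp: torus_iff)
  also have "\<dots> = M $$ (r,s) * t $$ (s,s)"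
    using assms by (intro sum_single_index) (auto simp: torus_iff diagonal_mat_def)
  finally show ?thesis .
qed

lemma torus_mat: "t \<in> torus n \<Longrightarrow> t \<in> carrier_mat (2*n) (2*n)"
  by (simp add: torus_iff)

lemma torus_one: "1\<^sub>m (2*n) \<in> torus n"
  by (auto simp: torus_iff diagonal_mat_def)

lemma torus_mult:
  assumes "s \<in> torus n" "t \<in> torus n"
  shows "s * t \<in> torus n"
proof -
  have "diagonal_mat (s * t)" unfolding diagonal_mat_def
    using assms torus_mat[OF assms(1)] torus_mat[OF assms(2)]
    by (auto simp: torus_mult_index[where l = "2*n"] torus_iff diagonal_mat_def simp del: index_mult_mat(1))
  then show ?thesis using assms Sp_mult_closed unfolding torus_def by auto
qed

lemma torus_nonzero: "t \<in> torus n \<Longrightarrow> r < 2*n \<Longrightarrow> t $$ (r,r) \<noteq> 0"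
  unfolding torus_iff by (metis mult_zero_left zero_neq_one)

lemma coroot_index:
  assumes "r < 2*n" "s < 2*n"
  shows "coroot n i c $$ (r,s) = (if r = s then if up n i r then c else if dn n i r then inverse c else 1 else 0)"
  using assms by (simp add: coroot_def mat_diag_def h_eigenvalue_up_dn power_int_minus)

lemma coroot_torus:
  assumes "i \<in> {1..n}" "c \<noteq> 0"
  shows "coroot n i c \<in> torus n"
  unfolding torus_iff diagonal_mat_def
  using assms up_mirror[OF assms(1)] dn_mirror[OF assms(1)] up_not_dn[of n i]
    carrier_matD[OF coroot_carrier[of n i c]]
  by (auto simp: coroot_index)

lemma torus_eqI:
  assumes "s \<in> torus n" "t \<in> torus n" "\<And>r. r < n \<Longrightarrow> s $$ (r,r) = t $$ (r,r)"
  shows "s = t"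
proof (rule mult_eqI[of _ n])
  fix r r' assume r: "r < 2*n" "r' < 2*n"
  have "s $$ (r,r) = t $$ (r,r)"
  proof (cases "r < n")
    case False
    then have m: "2*n - Suc r < n" "2*n - Suc r < 2*n" using r by auto
    have "s $$ (r,r) * s $$ (2*n - Suc r,2*n - Suc r) = t $$ (r,r) * t $$ (2*n - Suc r,2*n - Suc r)"
      using assms(1,2) r(1) unfolding torus_iff by metis
    then show ?thesis using assms(3)[OF m(1)] torus_nonzero[OF assms(2) m(2)] by simp
  qed (rule assms(3))
  then show "s $$ (r,r') = t $$ (r,r')"
    using assms(1,2) r unfolding torus_iff diagonal_mat_def by (cases "r = r'") auto
qed (use assms in \<open>auto simp: torus_iff\<close>)

text \<open>In standard coordinates \<Lambda>_k = eps_1 + ... + eps_k. The restriction makes the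
  function extensional, as \<open>fund_weight\<close> demands.\<close>

definition torus_char :: "nat \<Rightarrow> nat \<Rightarrow> complex mat \<Rightarrow> complex" where
  "torus_char n k = restrict (\<lambda>t. \<Prod>r<k. t $$ (r,r)) (torus n)"

lemma torus_char_coroot:
  assumes j: "j \<in> {1..n}" and k: "k \<le> n" and c: "c \<noteq> 0"
  shows "torus_char n k (coroot n j c) = (if k = j then c else 1)"
proof -
  have "torus_char n k (coroot n j c) = (\<Prod>r<k. coroot n j c $$ (r,r))"
    using coroot_torus[OF j c] by (simp add: torus_char_def)
  also have "\<dots> = (\<Prod>r<k. (if r = j - 1 then c else 1) * (if r = j then inverse c else 1))"
  proof (rule prod.cong)
    fix r assume "r \<in> {..<k}"
    then have r: "r < n" "r < 2*n" using k by auto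
    have "up n j r \<longleftrightarrow> r = j - 1" "dn n j r \<longleftrightarrow> r = j"
      using r j unfolding up_def dn_def by auto
    then show "coroot n j c $$ (r,r) = (if r = j - 1 then c else 1) * (if r = j then inverse c else 1)"
      using r j by (auto simp: coroot_index)
  qed simp
  \<comment> \<open>Coroot j has c at index j - 1 and the inverse of c at index j; the two cancel
    unless k = j separates them.\<close>
  also have "\<dots> = (if j - 1 < k then c else 1) * (if j < k then inverse c else 1)"
    by (simp add: prod.distrib prod.delta)
  also have "\<dots> = (if k = j then c else 1)"
  proof -
    consider "k = j" | "k < j" | "j < k" by linarith
    then show ?thesis by cases (use j c in auto)
  qed
  finally show ?thesis .
qed

text \<open>For uniqueness, every torus element is written as a product of coroot values, so that a
  character is known once its values on the coroot subgroups are. This is simple connectedness made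
  explicit.\<close>

lemma fund_weight_eq:
  assumes k: "k \<in> {1..n}"
  shows "fund_weight n k = torus_char n k"
  unfolding fund_weight_def
proof (rule the_equality)
  have "torus_char n k (s * t) = torus_char n k s * torus_char n k t" if "s \<in> torus n" "t \<in> torus n" for s t
  proof -
    have "(s * t) $$ (r,r) = s $$ (r,r) * t $$ (r,r)" if "r < k" for r
      using \<open>s \<in> torus n\<close> torus_mat[OF \<open>t \<in> torus n\<close>] that k
      by (simp add: torus_mult_index[where l = "2*n"] del: index_mult_mat(1))
    then show ?thesis using that torus_mult by (simp add: torus_char_def prod.distrib)
  qed
  moreover have "torus_char n k \<in> torus n \<rightarrow>\<^sub>E UNIV - {0}"
  proof (rule PiE_I)
    fix t assume t: "t \<in> torus n"
    then have "t $$ (r,r) \<noteq> 0" if "r < k" for r using torus_nonzero[OF t, of r] k that by auto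
    then show "torus_char n k t \<in> UNIV - {0}" using t by (simp add: torus_char_def)
  qed (simp add: torus_char_def)
  ultimately show "torus_char n k \<in> torus n \<rightarrow>\<^sub>E UNIV - {0} \<and>
     (\<forall>s \<in> torus n. \<forall>t \<in> torus n. torus_char n k (s * t) = torus_char n k s * torus_char n k t) \<and>
     (\<forall>j \<in> {1..n}. \<forall>c. c \<noteq> 0 \<longrightarrow> torus_char n k (coroot n j c) = (if k = j then c else 1))"
    using torus_char_coroot k by auto
next
  fix \<chi> assume \<chi>: "\<chi> \<in> torus n \<rightarrow>\<^sub>E UNIV - {0} \<and>
     (\<forall>s \<in> torus n. \<forall>t \<in> torus n. \<chi> (s * t) = \<chi> s * \<chi> t) \<and>
     (\<forall>j \<in> {1..n}. \<forall>c. c \<noteq> 0 \<longrightarrow> \<chi> (coroot n j c) = (if k = j then c else 1))"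
  have \<chi>1: "\<chi> (1\<^sub>m (2*n)) = 1"
  proof -
    have "\<chi> (1\<^sub>m (2*n) * 1\<^sub>m (2*n)) = \<chi> (1\<^sub>m (2*n)) * \<chi> (1\<^sub>m (2*n))" using \<chi> torus_one by blast
    moreover have "\<chi> (1\<^sub>m (2*n)) \<noteq> 0" using \<chi> torus_one[of n] by (auto simp: PiE_def Pi_def)
    ultimately show ?thesis by simp
  qed
  have eq: "\<chi> t = torus_char n k t" if t: "t \<in> torus n" for t
  proof -
    \<comment> \<open>The parameters solve a_(r+1) / a_r = t_r with a_0 = 1: at entry r, coroot r +
      1 contributes a_(r+1) and coroot r contributes the inverse of a_r.\<close>
    define a where "a j = (\<Prod>r<j. t $$ (r,r))" for j
    define T where "T = rec_nat (1\<^sub>m (2*n)) (\<lambda>m M. coroot n (Suc m) (a (Suc m)) * M)"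
    have T0: "T 0 = 1\<^sub>m (2*n)" and TS: "T (Suc m) = coroot n (Suc m) (a (Suc m)) * T m" for m
      unfolding T_def by auto
    have a: "a j \<noteq> 0" if "j \<le> n" for j
      using torus_nonzero[OF t] that unfolding a_def by auto
    have Tt: "T m \<in> torus n" if "m \<le> n" for m
      using that by (induction m) (auto simp: T0 TS torus_one a intro!: torus_mult coroot_torus)
    have \<chi>T: "\<chi> (T m) = (if k \<le> m then a k else 1)" if "m \<le> n" for m
      using that
    proof (induction m)
      case (Suc m)
      have "\<chi> (T (Suc m)) = \<chi> (coroot n (Suc m) (a (Suc m))) * \<chi> (T m)"
        using \<chi> Suc.prems Tt[of m] coroot_torus[of "Suc m" n "a (Suc m)"] a[of "Suc m"]
        unfolding TS by simp
      also have "\<chi> (coroot n (Suc m) (a (Suc m))) = (if k = Suc m then a (Suc m) else 1)"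
        using \<chi> Suc.prems a[of "Suc m"] by simp
      finally show ?case using Suc by (cases "k = Suc m") auto
    qed (use k in \<open>auto simp: T0 \<chi>1\<close>)
    \<comment> \<open>After m coroots the entries with 0 < r < m have received both factors, entry m
      so far only the inverse one.\<close>
    have ent: "T m $$ (r,r) = (if r < m then a (Suc r) else 1) * (if r < m \<and> 0 < r \<or> r = m \<and> 0 < r then inverse (a r) else 1)"
      if "m \<le> n" "r < n" for m r
      using that(1)
    proof (induction m)
      case 0
      then show ?case using that(2) by (auto simp: T0)
    next
      case (Suc m)
      have "up n (Suc m) r \<longleftrightarrow> r = m" "dn n (Suc m) r \<longleftrightarrow> r = Suc m"
        using that(2) Suc.prems unfolding up_def dn_def by auto
      moreover have "T (Suc m) $$ (r,r) = (if up n (Suc m) r then a (Suc m) else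
          if dn n (Suc m) r then inverse (a (Suc m)) else 1) * T m $$ (r,r)"
        unfolding TS using Tt[of m] Suc.prems that(2)
        by (intro coroot_mult_index[where l = "2*n"]) (auto simp: torus_iff)
      ultimately show ?case using Suc by auto
    qed
    have "T n = t"
    proof (rule torus_eqI[OF Tt t])
      fix r assume r: "r < n"
      have "a (Suc r) = t $$ (r,r) * a r" by (simp add: a_def)
      moreover have "a 0 = 1" by (simp add: a_def)
      ultimately show "T n $$ (r,r) = t $$ (r,r)" using ent[of n r] r a[of r] by auto
    qed simp
    then show ?thesis using \<chi>T[of n] k t by (simp add: torus_char_def a_def)
  qed
  show "\<chi> = torus_char n k"
  proof
    fix t show "\<chi> t = torus_char n k t"
      using eq \<chi> by (cases "t \<in> torus n") (auto simp: torus_char_def PiE_def extensional_def)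
  qed
qed

section \<open>Lifts as signed permutation matrices\<close>

lemma s_bar_carrier [simp]: "s_bar n i \<in> carrier_mat (2*n) (2*n)"
  unfolding s_bar_def by simp

lemma s_bar_mult_index:
  assumes i: "i \<in> {1..n}" and M: "M \<in> carrier_mat (2*n) l" and rs: "r < 2*n" "s < l"
  shows "(s_bar n i * M) $$ (r,s) =
    (if up n i r then - M $$ (Suc r,s) else if dn n i r then M $$ (r - 1,s) else M $$ (r,s))"
proof -
  let ?N = "x_elt n i (-1) * M"
  let ?N' = "y_elt n i 1 * ?N"
  have N: "?N \<in> carrier_mat (2*n) l" "?N' \<in> carrier_mat (2*n) l"
    using M by (meson mult_carrier_mat x_elt_carrier y_elt_carrier)+
  have "s_bar n i * M = x_elt n i (-1) * ?N'"
    unfolding s_bar_def using M assoc_mult_mat[OF x_elt_carrier[of n i "-1"] y_elt_carrier[of n i 1] N(1)]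
    by (simp add: assoc_mult_mat[of _ "2*n" "2*n" _ "2*n" _ l])
  then have *: "(s_bar n i * M) $$ (r,s) = ?N' $$ (r,s) + (if up n i r then - 1 * ?N' $$ (Suc r,s) else 0)"
    using x_elt_mult_index[OF i N(2) rs] by simp
  note N' = y_elt_mult_index[OF i N(1) _ rs(2), where t = 1]
  note N1 = x_elt_mult_index[OF i M _ rs(2), where t = "-1"]
  consider (up) "up n i r" | (dn) "dn n i r" | (none) "\<not> up n i r" "\<not> dn n i r" by blast
  then show ?thesis
  proof cases
    case up
    have "\<not> dn n i r" "Suc r < 2*n" "\<not> up n i (Suc r)"
      using up up_not_dn up_less[OF i up] dn_Suc by blast+
    then show ?thesis using up rs * by (simp add: N' N1 del: index_mult_mat(1))
  next
    case dn
    obtain r' where r': "r = Suc r'" using dn_pos[OF i rs(1) dn] by (metis not0_implies_Suc neq0_conv)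
    then have "up n i r'" "r' < 2*n" "\<not> up n i (Suc r')" using dn rs up_not_dn[of n i "Suc r'"] by auto
    then show ?thesis using rs * unfolding r' by (simp add: N' N1 del: index_mult_mat(1))
  next
    case none
    then show ?thesis using rs * by (simp add: N' N1 del: index_mult_mat(1))
  qed
qed

text \<open>The sign of row r counts inversions in the symmetric group on all 2n letters, not in
  type C; both members of a mirror pair count.\<close>

definition perm_lift :: "nat \<Rightarrow> (nat \<Rightarrow> nat) \<Rightarrow> complex mat" where
  "perm_lift n q = mat (2*n) (2*n) (\<lambda>(r,s). if s = q r then (-1) ^ inv_count (2*n) q r else 0)"

lemma perm_lift_carrier [simp]: "perm_lift n q \<in> carrier_mat (2*n) (2*n)"
  by (simp add: perm_lift_def)

text \<open>At an ascent, a row moved up from r + 1 to r gains one inversion and a row moved down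
  keeps its count. The gaining rows are exactly those that \<open>s_bar\<close> negates, which is
  the origin of the sign rule.\<close>

lemma inv_count_sg:
  assumes q: "sym_perm n q" and i: "i \<in> {1..n}" and less: "q (i - 1) < q i"
  shows "inv_count (2*n) (q \<circ> sg n i) r = (if up n i r then inv_count (2*n) q (Suc r) + 1
     else if dn n i r then inv_count (2*n) q (r - 1) else inv_count (2*n) q r)"
proof (cases "i = n")
  case True
  have "sg n i = swap_adj (n - 1)" using True sg_last i by auto
  moreover have "n - 1 + 1 = n" using i True by auto
  moreover have "up n i r \<longleftrightarrow> r = n - 1" "dn n i r \<longleftrightarrow> r = n"
    using i True unfolding up_def dn_def by auto
  ultimately show ?thesis
    using inv_count_swap[of "n - 1" "2*n" q r] less i True by auto
next
  case False
  then have i': "i < n" using i by auto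
  define a b where "a = i - 1" and "b = 2*n - Suc i"
  have ab: "i = Suc a" "2*n - i = Suc b" "2*n - Suc i = b" "Suc a < b" "Suc b < 2*n"
    using i i' unfolding a_def b_def by auto
  have s: "sg n i = swap_adj a \<circ> swap_adj b" using sg_short[OF i i'] unfolding ab(3) a_def .
  let ?q = "q \<circ> swap_adj a"
  have q': "?q b < ?q (b + 1)"
    using sym_perm_mirror_less[OF q i less] ab(4) unfolding ab(2,3) by (simp add: swap_adj_def)
  have ud: "up n i r \<longleftrightarrow> r = a \<or> r = b" "dn n i r \<longleftrightarrow> r = Suc a \<or> r = Suc b"
    using ab(1-3,5) unfolding up_def dn_def by auto
  have 1: "inv_count (2*n) ?q r = (if r = a then inv_count (2*n) q (a + 1) + 1
     else if r = a + 1 then inv_count (2*n) q a else inv_count (2*n) q r)" for r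
    using less ab by (intro inv_count_swap) auto
  have "inv_count (2*n) (?q \<circ> swap_adj b) r = (if r = b then inv_count (2*n) ?q (b + 1) + 1
     else if r = b + 1 then inv_count (2*n) ?q b else inv_count (2*n) ?q r)"
    using q' ab by (intro inv_count_swap) auto
  then show ?thesis unfolding s comp_assoc[symmetric] ud 1 using ab(4) by auto
qed

lemma s_bar_perm_lift:
  assumes q: "sym_perm n q" and i: "i \<in> {1..n}" and less: "q (i - 1) < q i"
  shows "s_bar n i * perm_lift n q = perm_lift n (q \<circ> sg n i)"
proof (rule mult_eqI[of _ n])
  fix r s assume rs: "r < 2*n" "s < 2*n"
  have *: "(s_bar n i * perm_lift n q) $$ (r,s) = (if up n i r then - perm_lift n q $$ (Suc r,s)
      else if dn n i r then perm_lift n q $$ (r - 1,s) else perm_lift n q $$ (r,s))"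
    using rs by (intro s_bar_mult_index[OF i, where l = "2*n"]) auto
  have "Suc r < 2*n" if "up n i r" using up_less[OF i that] .
  then show "(s_bar n i * perm_lift n q) $$ (r,s) = perm_lift n (q \<circ> sg n i) $$ (r,s)"
    unfolding * using rs by (auto simp: perm_lift_def inv_count_sg[OF q i less] sg_up_dn)
qed auto

text \<open>Reducedness makes every prepended letter an ascent, so the sign rule applies at each
  step. The right-hand side depends on the word through its permutation only, so the choice made in
  \<open>weyl_lift\<close> is harmless.\<close>

lemma foldr_s_bar_reduced:
  assumes "is \<in> lists {1..n}" "2 * length is = len2 n (pos n is)"
  shows "foldr (\<lambda>i g. s_bar n i * g) is (1\<^sub>m (2*n)) = perm_lift n (pos n is)"
  using assms
proof (induction "is")
  case Nil
  have "pos n [] = (\<lambda>r. r)" by auto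
  moreover have "inv_count (2*n) (\<lambda>r. r) r = 0" for r by (simp add: inv_count_def)
  ultimately show ?case by (intro mult_eqI[of _ n]) (auto simp: perm_lift_def)
next
  case (Cons i js)
  have "i # js \<in> lists {1..n}" using Cons.hyps by simp
  note red = reduced_word_Cons[OF this Cons.prems]
  have "foldr (\<lambda>i g. s_bar n i * g) (i # js) (1\<^sub>m (2*n)) = s_bar n i * perm_lift n (pos n js)"
    using Cons.IH red(2) by simp
  also have "\<dots> = perm_lift n (pos n (i # js))"
    unfolding pos_Cons_comp using Cons.hyps red(1) by (intro s_bar_perm_lift sym_perm_pos) auto
  finally show ?case .
qed

lemma weyl_lift_word:
  assumes "is \<in> lists {1..n}"
  shows "weyl_lift n (word_elt n is) = perm_lift n (pos n is)"
proof -
  define js where "js = (SOME js. reduced_word n (word_elt n is) js)"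
  have "reduced_word n (word_elt n is) js"
    unfolding js_def using exists_reduced_word[OF assms] by (rule someI_ex)
  then have js: "js \<in> lists {1..n}" "\<forall>r<2*n. pos n js r = pos n is r" "2 * length js = len2 n (pos n js)"
    using reduced_word_iff[OF assms] by auto
  have "inv_count (2*n) (pos n js) r = inv_count (2*n) (pos n is) r" if "r < 2*n" for r
    unfolding inv_count_def using js(2) that by (intro arg_cong[where f = card]) auto
  then have "perm_lift n (pos n js) = perm_lift n (pos n is)"
    using js(2) by (intro mult_eqI[of _ n]) (auto simp: perm_lift_def)
  then show ?thesis
    using foldr_s_bar_reduced[OF js(1,3)] unfolding weyl_lift_def js_def by simp
qed

lemma weyl_lift_longest: "weyl_lift n (longest_elt n) = - symp_form n"
proof -
  obtain "is" where is_l: "is \<in> lists {1..n}" and rev: "\<And>r. r < 2*n \<Longrightarrow> pos n is r = 2*n - Suc r"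
    using exists_longest_word[of n] by auto
  have "inv_count (2*n) (pos n is) r = 2*n - Suc r" if "r < 2*n" for r
  proof -
    have "{r'. r < r' \<and> r' < 2*n \<and> pos n is r' < pos n is r} = {r<..<2*n}" using rev that by auto
    then show ?thesis by (simp add: inv_count_def)
  qed
  \<comment> \<open>There are 2n - 1 - r inversions at r, so row r has sign -(-1)^r and the lift is
    -J, the inverse of J.\<close>
  then have "perm_lift n (pos n is) = - symp_form n"
    using rev by (intro mult_eqI[of _ n]) (auto simp: perm_lift_def symp_form_index neg_one_power_mirror)
  then show ?thesis using longest_elt_eq[OF is_l] rev weyl_lift_word[OF is_l] by simp
qed

lemma weyl_lift_simple_refl:
  assumes k: "k \<in> {1..n}"
  shows "weyl_lift n (simple_refl n k) = s_bar n k"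
proof -
  have "simple_refl n k = word_elt n [k]" by (auto simp: word_elt_def)
  moreover have "len2 n (pos n [k]) = 2"
  proof -
    have "sym_perm n (pos n [])" by (rule sym_perm_pos) simp
    then have "len2 n (pos n [k]) = len2 n (pos n []) + 2"
      unfolding pos_Cons_comp using k by (intro len2_ascent) auto
    moreover have "pos n [] = (\<lambda>r. r)" by auto
    ultimately show ?thesis by (simp add: len2_id del: pos.simps)
  qed
  ultimately show ?thesis
    using weyl_lift_word[of "[k]" n] foldr_s_bar_reduced[of "[k]" n] k
      right_mult_one_mat[OF s_bar_carrier[of n k]] by (simp del: pos.simps)
qed

section \<open>Principal minors are leading minors\<close>

definition lead_mat :: "nat \<Rightarrow> complex mat \<Rightarrow> complex mat" where
  "lead_mat k g = mat k k (\<lambda>(r,s). g $$ (r,s))"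

definition lead_minor :: "nat \<Rightarrow> complex mat \<Rightarrow> complex" where
  "lead_minor k g = det (lead_mat k g)"

lemma poly_funs_sum:
  assumes "finite A" "\<And>a. a \<in> A \<Longrightarrow> (\<lambda>g. f a g) \<in> poly_funs d"
  shows "(\<lambda>g. \<Sum>a\<in>A. f a g) \<in> poly_funs d"
  using assms by (induction A rule: finite_induct) (auto intro: poly_funs.intros)

lemma poly_funs_prod:
  assumes "finite A" "\<And>a. a \<in> A \<Longrightarrow> (\<lambda>g. f a g) \<in> poly_funs d"
  shows "(\<lambda>g. \<Prod>a\<in>A. f a g) \<in> poly_funs d"
  using assms by (induction A rule: finite_induct) (auto intro: poly_funs.intros)

lemma lead_minor_poly_funs:
  assumes "k \<le> d"
  shows "lead_minor k \<in> poly_funs d"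
proof -
  have "lead_minor k = (\<lambda>g. \<Sum>p\<in>{p. p permutes {0..<k}}. signof p * (\<Prod>r\<in>{0..<k}. g $$ (r, p r)))"
  proof
    fix g
    have "lead_minor k g = (\<Sum>p\<in>{p. p permutes {0..<k}}. signof p * (\<Prod>r\<in>{0..<k}. lead_mat k g $$ (r, p r)))"
      unfolding lead_minor_def by (rule det_def') (simp add: lead_mat_def)
    also have "\<dots> = (\<Sum>p\<in>{p. p permutes {0..<k}}. signof p * (\<Prod>r\<in>{0..<k}. g $$ (r, p r)))"
    proof (intro sum.cong prod.cong refl arg_cong2[where f = "(*)"])
      fix p r assume "p \<in> {p. p permutes {0..<k}}" "r \<in> {0..<k}"
      then have "p r < k" "r < k" using permutes_in_image[of p "{0..<k}" r] by auto
      then show "lead_mat k g $$ (r, p r) = g $$ (r, p r)" by (simp add: lead_mat_def)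
    qed
    finally show "lead_minor k g = (\<Sum>p\<in>{p. p permutes {0..<k}}. signof p * (\<Prod>r\<in>{0..<k}. g $$ (r, p r)))" .
  qed
  moreover have "(\<lambda>g. signof p * (\<Prod>r\<in>{0..<k}. g $$ (r, p r))) \<in> poly_funs d" if "p permutes {0..<k}" for p
  proof -
    have "p r < d" if "r \<in> {0..<k}" for r
      using permutes_in_image[OF \<open>p permutes {0..<k}\<close>, of r] that assms by auto
    then show ?thesis using assms by (intro poly_funs.mult poly_funs.const poly_funs_prod poly_funs.entry) auto
  qed
  ultimately show ?thesis by (auto intro!: poly_funs_sum finite_permutations)
qed

lemma Sp_inv_eqI:
  assumes "g \<in> carrier (Sp n)" "h \<in> carrier (Sp n)" "h * g = 1\<^sub>m (2*n)"
  shows "inv\<^bsub>Sp n\<^esub> g = h"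
  by (rule group.inv_equality[OF group_Sp]) (use assms in simp_all)

lemma inv_y_elt: "i \<in> {1..n} \<Longrightarrow> inv\<^bsub>Sp n\<^esub> (y_elt n i t) = y_elt n i (-t)"
  by (rule Sp_inv_eqI) (auto simp: y_elt_Sp y_elt_add y_elt_0)

lemma inv_x_elt: "i \<in> {1..n} \<Longrightarrow> inv\<^bsub>Sp n\<^esub> (x_elt n i t) = x_elt n i (-t)"
  by (rule Sp_inv_eqI) (auto simp: x_elt_Sp x_elt_add x_elt_0)

section \<open>The unipotent subgroups and leading minors on the big cell\<close>

lemma Uminus_one: "1\<^sub>m (2*n) \<in> Uminus n"
  using generate.one[of "Sp n"] unfolding Uminus_def by simp

lemma Uminus_y: "i \<in> {1..n} \<Longrightarrow> y_elt n i t \<in> Uminus n"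
  unfolding Uminus_def by (rule generate.incl) blast

lemma Uminus_mult: "u \<in> Uminus n \<Longrightarrow> v \<in> Uminus n \<Longrightarrow> u * v \<in> Uminus n"
  using generate.eng[of u "Sp n" _ v] unfolding Uminus_def by simp

lemma Uplus_one: "1\<^sub>m (2*n) \<in> Uplus n"
  using generate.one[of "Sp n"] unfolding Uplus_def by simp

lemma Uplus_x: "i \<in> {1..n} \<Longrightarrow> x_elt n i t \<in> Uplus n"
  unfolding Uplus_def by (rule generate.incl) blast

lemma Uplus_mult: "u \<in> Uplus n \<Longrightarrow> v \<in> Uplus n \<Longrightarrow> u * v \<in> Uplus n"
  using generate.eng[of u "Sp n" _ v] unfolding Uplus_def by simp

text \<open>Inverses of generators are again generators, so the induction rule gets by without a
  case for inverses.\<close>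

lemma Uminus_induct [consumes 1, case_names one gen mult]:
  assumes "u \<in> Uminus n" "P (1\<^sub>m (2*n))" "\<And>i t. i \<in> {1..n} \<Longrightarrow> P (y_elt n i t)"
    "\<And>u v. u \<in> Uminus n \<Longrightarrow> P u \<Longrightarrow> v \<in> Uminus n \<Longrightarrow> P v \<Longrightarrow> P (u * v)"
  shows "P u"
  using assms(1) unfolding Uminus_def
proof (induction rule: generate.induct)
  case (inv h)
  then obtain i t where "i \<in> {1..n}" "h = y_elt n i t" by blast
  then show ?case using assms(3) by (simp add: inv_y_elt)
next
  case (eng h1 h2)
  then show ?case using assms(4)[of h1 h2] unfolding Uminus_def by simp
qed (use assms in auto)

lemma Uplus_induct [consumes 1, case_names one gen mult]:
  assumes "u \<in> Uplus n" "P (1\<^sub>m (2*n))" "\<And>i t. i \<in> {1..n} \<Longrightarrow> P (x_elt n i t)"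
    "\<And>u v. u \<in> Uplus n \<Longrightarrow> P u \<Longrightarrow> v \<in> Uplus n \<Longrightarrow> P v \<Longrightarrow> P (u * v)"
  shows "P u"
  using assms(1) unfolding Uplus_def
proof (induction rule: generate.induct)
  case (inv h)
  then obtain i t where "i \<in> {1..n}" "h = x_elt n i t" by blast
  then show ?case using assms(3) by (simp add: inv_x_elt)
next
  case (eng h1 h2)
  then show ?case using assms(4)[of h1 h2] unfolding Uplus_def by simp
qed (use assms in auto)

lemma Uminus_Sp: "u \<in> Uminus n \<Longrightarrow> u \<in> carrier (Sp n)"
  by (induction rule: Uminus_induct) (auto simp: y_elt_Sp Sp_mult_closed intro: torus_one[unfolded torus_def, THEN CollectD, THEN conjunct1])

lemma Uplus_Sp: "u \<in> Uplus n \<Longrightarrow> u \<in> carrier (Sp n)"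
  by (induction rule: Uplus_induct) (auto simp: x_elt_Sp Sp_mult_closed intro: torus_one[unfolded torus_def, THEN CollectD, THEN conjunct1])

lemma torus_Sp: "t \<in> torus n \<Longrightarrow> t \<in> carrier (Sp n)"
  by (simp add: torus_def)

definition lower_uni :: "nat \<Rightarrow> complex mat \<Rightarrow> bool" where
  "lower_uni m g \<longleftrightarrow> g \<in> carrier_mat m m \<and> (\<forall>r<m. g $$ (r,r) = 1) \<and> (\<forall>r<m. \<forall>s<m. r < s \<longrightarrow> g $$ (r,s) = 0)"

lemma lower_uni_mult:
  assumes "lower_uni m g" "lower_uni m h"
  shows "lower_uni m (g * h)"
proof -
  have c: "g \<in> carrier_mat m m" "h \<in> carrier_mat m m" using assms by (auto simp: lower_uni_def)
  have "(g * h) $$ (r,s) = (if r = s then 1 else 0)" if "r < m" "s < m" "r \<le> s" for r s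
  proof -
    have "(g * h) $$ (r,s) = (\<Sum>j<m. g $$ (r,j) * h $$ (j,s))" using c that by (intro mult_index_sum) auto
    also have "\<dots> = g $$ (r,r) * h $$ (r,s)"
    proof (rule sum_single_index)
      fix j assume "j < m" "j \<noteq> r"
      then show "g $$ (r,j) * h $$ (j,s) = 0"
        using assms that unfolding lower_uni_def by (cases "j < r") auto
    qed (use that in auto)
    also have "\<dots> = (if r = s then 1 else 0)" using assms that unfolding lower_uni_def by auto
    finally show ?thesis .
  qed
  then show ?thesis using c unfolding lower_uni_def by (auto simp del: index_mult_mat(1))
qed

lemma Uminus_lower_uni: "u \<in> Uminus n \<Longrightarrow> lower_uni (2*n) u"
proof (induction rule: Uminus_induct)
  case (gen i t)
  then show ?case by (auto simp: lower_uni_def y_elt_index)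
qed (auto simp: lower_uni_mult, auto simp: lower_uni_def)

lemma Uplus_lower_uni: "u \<in> Uplus n \<Longrightarrow> lower_uni (2*n) (transpose_mat u)"
proof (induction rule: Uplus_induct)
  case (gen i t)
  then show ?case by (auto simp: lower_uni_def x_elt_index carrier_matD[OF x_elt_carrier])
next
  case (mult u v)
  then show ?case
    using transpose_mult[OF Sp_mat[OF Uplus_Sp[OF mult(1)]] Sp_mat[OF Uplus_Sp[OF mult(2)]]]
    by (simp add: lower_uni_mult)
qed (auto simp: lower_uni_def)

lemma lead_mat_carrier [simp]: "lead_mat k g \<in> carrier_mat k k"
  by (simp add: lead_mat_def)

text \<open>In the rows above k, a lower triangular left factor vanishes from column k on, so the
  product sees only the leading block of the right factor.\<close>

lemma lead_mat_lower_mult: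
  assumes g: "lower_uni m g" and h: "h \<in> carrier_mat m m" and k: "k \<le> m"
  shows "lead_mat k (g * h) = lead_mat k g * lead_mat k h"
proof (rule eq_matI)
  fix r s assume "r < dim_row (lead_mat k g * lead_mat k h)" "s < dim_col (lead_mat k g * lead_mat k h)"
  then have rs: "r < k" "s < k" by (auto simp: lead_mat_def)
  have gc: "g \<in> carrier_mat m m" using g by (simp add: lower_uni_def)
  have "lead_mat k (g * h) $$ (r,s) = (\<Sum>j<m. g $$ (r,j) * h $$ (j,s))"
    using rs k mult_index_sum[OF gc h, of r s] by (simp add: lead_mat_def del: index_mult_mat(1))
  also have "\<dots> = (\<Sum>j<k. g $$ (r,j) * h $$ (j,s))"
    by (rule sum.mono_neutral_right) (use rs k g in \<open>auto simp: lower_uni_def\<close>)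
  also have "\<dots> = (\<Sum>j<k. lead_mat k g $$ (r,j) * lead_mat k h $$ (j,s))"
    using rs by (intro sum.cong refl) (auto simp: lead_mat_def)
  also have "\<dots> = (lead_mat k g * lead_mat k h) $$ (r,s)"
    using rs by (intro mult_index_sum[symmetric]) auto
  finally show "lead_mat k (g * h) $$ (r,s) = (lead_mat k g * lead_mat k h) $$ (r,s)" .
qed (auto simp: lead_mat_def)

lemma lead_minor_lower_mult:
  assumes g: "lower_uni m g" and h: "h \<in> carrier_mat m m" and k: "k \<le> m"
  shows "lead_minor k (g * h) = lead_minor k h"
proof -
  have "det (lead_mat k g) = prod_list (diag_mat (lead_mat k g))"
    by (rule det_lower_triangular[where n = k]) (use g k in \<open>auto simp: lead_mat_def lower_uni_def\<close>)
  also have "\<dots> = 1"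
    unfolding prod_list_diag_prod using g k by (intro prod.neutral) (auto simp: lead_mat_def lower_uni_def)
  finally show ?thesis unfolding lead_minor_def lead_mat_lower_mult[OF assms]
    by (simp add: det_mult[of _ k])
qed

lemma lead_minor_transpose:
  assumes "g \<in> carrier_mat m m" "k \<le> m"
  shows "lead_minor k (transpose_mat g) = lead_minor k g"
proof -
  have "lead_mat k (transpose_mat g) = transpose_mat (lead_mat k g)"
    using assms by (intro eq_matI) (auto simp: lead_mat_def)
  then show ?thesis using det_transpose[OF lead_mat_carrier[of k g]] by (simp add: lead_minor_def)
qed

text \<open>The left factor drops out directly. The right factor drops out after transposition,
  which makes it a lower unitriangular left factor.\<close>

lemma lead_minor_big_cell:
  assumes u: "u \<in> Uminus n" and t: "t \<in> torus n" and v: "v \<in> Uplus n" and k: "k \<in> {1..n}"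
  shows "lead_minor k (u * t * v) = torus_char n k t"
proof -
  have c: "u \<in> carrier_mat (2*n) (2*n)" "t \<in> carrier_mat (2*n) (2*n)" "v \<in> carrier_mat (2*n) (2*n)"
    using assms Uminus_Sp Uplus_Sp Sp_mat torus_mat by auto
  have k': "k \<le> 2*n" using k by auto
  have "lead_minor k (u * t * v) = lead_minor k (u * (t * v))"
    using c by (simp add: assoc_mult_mat[of _ "2*n" "2*n" _ "2*n" _ "2*n"])
  also have "\<dots> = lead_minor k (t * v)"
    using c k' Uminus_lower_uni[OF u] by (intro lead_minor_lower_mult[of "2*n"]) auto
  also have "\<dots> = lead_minor k (transpose_mat (t * v))"
    using c k' lead_minor_transpose[of "t * v" "2*n" k] by simp
  also have "transpose_mat (t * v) = transpose_mat v * transpose_mat t"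
    using c by (intro transpose_mult) auto
  also have "lead_minor k \<dots> = lead_minor k (transpose_mat t)"
    using c k' Uplus_lower_uni[OF v] by (intro lead_minor_lower_mult[of "2*n"]) auto
  also have "\<dots> = prod_list (diag_mat (lead_mat k (transpose_mat t)))"
    unfolding lead_minor_def
    by (rule det_lower_triangular[where n = k])
      (use t k' in \<open>auto simp: lead_mat_def torus_iff diagonal_mat_def\<close>)
  also have "\<dots> = (\<Prod>r<k. t $$ (r,r))"
    unfolding prod_list_diag_prod lessThan_atLeast0
    using c k' by (intro prod.cong) (auto simp: lead_mat_def)
  finally show ?thesis using t by (simp add: torus_char_def)
qed

section \<open>The big cell and its Zariski closure\<close>

definition big_cell :: "nat \<Rightarrow> complex mat set" where
  "big_cell n = {u * t * v | u t v. u \<in> Uminus n \<and> t \<in> torus n \<and> v \<in> Uplus n}"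

text \<open>This is the Zariski closure of the cell in the space of all square matrices, so that
  only polynomial functions of the entries enter.\<close>

definition cell_closure :: "nat \<Rightarrow> complex mat set" where
  "cell_closure n = {g \<in> carrier_mat (2*n) (2*n).
     \<forall>p \<in> poly_funs (2*n). (\<forall>w \<in> big_cell n. p w = 0) \<longrightarrow> p g = 0}"

lemma big_cell_Sp: "w \<in> big_cell n \<Longrightarrow> w \<in> carrier (Sp n)"
  unfolding big_cell_def using Uminus_Sp Uplus_Sp torus_Sp Sp_mult_closed by blast

lemma poly_funs_curve:
  assumes "p \<in> poly_funs d"
    and "\<And>r c. r < d \<Longrightarrow> c < d \<Longrightarrow> \<exists>P. \<forall>s. M s $$ (r,c) = poly P s"
  shows "\<exists>P. \<forall>s. p (M s) = poly P s"
  using assms(1)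
proof induction
  case (const a)
  show ?case by (rule exI[of _ "[:a:]"]) simp
next
  case (add p q)
  then obtain P Q where "\<forall>s. p (M s) = poly P s" "\<forall>s. q (M s) = poly Q s" by blast
  then show ?case by (intro exI[of _ "P + Q"]) simp
next
  case (mult p q)
  then obtain P Q where "\<forall>s. p (M s) = poly P s" "\<forall>s. q (M s) = poly Q s" by blast
  then show ?case by (intro exI[of _ "P * Q"]) simp
qed (use assms(2) in auto)

text \<open>The entries of A g are linear in those of g. The comparison is confined to matrices of
  the right size because the entry formula for a product depends on the dimensions.\<close>

lemma poly_funs_mult_left:
  assumes A: "A \<in> carrier_mat d d" and "p \<in> poly_funs d"
  shows "\<exists>q \<in> poly_funs d. \<forall>g \<in> carrier_mat d d. q g = p (A * g)"
  using assms(2)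
proof induction
  case (const a)
  show ?case by (rule bexI[of _ "\<lambda>g. a"]) (auto intro: poly_funs.intros)
next
  case (entry r s)
  have "(\<lambda>g. \<Sum>j<d. A $$ (r,j) * g $$ (j,s)) \<in> poly_funs d"
    using entry by (intro poly_funs_sum poly_funs.mult poly_funs.const poly_funs.entry) auto
  then show ?case
    by (rule bexI[rotated]) (use mult_index_sum[OF A _ entry] in \<open>simp del: index_mult_mat(1)\<close>)
next
  case (add p q)
  then obtain p' q' where "p' \<in> poly_funs d" "\<forall>g \<in> carrier_mat d d. p' g = p (A * g)"
    "q' \<in> poly_funs d" "\<forall>g \<in> carrier_mat d d. q' g = q (A * g)" by blast
  then show ?case by (intro bexI[of _ "\<lambda>g. p' g + q' g"]) (auto intro: poly_funs.intros)
next
  case (mult p q)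
  then obtain p' q' where "p' \<in> poly_funs d" "\<forall>g \<in> carrier_mat d d. p' g = p (A * g)"
    "q' \<in> poly_funs d" "\<forall>g \<in> carrier_mat d d. q' g = q (A * g)" by blast
  then show ?case by (intro bexI[of _ "\<lambda>g. p' g * q' g"]) (auto intro: poly_funs.intros)
qed

text \<open>The quotient is the inverse of alpha_i(t). It is the same at both places of e_i because
  mirrored diagonal entries are inverse to each other.\<close>

lemma torus_ratio:
  assumes t: "t \<in> torus n" and i: "i \<in> {1..n}" and r: "up n i r"
  shows "t $$ (Suc r,Suc r) / t $$ (r,r) = t $$ (i,i) / t $$ (i - 1,i - 1)"
proof -
  have r': "Suc r < 2*n" using up_less[OF i r] .
  have nz: "t $$ (s,s) \<noteq> 0" if "s < 2*n" for s using torus_nonzero[OF t that] .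
  from r consider "r = i - 1" | "r + 1 + i = 2*n" unfolding up_def by auto
  then show ?thesis
  proof cases
    case 1
    then show ?thesis using i by auto
  next
    case 2
    then have e: "2*n - Suc (Suc r) = i - 1" "2*n - Suc r = i" by auto
    have "t $$ (Suc r,Suc r) * t $$ (i - 1,i - 1) = 1" "t $$ (r,r) * t $$ (i,i) = 1"
      using t r' e unfolding torus_iff by (metis, metis Suc_lessD)
    moreover have "t $$ (r,r) \<noteq> 0" "t $$ (i - 1,i - 1) \<noteq> 0" using nz r' i by auto
    ultimately show ?thesis by (simp add: field_simps)
  qed
qed

lemma torus_y:
  assumes t: "t \<in> torus n" and i: "i \<in> {1..n}"
  shows "t * y_elt n i a = y_elt n i (a * (t $$ (i,i) / t $$ (i - 1,i - 1))) * t"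
proof (rule mult_eqI[of _ n])
  fix r s assume rs: "r < 2*n" "s < 2*n"
  have tc: "t \<in> carrier_mat (2*n) (2*n)" using t torus_mat by simp
  have *: "(t * y_elt n i a) $$ (r,s) = t $$ (r,r) * y_elt n i a $$ (r,s)"
    using rs by (intro torus_mult_index[OF t, where l = "2*n"]) auto
  have **: "(y_elt n i b * t) $$ (r,s) = y_elt n i b $$ (r,s) * t $$ (s,s)" for b
    using rs by (intro mult_torus_index[OF t, where l = "2*n"]) auto
  show "(t * y_elt n i a) $$ (r,s) = (y_elt n i (a * (t $$ (i,i) / t $$ (i - 1,i - 1))) * t) $$ (r,s)"
  proof (cases "r = Suc s \<and> up n i s")
    case True
    then show ?thesis unfolding * ** using rs i torus_ratio[OF t i, of s] torus_nonzero[OF t, of s]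
      by (auto simp: y_elt_index field_simps)
  next
    case False
    then show ?thesis unfolding * ** using rs i by (auto simp: y_elt_index)
  qed
qed (use t torus_mat in auto)

lemma x_torus:
  assumes t: "t \<in> torus n" and i: "i \<in> {1..n}"
  shows "x_elt n i a * t = t * x_elt n i (a * (t $$ (i,i) / t $$ (i - 1,i - 1)))"
proof (rule mult_eqI[of _ n])
  fix r s assume rs: "r < 2*n" "s < 2*n"
  have *: "(t * x_elt n i b) $$ (r,s) = t $$ (r,r) * x_elt n i b $$ (r,s)" for b
    using rs by (intro torus_mult_index[OF t, where l = "2*n"]) auto
  have **: "(x_elt n i a * t) $$ (r,s) = x_elt n i a $$ (r,s) * t $$ (s,s)"
    using rs by (intro mult_torus_index[OF t, where l = "2*n"]) auto
  show "(x_elt n i a * t) $$ (r,s) = (t * x_elt n i (a * (t $$ (i,i) / t $$ (i - 1,i - 1)))) $$ (r,s)"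
  proof (cases "s = Suc r \<and> up n i r")
    case True
    then show ?thesis unfolding * ** using rs i torus_ratio[OF t i, of r] torus_nonzero[OF t, of r]
      by (auto simp: x_elt_index field_simps)
  next
    case False
    then show ?thesis unfolding * ** using rs i by (auto simp: x_elt_index)
  qed
qed (use t torus_mat in auto)

lemma torus_Uminus:
  assumes t: "t \<in> torus n" and u: "u \<in> Uminus n"
  shows "\<exists>u' \<in> Uminus n. t * u = u' * t"
  using u
proof (induction rule: Uminus_induct)
  case one
  show ?case using torus_mat[OF t] Uminus_one by (intro bexI[of _ "1\<^sub>m (2*n)"]) auto
next
  case (gen i a)
  show ?case using torus_y[OF t gen] Uminus_y[OF gen] by blast
next
  case (mult u v)
  then obtain u' v' where *: "u' \<in> Uminus n" "v' \<in> Uminus n" "t * u = u' * t" "t * v = v' * t" by blast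
  have c: "t \<in> carrier_mat (2*n) (2*n)" "u \<in> carrier_mat (2*n) (2*n)" "v \<in> carrier_mat (2*n) (2*n)"
    "u' \<in> carrier_mat (2*n) (2*n)" "v' \<in> carrier_mat (2*n) (2*n)"
    using t mult * torus_mat Uminus_Sp Sp_mat by auto
  note a = assoc_mult_mat[of _ "2*n" "2*n" _ "2*n" _ "2*n"]
  have "t * (u * v) = t * u * v" using c by (simp add: a)
  also have "\<dots> = u' * (t * v)" unfolding *(3) using c by (simp add: a)
  also have "\<dots> = u' * v' * t" unfolding *(4) using c by (simp add: a)
  finally have "t * (u * v) = u' * v' * t" .
  then show ?case using Uminus_mult[OF *(1,2)] by blast
qed

text \<open>This reflects [e_i, f_j] = 0: no pair of neighbouring rows is linked by two different
  generators.\<close>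

lemma x_y_commute:
  assumes i: "i \<in> {1..n}" and j: "j \<in> {1..n}" and ne: "i \<noteq> j"
  shows "x_elt n i s * y_elt n j a = y_elt n j a * x_elt n i s"
proof (rule mult_eqI[of _ n])
  fix r c assume rc: "r < 2*n" "c < 2*n"
  have no: "\<not> (up n i r' \<and> up n j r')" for r' using up_unique[OF i j] ne by blast
  have "(x_elt n i s * y_elt n j a) $$ (r,c) = y_elt n j a $$ (r,c) + (if up n i r then s * y_elt n j a $$ (Suc r,c) else 0)"
    using rc i by (intro x_elt_mult_index[where l = "2*n"]) auto
  moreover have "(y_elt n j a * x_elt n i s) $$ (r,c) = x_elt n i s $$ (r,c) + (if dn n j r then a * x_elt n i s $$ (r - 1,c) else 0)"
    using rc j by (intro y_elt_mult_index[where l = "2*n"]) auto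
  moreover have "y_elt n j a $$ (Suc r,c) = (if Suc r = c then 1 else 0)" if "up n i r"
    using that no[of r] up_less[OF i that] rc j by (auto simp: y_elt_index)
  moreover have "x_elt n i s $$ (r - 1,c) = (if r - 1 = c then 1 else 0)" if "dn n j r"
    using that no[of "r - 1"] up_pred[OF j that] rc i by (auto simp: x_elt_index)
  moreover have "y_elt n j a $$ (r,c) = (if r = c then 1 else 0) + (if dn n j r then a * (if r - 1 = c then 1 else 0) else 0)"
  proof (cases "dn n j r")
    case True
    then obtain r' where "r = Suc r'" using dn_pos[OF j rc(1)] by (metis not0_implies_Suc neq0_conv)
    then show ?thesis using rc j by (auto simp: y_elt_index)
  qed (use rc j in \<open>auto simp: y_elt_index\<close>)
  moreover have "x_elt n i s $$ (r,c) = (if r = c then 1 else 0) + (if up n i r then s * (if Suc r = c then 1 else 0) else 0)"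
    using rc i by (auto simp: x_elt_index)
  ultimately show "(x_elt n i s * y_elt n j a) $$ (r,c) = (y_elt n j a * x_elt n i s) $$ (r,c)"
    by (simp del: index_mult_mat(1))
qed auto

text \<open>The LDU decomposition in SL_2 of the matrix with rows (1 + a s, s) and (a, 1), carried
  out on the pairs of rows belonging to i.\<close>

lemma x_y_same:
  assumes i: "i \<in> {1..n}" and d: "1 + a * s \<noteq> 0"
  shows "x_elt n i s * y_elt n i a =
    y_elt n i (a / (1 + a * s)) * coroot n i (1 + a * s) * x_elt n i (s / (1 + a * s))"
proof -
  define e where "e = 1 + a * s"
  have e: "e \<noteq> 0" "e = 1 + a * s" using d unfolding e_def by auto
  let ?X = "x_elt n i (s / e)"
  let ?C = "coroot n i e * ?X"
  have C: "?C \<in> carrier_mat (2*n) (2*n)" by simp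
  have "x_elt n i s * y_elt n i a = y_elt n i (a / e) * ?C"
  proof (rule mult_eqI[of _ n])
    fix r c assume rc: "r < 2*n" "c < 2*n"
    have L: "(x_elt n i s * y_elt n i a) $$ (r,c) = y_elt n i a $$ (r,c) + (if up n i r then s * y_elt n i a $$ (Suc r,c) else 0)"
      using rc i by (intro x_elt_mult_index[where l = "2*n"]) auto
    have R: "(y_elt n i (a / e) * ?C) $$ (r,c) = ?C $$ (r,c) + (if dn n i r then a / e * ?C $$ (r - 1,c) else 0)"
      using rc i C by (intro y_elt_mult_index[where l = "2*n"]) auto
    have CC: "?C $$ (r',c') = (if up n i r' then e else if dn n i r' then inverse e else 1) * ?X $$ (r',c')"
      if "r' < 2*n" "c' < 2*n" for r' c'
      using that by (intro coroot_mult_index[where l = "2*n"]) auto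
    consider (up) "up n i r" | (dn) "dn n i r" | (none) "\<not> up n i r" "\<not> dn n i r" by blast
    then show "(x_elt n i s * y_elt n i a) $$ (r,c) = (y_elt n i (a / e) * ?C) $$ (r,c)"
    proof cases
      case up
      have "\<not> dn n i r" "Suc r < 2*n" using up up_not_dn up_less[OF i up] by blast+
      moreover have e': "1 + s * a = e" using e(2) by (simp add: mult.commute)
      ultimately show ?thesis unfolding L R using up rc i e(1)
        by (cases "c = r"; cases "c = Suc r")
          (simp_all add: CC x_elt_index y_elt_index e(2)[symmetric] e' del: index_mult_mat(1))
    next
      case dn
      obtain r' where r': "r = Suc r'" using dn_pos[OF i rc(1) dn] by (metis not0_implies_Suc neq0_conv)
      then have "up n i r'" "r' < 2*n" "\<not> up n i (Suc r')" "\<not> dn n i r'"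
        using dn rc up_not_dn[of n i "Suc r'"] up_not_dn[of n i r'] by auto
      moreover have "1 = inverse e + a * s / e" using e by (simp add: field_simps)
      ultimately show ?thesis unfolding L R using rc i e(1)
        by (cases "c = r'"; cases "c = Suc r'")
          (simp_all add: CC x_elt_index y_elt_index r' del: index_mult_mat(1))
    next
      case none
      then show ?thesis unfolding L R using rc i
        by (auto simp: CC x_elt_index y_elt_index simp del: index_mult_mat(1))
    qed
  qed (use C in auto)
  also have "\<dots> = y_elt n i (a / e) * coroot n i e * ?X"
    by (simp add: assoc_mult_mat[of _ "2*n" "2*n" _ "2*n" _ "2*n"])
  finally show ?thesis unfolding e_def .
qed

text \<open>x_i(s) passes one generator at a time. Its parameter either stays or becomes s / (1 + a
  s), which fails only where 1 + a s = 0. Injectivity of \<phi> belongs to the claim so that the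
  exceptional set of the next factor pulls back to a finite set.\<close>

lemma x_Uminus:
  assumes i: "i \<in> {1..n}" and u: "u \<in> Uminus n"
  shows "\<exists>F \<phi>. finite F \<and> inj_on \<phi> (- F) \<and> (\<forall>s. s \<notin> F \<longrightarrow>
    (\<exists>u' \<in> Uminus n. \<exists>t \<in> torus n. x_elt n i s * u = u' * t * x_elt n i (\<phi> s)))"
  using u
proof (induction rule: Uminus_induct)
  case one
  have "x_elt n i s * 1\<^sub>m (2*n) = 1\<^sub>m (2*n) * 1\<^sub>m (2*n) * x_elt n i s" for s
    using right_mult_one_mat[OF x_elt_carrier] left_mult_one_mat[OF x_elt_carrier] by simp
  then have "\<exists>u' \<in> Uminus n. \<exists>t \<in> torus n. x_elt n i s * 1\<^sub>m (2*n) = u' * t * x_elt n i (id s)" for s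
    using Uminus_one torus_one unfolding id_def by blast
  then show ?case by (intro exI[of _ "{}"] exI[of _ id] conjI allI impI) simp_all
next
  case (gen j a)
  show ?case
  proof (cases "i = j")
    case True
    have "inj_on (\<lambda>s. s / (1 + a * s)) (- {s. 1 + a * s = 0})"
      by (rule inj_onI) (simp add: field_simps)
    moreover have "finite {s. 1 + a * s = 0}"
    proof -
      have "s = - 1 / a" if "1 + a * s = 0" for s
      proof -
        have "a * s = - 1" using that by (simp add: add_eq_0_iff)
        then show ?thesis by (metis mult_zero_left neg_equal_0_iff_equal nonzero_mult_div_cancel_left zero_neq_one)
      qed
      then have "{s. 1 + a * s = 0} \<subseteq> {- 1 / a}" by blast
      then show ?thesis by (rule finite_subset) simp
    qed
    moreover have "\<exists>u' \<in> Uminus n. \<exists>t \<in> torus n. x_elt n i s * y_elt n j a = u' * t * x_elt n i (s / (1 + a * s))"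
      if "s \<notin> {s. 1 + a * s = 0}" for s
      using x_y_same[OF i, of a s] that Uminus_y[OF i] coroot_torus[OF i] True by blast
    ultimately show ?thesis by blast
  next
    case False
    have "x_elt n i s * y_elt n j a = y_elt n j a * 1\<^sub>m (2*n) * x_elt n i s" for s
      using x_y_commute[OF i gen False] right_mult_one_mat[OF y_elt_carrier] by simp
    then have "\<exists>u' \<in> Uminus n. \<exists>t \<in> torus n. x_elt n i s * y_elt n j a = u' * t * x_elt n i (id s)" for s
      using Uminus_y[OF gen] torus_one unfolding id_def by blast
    then show ?thesis by (intro exI[of _ "{}"] exI[of _ id] conjI allI impI) simp_all
  qed
next
  case (mult u v)
  then obtain F \<phi> F' \<psi> where u: "finite F" "inj_on \<phi> (- F)"
      "\<And>s. s \<notin> F \<Longrightarrow> \<exists>u' \<in> Uminus n. \<exists>t \<in> torus n. x_elt n i s * u = u' * t * x_elt n i (\<phi> s)"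
    and v: "finite F'" "inj_on \<psi> (- F')"
      "\<And>s. s \<notin> F' \<Longrightarrow> \<exists>u' \<in> Uminus n. \<exists>t \<in> torus n. x_elt n i s * v = u' * t * x_elt n i (\<psi> s)"
    by metis
  define F'' where "F'' = F \<union> (\<phi> -` F' \<inter> - F)"
  have "finite F''" unfolding F''_def using u(1) finite_vimage_IntI[OF v(1) u(2)] by simp
  moreover have "inj_on (\<psi> \<circ> \<phi>) (- F'')"
    using u(2) v(2) unfolding F''_def inj_on_def by auto
  moreover have "\<exists>u' \<in> Uminus n. \<exists>t \<in> torus n. x_elt n i s * (u * v) = u' * t * x_elt n i ((\<psi> \<circ> \<phi>) s)"
    if s: "s \<notin> F''" for s
  proof -
    obtain u1 t1 where 1: "u1 \<in> Uminus n" "t1 \<in> torus n" "x_elt n i s * u = u1 * t1 * x_elt n i (\<phi> s)"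
      using u(3)[of s] s unfolding F''_def by blast
    obtain u2 t2 where 2: "u2 \<in> Uminus n" "t2 \<in> torus n" "x_elt n i (\<phi> s) * v = u2 * t2 * x_elt n i (\<psi> (\<phi> s))"
      using v(3)[of "\<phi> s"] s unfolding F''_def by blast
    obtain u3 where 3: "u3 \<in> Uminus n" "t1 * u2 = u3 * t1" using torus_Uminus[OF 1(2) 2(1)] by blast
    have c: "u \<in> carrier_mat (2*n) (2*n)" "v \<in> carrier_mat (2*n) (2*n)" "u1 \<in> carrier_mat (2*n) (2*n)"
      "u2 \<in> carrier_mat (2*n) (2*n)" "u3 \<in> carrier_mat (2*n) (2*n)" "t1 \<in> carrier_mat (2*n) (2*n)"
      "t2 \<in> carrier_mat (2*n) (2*n)"
      using mult 1 2 3 torus_mat Uminus_Sp Sp_mat by auto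
    let ?X = "x_elt n i (\<psi> (\<phi> s))"
    note a = assoc_mult_mat[of _ "2*n" "2*n" _ "2*n" _ "2*n"]
    have "x_elt n i s * (u * v) = x_elt n i s * u * v" using c by (simp add: a)
    also have "\<dots> = u1 * t1 * (x_elt n i (\<phi> s) * v)" unfolding 1(3) using c by (simp add: a)
    also have "\<dots> = u1 * (t1 * u2) * t2 * ?X" unfolding 2(3) using c by (simp add: a)
    also have "\<dots> = (u1 * u3) * (t1 * t2) * ?X" unfolding 3(2) using c by (simp add: a)
    finally show ?thesis using Uminus_mult[OF 1(1) 3(1)] torus_mult[OF 1(2) 2(2)] by auto
  qed
  ultimately show ?case by blast
qed

lemma x_big_cell:
  assumes i: "i \<in> {1..n}" and w: "w \<in> big_cell n"
  shows "finite {s. x_elt n i s * w \<notin> big_cell n}"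
proof -
  obtain u t v where w': "w = u * t * v" "u \<in> Uminus n" "t \<in> torus n" "v \<in> Uplus n"
    using w unfolding big_cell_def by blast
  obtain F \<phi> where F: "finite F" "\<And>s. s \<notin> F \<Longrightarrow>
    \<exists>u' \<in> Uminus n. \<exists>t \<in> torus n. x_elt n i s * u = u' * t * x_elt n i (\<phi> s)"
    using x_Uminus[OF i w'(2)] by blast
  have "x_elt n i s * w \<in> big_cell n" if "s \<notin> F" for s
  proof -
    obtain u' t' where *: "u' \<in> Uminus n" "t' \<in> torus n" "x_elt n i s * u = u' * t' * x_elt n i (\<phi> s)"
      using F(2)[OF \<open>s \<notin> F\<close>] by blast
    obtain b where b: "x_elt n i (\<phi> s) * t = t * x_elt n i b" using x_torus[OF w'(3) i] by blast
    have c: "u \<in> carrier_mat (2*n) (2*n)" "t \<in> carrier_mat (2*n) (2*n)" "v \<in> carrier_mat (2*n) (2*n)"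
      "u' \<in> carrier_mat (2*n) (2*n)" "t' \<in> carrier_mat (2*n) (2*n)"
      using w' * torus_mat Uminus_Sp Uplus_Sp Sp_mat by auto
    note a = assoc_mult_mat[of _ "2*n" "2*n" _ "2*n" _ "2*n"]
    have "x_elt n i s * w = x_elt n i s * u * t * v" unfolding w' using c by (simp add: a)
    also have "\<dots> = u' * t' * (x_elt n i (\<phi> s) * t) * v" unfolding *(3) using c by (simp add: a)
    also have "\<dots> = u' * (t' * t) * (x_elt n i b * v)" unfolding b using c by (simp add: a)
    finally show ?thesis unfolding big_cell_def
      using *(1) torus_mult[OF *(2) w'(3)] Uplus_mult[OF Uplus_x[OF i] w'(4)] by blast
  qed
  then have "{s. x_elt n i s * w \<notin> big_cell n} \<subseteq> F" by blast
  then show ?thesis using F(1) by (rule finite_subset)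
qed

lemma y_big_cell:
  assumes i: "i \<in> {1..n}" and w: "w \<in> big_cell n"
  shows "y_elt n i s * w \<in> big_cell n"
proof -
  obtain u t v where w': "w = u * t * v" "u \<in> Uminus n" "t \<in> torus n" "v \<in> Uplus n"
    using w unfolding big_cell_def by blast
  have c: "u \<in> carrier_mat (2*n) (2*n)" "t \<in> carrier_mat (2*n) (2*n)" "v \<in> carrier_mat (2*n) (2*n)"
    using w' torus_mat Uminus_Sp Uplus_Sp Sp_mat by auto
  have "y_elt n i s * w = (y_elt n i s * u) * t * v"
    unfolding w' using c by (simp add: assoc_mult_mat[of _ "2*n" "2*n" _ "2*n" _ "2*n"])
  then show ?thesis unfolding big_cell_def using Uminus_mult[OF Uminus_y[OF i] w'(2)] w'(3,4) by blast
qed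

text \<open>The assumption \<open>van\<close> asks for p (A w) = 0 and not for A w in the cell:
  x_i(s) w may leave the cell for finitely many s, and yet p still vanishes there.\<close>

lemma cell_closure_mult:
  assumes A: "A \<in> carrier_mat (2*n) (2*n)" and g: "g \<in> cell_closure n"
    and van: "\<And>p w. p \<in> poly_funs (2*n) \<Longrightarrow> (\<forall>w \<in> big_cell n. p w = 0) \<Longrightarrow> w \<in> big_cell n \<Longrightarrow> p (A * w) = 0"
  shows "A * g \<in> cell_closure n"
proof -
  have gc: "g \<in> carrier_mat (2*n) (2*n)" using g by (simp add: cell_closure_def)
  have "p (A * g) = 0" if p: "p \<in> poly_funs (2*n)" "\<forall>w \<in> big_cell n. p w = 0" for p
  proof -
    obtain q where q: "q \<in> poly_funs (2*n)" "\<And>h. h \<in> carrier_mat (2*n) (2*n) \<Longrightarrow> q h = p (A * h)"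
      using poly_funs_mult_left[OF A p(1)] by blast
    have "q w = 0" if "w \<in> big_cell n" for w
      using q(2)[OF Sp_mat[OF big_cell_Sp[OF that]]] van[OF p that] by simp
    then show ?thesis using g q gc unfolding cell_closure_def by auto
  qed
  then show ?thesis using A gc unfolding cell_closure_def by simp
qed

lemma cell_closure_y:
  assumes i: "i \<in> {1..n}" and g: "g \<in> cell_closure n"
  shows "y_elt n i s * g \<in> cell_closure n"
  by (rule cell_closure_mult) (use assms y_big_cell in auto)

text \<open>The polynomial function \<open>s \<mapsto> p (x\<^sub>i(s) w)\<close> vanishes for all but finitely many \<open>s\<close>, hence for
  all \<open>s\<close>.\<close>

lemma cell_closure_x:
  assumes i: "i \<in> {1..n}" and g: "g \<in> cell_closure n"
  shows "x_elt n i s * g \<in> cell_closure n"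
proof (rule cell_closure_mult[OF x_elt_carrier g])
  fix p w assume p: "p \<in> poly_funs (2*n)" "\<forall>w \<in> big_cell n. p w = 0" and w: "w \<in> big_cell n"
  have wc: "w \<in> carrier_mat (2*n) (2*n)" using w big_cell_Sp Sp_mat by blast
  have "\<exists>P. \<forall>s. (x_elt n i s * w) $$ (r,c) = poly P s" if "r < 2*n" "c < 2*n" for r c
    by (rule exI[of _ "[:w $$ (r,c), if up n i r then w $$ (Suc r,c) else 0:]"])
      (use that in \<open>simp add: x_elt_mult_index[OF i wc] del: index_mult_mat(1)\<close>)
  from poly_funs_curve[OF p(1) this] obtain P where P: "\<And>s. p (x_elt n i s * w) = poly P s" by blast
  have "P = 0"
  proof (rule ccontr)
    assume "P \<noteq> 0"
    then have "finite {s. poly P s = 0}" by (rule poly_roots_finite)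
    moreover have "- {s. x_elt n i s * w \<notin> big_cell n} \<subseteq> {s. poly P s = 0}" using P p(2) by force
    ultimately have "finite (- {s. x_elt n i s * w \<notin> big_cell n})" by (rule finite_subset[rotated])
    then show False using x_big_cell[OF i w] infinite_UNIV_char_0[where 'a = complex] by (metis finite_compl)
  qed
  then show "p (x_elt n i s * w) = 0" using P by simp
qed

lemma torus_cell_closure: "t \<in> torus n \<Longrightarrow> t \<in> cell_closure n"
proof -
  assume t: "t \<in> torus n"
  have "t = 1\<^sub>m (2*n) * t * 1\<^sub>m (2*n)" using torus_mat[OF t] by simp
  then have "t \<in> big_cell n" unfolding big_cell_def using t Uminus_one Uplus_one by blast
  then show ?thesis using torus_mat[OF t] unfolding cell_closure_def by blast
qed

text \<open>The root subgroup of the long root \<open>2\<epsilon>\<^sub>k\<^sub>+\<^sub>1\<close>, which clears the corner entry of a column without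
  touching the other rows.\<close>

definition long_elt :: "nat \<Rightarrow> nat \<Rightarrow> complex \<Rightarrow> complex mat" where
  "long_elt n k t = 1\<^sub>m (2*n) + t \<cdot>\<^sub>m mat (2*n) (2*n) (\<lambda>(r,s). if r = k \<and> s = 2*n - Suc k then 1 else 0)"

lemma long_elt_carrier [simp]: "long_elt n k t \<in> carrier_mat (2*n) (2*n)"
  by (simp add: long_elt_def)

lemma long_elt_index:
  "r < 2*n \<Longrightarrow> s < 2*n \<Longrightarrow> k < n \<Longrightarrow>
    long_elt n k t $$ (r,s) = (if r = s then 1 else if r = k \<and> s = 2*n - Suc k then t else 0)"
  by (auto simp: long_elt_def)

lemma long_elt_mult_index:
  assumes k: "k < n" and M: "M \<in> carrier_mat (2*n) l" and rs: "r < 2*n" "s < l"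
  shows "(long_elt n k t * M) $$ (r,s) = M $$ (r,s) + (if r = k then t * M $$ (2*n - Suc k,s) else 0)"
proof -
  have "(long_elt n k t * M) $$ (r,s) = (\<Sum>j<2*n. long_elt n k t $$ (r,j) * M $$ (j,s))"
    using M rs by (intro mult_index_sum) auto
  also have "\<dots> = (\<Sum>j<2*n. (if j = r then M $$ (j,s) else 0) +
      (if j = 2*n - Suc k then (if r = k then t * M $$ (j,s) else 0) else 0))"
    using rs k by (intro sum.cong refl) (auto simp: long_elt_index)
  also have "\<dots> = M $$ (r,s) + (if r = k then t * M $$ (2*n - Suc k,s) else 0)"
    using rs k by (simp add: sum.distrib sum.delta)
  finally show ?thesis .
qed

lemma long_elt_Sp:
  assumes k: "k < n"
  shows "long_elt n k t \<in> carrier (Sp n)"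
proof -
  let ?E = "mat (2*n) (2*n) (\<lambda>(r,s). if r = k \<and> s = 2*n - Suc k then 1 else 0) :: complex mat"
  have E: "?E \<in> carrier_mat (2*n) (2*n)" by simp
  have ne: "2*n - Suc k \<noteq> k" using k by presburger
  have "(?E * ?E) $$ (r,s) = 0" if "r < 2*n" "s < 2*n" for r s
  proof -
    have "(?E * ?E) $$ (r,s) = (\<Sum>j<2*n. ?E $$ (r,j) * ?E $$ (j,s))"
      using that by (intro mult_index_sum[OF E E])
    also have "\<dots> = 0" using that ne by (intro sum.neutral) auto
    finally show ?thesis .
  qed
  then have sq: "?E * ?E = 0\<^sub>m (2*n) (2*n)" by (intro mult_eqI[of _ n]) (auto simp del: index_mult_mat(1))
  have "transpose_mat ?E * symp_form n = - (symp_form n * ?E)"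
  proof (rule mult_eqI[of _ n])
    fix r s assume rs: "r < 2*n" "s < 2*n"
    have "(transpose_mat ?E * symp_form n) $$ (r,s) = - ((-1)^s * ?E $$ (2*n - Suc s,r))"
      using rs by (subst mult_symp_form_index) auto
    moreover have "(- (symp_form n * ?E)) $$ (r,s) = - ((-1)^r * ?E $$ (2*n - Suc r,s))"
      using rs by (simp add: symp_form_mult_index[where l = "2*n"] del: index_mult_mat(1))
    moreover have "2*n - Suc s = k \<and> r = 2*n - Suc k \<longleftrightarrow> s = r \<and> r = 2*n - Suc k"
      "2*n - Suc r = k \<and> s = 2*n - Suc k \<longleftrightarrow> s = r \<and> r = 2*n - Suc k"
      using rs k by auto
    ultimately show "(transpose_mat ?E * symp_form n) $$ (r,s) = (- (symp_form n * ?E)) $$ (r,s)"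
      using rs by (auto simp del: index_mult_mat(1))
  qed auto
  from square_zero_Sp[OF E sq this] show ?thesis unfolding long_elt_def .
qed

lemma long_elt_last:
  assumes "n \<ge> 1"
  shows "long_elt n (n - 1) t = x_elt n n t"
proof (rule mult_eqI[of _ n])
  fix r s assume rs: "r < 2*n" "s < 2*n"
  have "up n n r \<and> s = Suc r \<longleftrightarrow> r = n - 1 \<and> s = 2*n - Suc (n - 1)"
    using assms unfolding up_def by auto
  then show "long_elt n (n - 1) t $$ (r,s) = x_elt n n t $$ (r,s)"
    using rs assms by (auto simp: long_elt_index x_elt_index)
qed auto

text \<open>The reflection s_(k+1) takes the root 2 eps_(k+1) to 2 eps_(k+2), and its lift adds the
  sign. Repetition ties every long root subgroup to that of the simple root alpha_n.\<close>

lemma s_bar_long_elt: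
  assumes k: "Suc k < n" and M: "M \<in> carrier_mat (2*n) (2*n)"
  shows "s_bar n (Suc k) * (long_elt n k t * M) = long_elt n (Suc k) (-t) * (s_bar n (Suc k) * M)"
proof (rule mult_eqI[of _ n])
  fix r c assume rc: "r < 2*n" "c < 2*n"
  define k' where "k' = 2*n - Suc (Suc k)"
  have i: "Suc k \<in> {1..n}" and k': "2*n - Suc k = Suc k'" "2*n - Suc (Suc k) = k'" "Suc k < k'" "Suc k' < 2*n"
    using k unfolding k'_def by auto
  have ud: "up n (Suc k) r \<longleftrightarrow> r = k \<or> r = k'" "dn n (Suc k) r \<longleftrightarrow> r = Suc k \<or> r = Suc k'"
    using k rc k'_def unfolding up_def dn_def by auto
  let ?L = "long_elt n k t * M" and ?S = "s_bar n (Suc k) * M"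
  have LS: "?L \<in> carrier_mat (2*n) (2*n)" "?S \<in> carrier_mat (2*n) (2*n)" using M by auto
  have L: "?L $$ (r',c) = M $$ (r',c) + (if r' = k then t * M $$ (Suc k',c) else 0)" if "r' < 2*n" for r'
    using long_elt_mult_index[OF _ M that rc(2), of k t] k k'(1) by simp
  have S: "?S $$ (r',c) = (if up n (Suc k) r' then - M $$ (Suc r',c) else if dn n (Suc k) r' then M $$ (r' - 1,c) else M $$ (r',c))"
    if "r' < 2*n" for r' using s_bar_mult_index[OF i M that rc(2)] .
  have "(s_bar n (Suc k) * ?L) $$ (r,c) = (if up n (Suc k) r then - ?L $$ (Suc r,c) else if dn n (Suc k) r then ?L $$ (r - 1,c) else ?L $$ (r,c))"
    using s_bar_mult_index[OF i LS(1) rc] .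
  moreover have "(long_elt n (Suc k) (-t) * ?S) $$ (r,c) = ?S $$ (r,c) + (if r = Suc k then - t * ?S $$ (k',c) else 0)"
    using long_elt_mult_index[OF k LS(2) rc] k'(2) by simp
  moreover have "?S $$ (k',c) = - M $$ (Suc k',c)"
  proof -
    have "up n (Suc k) k'" unfolding up_def k'_def using k by auto
    then show ?thesis using S[of k'] k'(4) by simp
  qed
  moreover consider "r = k" | "r = Suc k" | "r = k'" | "r = Suc k'" | "r \<noteq> k" "r \<noteq> Suc k" "r \<noteq> k'" "r \<noteq> Suc k'" by blast
  ultimately show "(s_bar n (Suc k) * ?L) $$ (r,c) = (long_elt n (Suc k) (-t) * ?S) $$ (r,c)"
    using k'(3,4) rc k by cases (simp_all add: L S ud del: index_mult_mat(1))
qed (use M in auto)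

section \<open>Elimination in the symplectic group\<close>

text \<open>An equivalence is demanded because elimination transforms g into a known element and
  membership has to be carried back to g.\<close>

definition row_closed :: "nat \<Rightarrow> complex mat set \<Rightarrow> bool" where
  "row_closed n S \<longleftrightarrow> (\<forall>i \<in> {1..n}. \<forall>s. \<forall>g \<in> carrier_mat (2*n) (2*n).
     (x_elt n i s * g \<in> S \<longleftrightarrow> g \<in> S) \<and> (y_elt n i s * g \<in> S \<longleftrightarrow> g \<in> S))"

lemma row_closedD:
  assumes "row_closed n S" "i \<in> {1..n}" "g \<in> carrier_mat (2*n) (2*n)"
  shows "x_elt n i s * g \<in> S \<longleftrightarrow> g \<in> S" "y_elt n i s * g \<in> S \<longleftrightarrow> g \<in> S"
  using assms unfolding row_closed_def by blast+

lemma row_closed_s_bar: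
  assumes S: "row_closed n S" and i: "i \<in> {1..n}" and g: "g \<in> carrier_mat (2*n) (2*n)"
  shows "s_bar n i * g \<in> S \<longleftrightarrow> g \<in> S"
proof -
  have "s_bar n i * g = x_elt n i (-1) * (y_elt n i 1 * (x_elt n i (-1) * g))"
    unfolding s_bar_def using g by (simp add: assoc_mult_mat[of _ "2*n" "2*n" _ "2*n" _ "2*n"])
  then show ?thesis using row_closedD[OF S i] g by simp
qed

lemma row_closed_long_elt:
  assumes S: "row_closed n S" and k: "k < n" and g: "g \<in> carrier_mat (2*n) (2*n)"
  shows "long_elt n k t * g \<in> S \<longleftrightarrow> g \<in> S"
  using k g
proof (induction "n - Suc k" arbitrary: k t g)
  case 0
  then have "k = n - 1" by simp
  then show ?case using row_closedD(1)[OF S, of n g] 0 long_elt_last[of n] by simp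
next
  case (Suc m)
  have k: "Suc k < n" and i: "Suc k \<in> {1..n}" using Suc.hyps(2) by auto
  have "long_elt n k t * g \<in> S \<longleftrightarrow> s_bar n (Suc k) * (long_elt n k t * g) \<in> S"
    using row_closed_s_bar[OF S i, of "long_elt n k t * g"] Suc.prems by simp
  also have "\<dots> \<longleftrightarrow> s_bar n (Suc k) * g \<in> S"
    unfolding s_bar_long_elt[OF k Suc.prems(2)] using Suc k by (intro Suc.hyps(1)) auto
  finally show ?case using row_closed_s_bar[OF S i Suc.prems(2)] by simp
qed

lemma Sp_columns:
  assumes g: "g \<in> carrier (Sp n)" and s: "s < 2*n" "s' < 2*n"
  shows "(\<Sum>r<2*n. (-1)^r * g $$ (r,s) * g $$ (2*n - Suc r,s')) = symp_form n $$ (s,s')"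
proof -
  have gc: "g \<in> carrier_mat (2*n) (2*n)" and eq: "transpose_mat g * symp_form n * g = symp_form n"
    using g by (auto simp: carrier_Sp)
  have "(transpose_mat g * (symp_form n * g)) $$ (s,s') = (\<Sum>r<2*n. transpose_mat g $$ (s,r) * (symp_form n * g) $$ (r,s'))"
    using gc s by (intro mult_index_sum) auto
  also have "\<dots> = (\<Sum>r<2*n. (-1)^r * g $$ (r,s) * g $$ (2*n - Suc r,s'))"
    using gc s by (intro sum.cong refl) (simp add: symp_form_mult_index[where l = "2*n"] del: index_mult_mat(1))
  finally show ?thesis
    using eq gc assoc_mult_mat[of "transpose_mat g" "2*n" "2*n" "symp_form n" "2*n" g "2*n"] by simp
qed

text \<open>If column k is a multiple of a basis vector, its pairing with column s picks out a
  single entry of row 2n - 1 - k. This is how a cleared column produces a cleared row.\<close>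

lemma Sp_unit_column:
  assumes g: "g \<in> carrier (Sp n)" and k: "k < 2*n" and col: "\<And>r. r < 2*n \<Longrightarrow> r \<noteq> k \<Longrightarrow> g $$ (r,k) = 0"
    and s: "s < 2*n"
  shows "(-1)^k * g $$ (k,k) * g $$ (2*n - Suc k,s) = symp_form n $$ (k,s)"
    "g $$ (k,k) \<noteq> 0" "s \<noteq> 2*n - Suc k \<Longrightarrow> g $$ (2*n - Suc k,s) = 0"
proof -
  have *: "(-1)^k * g $$ (k,k) * g $$ (2*n - Suc k,s) = symp_form n $$ (k,s)" if "s < 2*n" for s
    unfolding Sp_columns[OF g k that, symmetric]
    using k col by (intro sum_single_index[symmetric]) auto
  then show 1: "(-1)^k * g $$ (k,k) * g $$ (2*n - Suc k,s) = symp_form n $$ (k,s)" using s .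
  show 2: "g $$ (k,k) \<noteq> 0"
    using *[of "2*n - Suc k"] k by (auto simp: symp_form_index)
  show "g $$ (2*n - Suc k,s) = 0" if "s \<noteq> 2*n - Suc k"
    using 1 2 that k s by (auto simp: symp_form_index)
qed

text \<open>What is left is the inner block of the indices k, ..., 2n - k - 1, on which the
  generators with index above k act.\<close>

definition peeled :: "nat \<Rightarrow> nat \<Rightarrow> complex mat \<Rightarrow> bool" where
  "peeled n k g \<longleftrightarrow> (\<forall>r<2*n. \<forall>s<2*n. r \<noteq> s \<longrightarrow>
     r < k \<or> 2*n - k \<le> r \<or> s < k \<or> 2*n - k \<le> s \<longrightarrow> g $$ (r,s) = 0)"

lemma up_inner: "i \<in> {1..n} \<Longrightarrow> k < i \<Longrightarrow> up n i r \<Longrightarrow> k \<le> r \<and> Suc r < 2*n - k"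
  unfolding up_def by auto

lemma dn_inner:
  assumes "i \<in> {1..n}" "k < i" "r < 2*n" "dn n i r"
  shows "k \<le> r - 1 \<and> r < 2*n - k \<and> 0 < r"
  using up_inner[OF assms(1,2) up_pred[OF assms(1,4)]] dn_pos[OF assms(1,3,4)] by simp

lemma peeled_x:
  assumes p: "peeled n k g" and g: "g \<in> carrier_mat (2*n) (2*n)" and i: "i \<in> {1..n}" "k < i"
  shows "peeled n k (x_elt n i s * g)"
  unfolding peeled_def
proof (intro allI impI)
  fix r c assume rc: "r < 2*n" "c < 2*n" "r \<noteq> c" "r < k \<or> 2*n - k \<le> r \<or> c < k \<or> 2*n - k \<le> c"
  have "g $$ (Suc r,c) = 0" if "up n i r"
    using up_inner[OF i that] rc p unfolding peeled_def by auto
  moreover have "g $$ (r,c) = 0" using p rc unfolding peeled_def by blast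
  ultimately show "(x_elt n i s * g) $$ (r,c) = 0"
    using x_elt_mult_index[OF i(1) g rc(1,2), of s] by simp
qed

lemma peeled_y:
  assumes p: "peeled n k g" and g: "g \<in> carrier_mat (2*n) (2*n)" and i: "i \<in> {1..n}" "k < i"
  shows "peeled n k (y_elt n i s * g)"
  unfolding peeled_def
proof (intro allI impI)
  fix r c assume rc: "r < 2*n" "c < 2*n" "r \<noteq> c" "r < k \<or> 2*n - k \<le> r \<or> c < k \<or> 2*n - k \<le> c"
  have "g $$ (r - 1,c) = 0" if "dn n i r"
    using dn_inner[OF i rc(1) that] rc p unfolding peeled_def by auto
  moreover have "g $$ (r,c) = 0" using p rc unfolding peeled_def by blast
  ultimately show "(y_elt n i s * g) $$ (r,c) = 0"
    using y_elt_mult_index[OF i(1) g rc(1,2), of s] by simp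
qed

text \<open>Neighbouring rows of the inner block are always linked by a generator that leaves the
  peeled rows alone.\<close>

lemma exists_up:
  assumes "k \<le> L" "Suc L < 2*n - k"
  shows "\<exists>i \<in> {1..n}. k < i \<and> up n i L"
proof (cases "L < n")
  case True
  then show ?thesis using assms by (intro bexI[of _ "Suc L"]) (auto simp: up_def)
next
  case False
  then show ?thesis using assms by (intro bexI[of _ "2*n - Suc L"]) (auto simp: up_def)
qed

lemma up_Suc_False: "up n i r \<Longrightarrow> \<not> up n i (Suc r)"
  using up_not_dn dn_Suc by blast

text \<open>The lowest entry, in row L + 1, is removed with the pivot in row L. The generator also
  acts on the mirror pair of rows. If that is a different pair, it lies either below row L + 1,
  where the column is zero, or above row L, where the induction claims nothing.\<close>

lemma clear_column:
  assumes S: "row_closed n S" and k: "k < n"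
    and target: "\<And>g. \<lbrakk>g \<in> carrier (Sp n); peeled n k g; \<And>r. r < 2*n \<Longrightarrow> r \<noteq> k \<Longrightarrow> g $$ (r,k) = 0\<rbrakk> \<Longrightarrow> g \<in> S"
    and "g \<in> carrier (Sp n)" "peeled n k g" "k \<le> L" "L < 2*n - k" "\<And>r. L < r \<Longrightarrow> r < 2*n \<Longrightarrow> g $$ (r,k) = 0"
  shows "g \<in> S"
  using assms(4-)
proof (induction L arbitrary: g)
  case 0
  then have k0: "k = 0" by simp
  show ?case by (rule target) (use 0 k0 in auto)
next
  case (Suc L)
  have gc: "g \<in> carrier_mat (2*n) (2*n)" using Suc.prems(1) Sp_mat by blast
  show ?case
  proof (cases "k = Suc L")
    case True
    show ?thesis
    proof (rule target)
      fix r assume r: "r < 2*n" "r \<noteq> k"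
      then show "g $$ (r,k) = 0"
        using Suc.prems(5)[of r] Suc.prems(2) True k unfolding peeled_def by (cases "r < k") auto
    qed (use Suc.prems in auto)
  next
    case False
    then have kL: "k \<le> L" "Suc L < 2*n - k" "Suc L < 2*n" "L < 2*n" using Suc.prems(3,4) by auto
    obtain i where i: "i \<in> {1..n}" "k < i" "up n i L" using exists_up[OF kL(1,2)] by blast
    have i': "\<not> up n i (Suc L)" "dn n i (Suc L)" using i(3) up_Suc_False by auto
    show ?thesis
    proof (cases "g $$ (Suc L,k) = 0")
      case True
      show ?thesis
      proof (rule Suc.IH)
        fix r assume "L < r" "r < 2*n"
        then show "g $$ (r,k) = 0" using True Suc.prems(5)[of r] by (cases "r = Suc L") auto
      qed (use Suc.prems kL in auto)
    next
      case nz: False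
      \<comment> \<open>If the pivot vanishes, row L + 1 is first added to row L.\<close>
      define a where "a = (if g $$ (L,k) = 0 then 1 else 0 :: complex)"
      define g1 where "g1 = x_elt n i a * g"
      have g1: "g1 \<in> carrier (Sp n)" unfolding g1_def using Suc.prems(1) i by (intro Sp_mult_closed x_elt_Sp)
      then have g1c: "g1 \<in> carrier_mat (2*n) (2*n)" using Sp_mat by blast
      have g1i: "g1 $$ (r,k) = g $$ (r,k) + (if up n i r then a * g $$ (Suc r,k) else 0)" if "r < 2*n" for r
        unfolding g1_def using x_elt_mult_index[OF i(1) gc that, of k a] k by simp
      have L1: "g1 $$ (L,k) \<noteq> 0" using g1i[OF kL(4)] i(3) nz by (auto simp: a_def)
      have L2: "g1 $$ (Suc L,k) = g $$ (Suc L,k)" using g1i[OF kL(3)] i' by simp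
      have L3: "g1 $$ (r,k) = 0" if "Suc L < r" "r < 2*n" for r
        using g1i[OF that(2)] Suc.prems(5)[of r] Suc.prems(5)[of "Suc r"] that up_less[OF i(1), of r] by auto
      define b where "b = - (g1 $$ (Suc L,k) / g1 $$ (L,k))"
      define g2 where "g2 = y_elt n i b * g1"
      have g2i: "g2 $$ (r,k) = g1 $$ (r,k) + (if dn n i r then b * g1 $$ (r - 1,k) else 0)" if "r < 2*n" for r
        unfolding g2_def using y_elt_mult_index[OF i(1) g1c that, of k b] k by simp
      have "g2 \<in> S"
      proof (rule Suc.IH)
        show "g2 \<in> carrier (Sp n)" unfolding g2_def using g1 i by (intro Sp_mult_closed y_elt_Sp)
        show "peeled n k g2" unfolding g2_def g1_def using Suc.prems(2) gc g1c i
          by (intro peeled_y peeled_x) (auto simp: g1_def)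
        fix r assume r: "L < r" "r < 2*n"
        show "g2 $$ (r,k) = 0"
        proof (cases "r = Suc L")
          case True
          then show ?thesis using g2i[OF r(2)] i' L1 by (simp add: b_def)
        next
          case False
          then have r': "Suc L < r" using r by auto
          have "g1 $$ (r - 1,k) = 0" if "dn n i r"
          proof -
            have "r \<noteq> Suc (Suc L)" using that i' by auto
            then show ?thesis using r' r by (intro L3) auto
          qed
          then show ?thesis using g2i[OF r(2)] L3[OF r' r(2)] by simp
        qed
      qed (use kL in auto)
      then show ?thesis using row_closedD[OF S i(1)] g1c gc unfolding g2_def g1_def by blast
    qed
  qed
qed

text \<open>The column is cleared from the top, each entry with the pivot in the row below it, while
  column k has to stay clear. Once both columns are clear, \<open>Sp_unit_column\<close> clears both
  rows and the index pair is peeled off.\<close>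

lemma clear_mirror_column:
  assumes S: "row_closed n S" and k: "k < n"
    and target: "\<And>g. \<lbrakk>g \<in> carrier (Sp n); peeled n (Suc k) g\<rbrakk> \<Longrightarrow> g \<in> S"
    and "g \<in> carrier (Sp n)" "peeled n k g" "\<And>r. r < 2*n \<Longrightarrow> r \<noteq> k \<Longrightarrow> g $$ (r,k) = 0"
    and "Suc k \<le> L" "L \<le> 2*n - Suc k" "\<And>r. r < L \<Longrightarrow> g $$ (r,2*n - Suc k) = 0"
  shows "g \<in> S"
  using assms(4-)
proof (induction "2*n - Suc k - L" arbitrary: g L)
  case 0
  let ?k' = "2*n - Suc k"
  have L: "L = ?k'" using 0 by simp
  have k': "?k' < 2*n" "2*n - Suc ?k' = k" using k by auto
  have row': "g $$ (?k',s) = 0" if "s < 2*n" "s \<noteq> ?k'" for s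
    using Sp_unit_column(3)[OF 0(2) _ 0(4) that(1)] that k by simp
  have col': "g $$ (r,?k') = 0" if "r < 2*n" "r \<noteq> ?k'" for r
    using 0(7)[of r] 0(3) that k unfolding L peeled_def by (cases "r < ?k'") auto
  have row: "g $$ (k,s) = 0" if "s < 2*n" "s \<noteq> k" for s
    using Sp_unit_column(3)[OF 0(2) k'(1) col' that(1)] that(2) unfolding k'(2) by simp
  have "peeled n (Suc k) g" unfolding peeled_def
  proof (intro allI impI)
    fix r s assume rs: "r < 2*n" "s < 2*n" "r \<noteq> s"
      "r < Suc k \<or> 2*n - Suc k \<le> r \<or> s < Suc k \<or> 2*n - Suc k \<le> s"
    then consider "r < k \<or> 2*n - k \<le> r \<or> s < k \<or> 2*n - k \<le> s" | "r = k" | "s = k" | "r = ?k'" | "s = ?k'"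
      by linarith
    then show "g $$ (r,s) = 0"
    proof cases
      case 1
      then show ?thesis using 0(3) rs unfolding peeled_def by blast
    qed (use rs row row' col' 0(4) in auto)
  qed
  then show ?case using target 0(2) by blast
next
  case (Suc m)
  let ?k' = "2*n - Suc k"
  have gc: "g \<in> carrier_mat (2*n) (2*n)" using Suc.prems(1) Sp_mat by blast
  have k': "?k' < 2*n" "k < 2*n" "k < ?k'" using k by auto
  have L: "Suc k \<le> L" "L < ?k'" "Suc L < 2*n" "L < 2*n" using Suc.hyps(2) Suc.prems(4) by auto
  show ?case
  proof (cases "g $$ (L,?k') = 0")
    case True
    show ?thesis
    proof (rule Suc.hyps(1)[of "Suc L"])
      fix r assume "r < Suc L"
      then show "g $$ (r,?k') = 0" using True Suc.prems(6)[of r] by (cases "r = L") auto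
    qed (use Suc.prems Suc.hyps(2) L in auto)
  next
    case nz: False
    have "k \<le> L" "Suc L < 2*n - k" using L by auto
    from exists_up[OF this] obtain i where i: "i \<in> {1..n}" "k < i" "up n i L" by blast
    have i': "\<not> dn n i L" "\<not> up n i (Suc L)" using i(3) up_not_dn up_Suc_False by auto
    have nzk: "g $$ (?k',?k') \<noteq> 0"
      using Sp_unit_column(1)[OF Suc.prems(1) k'(2) Suc.prems(3) k'(1)] k' by (auto simp: symp_form_index)
    define a where "a = (if g $$ (Suc L,?k') = 0 then 1 else 0 :: complex)"
    define g1 where "g1 = y_elt n i a * g"
    have g1: "g1 \<in> carrier (Sp n)" unfolding g1_def using Suc.prems(1) i by (intro Sp_mult_closed y_elt_Sp)
    then have g1c: "g1 \<in> carrier_mat (2*n) (2*n)" using Sp_mat by blast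
    have p1: "peeled n k g1" unfolding g1_def using Suc.prems(2) gc i by (intro peeled_y)
    have g1i: "g1 $$ (r,s) = g $$ (r,s) + (if dn n i r then a * g $$ (r - 1,s) else 0)" if "r < 2*n" "s < 2*n" for r s
      unfolding g1_def using y_elt_mult_index[OF i(1) gc that] by simp
    \<comment> \<open>The generator with i = k + 1 would add row k to row k + 1 and spoil column k.
      It occurs only when the pivot row L + 1 is row 2n - 1 - k, where the entry is already nonzero
      and a = 0.\<close>
    have ak: "a = 0 \<or> i \<noteq> Suc k"
    proof (rule disjCI)
      assume "\<not> i \<noteq> Suc k"
      then have "Suc L = ?k'" using i(3) L unfolding up_def by auto
      then show "a = 0" using nzk by (simp add: a_def)
    qed
    have col1: "g1 $$ (r,k) = 0" if r: "r < 2*n" "r \<noteq> k" for r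
    proof -
      have "g $$ (r - 1,k) = 0" if "dn n i r" "a \<noteq> 0"
      proof -
        have "0 < r" using dn_pos[OF i(1) r(1) that(1)] .
        have "r - 1 \<noteq> k"
        proof
          assume "r - 1 = k"
          then have "r = Suc k" using \<open>0 < r\<close> by simp
          then have "up n i k" using that(1) by simp
          then show False using ak that(2) i(1,2) k unfolding up_def by auto
        qed
        then show ?thesis using Suc.prems(3) r by simp
      qed
      then show ?thesis using g1i[OF r(1) k'(2)] Suc.prems(3)[OF r] by auto
    qed
    have z1: "g1 $$ (r,?k') = 0" if "r < L" for r
      using g1i[of r ?k'] Suc.prems(6)[of r] Suc.prems(6)[of "r - 1"] that L k' by auto
    have L1: "g1 $$ (L,?k') = g $$ (L,?k')" using g1i[OF L(4) k'(1)] i' by simp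
    have L2: "g1 $$ (Suc L,?k') \<noteq> 0"
      using g1i[OF L(3) k'(1)] i(3) nz by (auto simp: a_def)
    define b where "b = - (g1 $$ (L,?k') / g1 $$ (Suc L,?k'))"
    define g2 where "g2 = x_elt n i b * g1"
    have g2i: "g2 $$ (r,s) = g1 $$ (r,s) + (if up n i r then b * g1 $$ (Suc r,s) else 0)" if "r < 2*n" "s < 2*n" for r s
      unfolding g2_def using x_elt_mult_index[OF i(1) g1c that] by simp
    have "g2 \<in> S"
    proof (rule Suc.hyps(1)[of "Suc L"])
      show "g2 \<in> carrier (Sp n)" unfolding g2_def using g1 i by (intro Sp_mult_closed x_elt_Sp)
      show "peeled n k g2" unfolding g2_def using p1 g1c i by (intro peeled_x)
      show "g2 $$ (r,k) = 0" if r: "r < 2*n" "r \<noteq> k" for r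
      proof -
        have "g1 $$ (Suc r,k) = 0" if "up n i r"
        proof -
          have "k \<le> r" "Suc r < 2*n" using up_inner[OF i(1,2) that] by auto
          then show ?thesis by (intro col1) auto
        qed
        then show ?thesis using g2i[OF r(1) k'(2)] col1[OF r] by simp
      qed
      show "g2 $$ (r,?k') = 0" if r: "r < Suc L" for r
      proof (cases "r = L")
        case True
        then show ?thesis using g2i[OF L(4) k'(1)] i(3) L2 by (simp add: b_def)
      next
        case False
        then have r': "r < L" "r < 2*n" using r L by auto
        have "g1 $$ (Suc r,?k') = 0" if "up n i r"
        proof -
          have "Suc r \<noteq> L" using that i' by auto
          then show ?thesis using r' by (intro z1) auto
        qed
        then show ?thesis using g2i[OF r'(2) k'(1)] z1[OF r'(1)] by simp
      qed
    qed (use Suc.hyps(2) L in auto)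
    then show ?thesis using row_closedD[OF S i(1)] g1c gc unfolding g2_def g1_def by blast
  qed
qed

text \<open>A clear column k forces the entry at (2n - 1 - k, 2n - 1 - k) to be nonzero. It is the
  pivot with which a long root element removes the corner entry, after which the mirror column can
  be cleared from row k + 1 on.\<close>

lemma peel_step:
  assumes S: "row_closed n S" and k: "k < n"
    and target: "\<And>g. \<lbrakk>g \<in> carrier (Sp n); peeled n (Suc k) g\<rbrakk> \<Longrightarrow> g \<in> S"
    and g: "g \<in> carrier (Sp n)" "peeled n k g"
  shows "g \<in> S"
proof (rule clear_column[OF S k _ g, of "2*n - Suc k"])
  fix h assume h: "h \<in> carrier (Sp n)" "peeled n k h" and col: "\<And>r. r < 2*n \<Longrightarrow> r \<noteq> k \<Longrightarrow> h $$ (r,k) = 0"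
  let ?k' = "2*n - Suc k"
  have k': "?k' < 2*n" "k < 2*n" "k < ?k'" using k by auto
  have hc: "h \<in> carrier_mat (2*n) (2*n)" using h(1) Sp_mat by blast
  have nzk: "h $$ (?k',?k') \<noteq> 0"
    using Sp_unit_column(1)[OF h(1) k'(2) col k'(1)] k' by (auto simp: symp_form_index)
  define b where "b = - (h $$ (k,?k') / h $$ (?k',?k'))"
  define h' where "h' = long_elt n k b * h"
  have h'i: "h' $$ (r,s) = h $$ (r,s) + (if r = k then b * h $$ (?k',s) else 0)" if "r < 2*n" "s < 2*n" for r s
    unfolding h'_def using long_elt_mult_index[OF k hc that] .
  have "h' \<in> S"
  proof (rule clear_mirror_column[OF S k target, of h' "Suc k"])
    show "h' \<in> carrier (Sp n)" unfolding h'_def using h(1) k by (intro Sp_mult_closed long_elt_Sp)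
    show "peeled n k h'" unfolding peeled_def
    proof (intro allI impI)
      fix r s assume rs: "r < 2*n" "s < 2*n" "r \<noteq> s" "r < k \<or> 2*n - k \<le> r \<or> s < k \<or> 2*n - k \<le> s"
      have "h $$ (?k',s) = 0" if "r = k" using h(2) rs that k unfolding peeled_def by auto
      moreover have "h $$ (r,s) = 0" using h(2) rs unfolding peeled_def by blast
      ultimately show "h' $$ (r,s) = 0" using h'i[OF rs(1,2)] by simp
    qed
    show "h' $$ (r,k) = 0" if "r < 2*n" "r \<noteq> k" for r
      using h'i[OF that(1) k'(2)] col[OF that] that(2) by simp
    show "h' $$ (r,?k') = 0" if r: "r < Suc k" for r
    proof (cases "r = k")
      case True
      then show ?thesis using h'i[OF k'(2,1)] nzk by (simp add: b_def)
    next
      case False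
      then have "h $$ (r,?k') = 0" using h(2) r k unfolding peeled_def by auto
      then show ?thesis using h'i[of r ?k'] False r k' by simp
    qed
  qed (use k in auto)
  then show "h \<in> S" using row_closed_long_elt[OF S k hc] unfolding h'_def by blast
qed (use k g in \<open>auto simp: peeled_def\<close>)

text \<open>In effect: the torus and the simple root subgroups generate the group. It is phrased for
  sets so that it applies to the closure of the cell.\<close>

lemma Sp_subset_row_closed:
  assumes S: "row_closed n S" and T: "torus n \<subseteq> S"
  shows "carrier (Sp n) \<subseteq> S"
proof -
  have "g \<in> S" if "k \<le> n" "g \<in> carrier (Sp n)" "peeled n k g" for k g
    using that
  proof (induction "n - k" arbitrary: k g)
    case 0
    then have "k = n" by simp
    then have "g $$ (r,s) = 0" if "r < 2*n" "s < 2*n" "r \<noteq> s" for r s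
      using 0(4) that unfolding peeled_def by (cases "r < n") auto
    then have "diagonal_mat g" using Sp_mat[OF 0(3)] unfolding diagonal_mat_def by auto
    then show ?case using T 0 unfolding torus_def by auto
  next
    case (Suc m)
    have k: "k < n" "m = n - Suc k" "Suc k \<le> n" using Suc.hyps(2) by auto
    show ?case
      by (rule peel_step[OF S k(1) _ Suc.prems(2,3)]) (rule Suc.hyps(1)[OF k(2,3)])
  qed
  from this[of 0] show ?thesis by (auto simp: peeled_def)
qed

lemma cell_closure_row_closed: "row_closed n (cell_closure n)"
  unfolding row_closed_def
proof (intro ballI allI)
  fix i s and g :: "complex mat" assume i: "i \<in> {1..n}" and g: "g \<in> carrier_mat (2*n) (2*n)"
  note a = assoc_mult_mat[of _ "2*n" "2*n" _ "2*n" g "2*n", symmetric]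
  have "x_elt n i (-s) * (x_elt n i s * g) = g" "y_elt n i (-s) * (y_elt n i s * g) = g"
    using g i by (simp_all add: a x_elt_add y_elt_add x_elt_0 y_elt_0)
  then show "(x_elt n i s * g \<in> cell_closure n \<longleftrightarrow> g \<in> cell_closure n) \<and>
      (y_elt n i s * g \<in> cell_closure n \<longleftrightarrow> g \<in> cell_closure n)"
    using cell_closure_x[OF i] cell_closure_y[OF i] by metis
qed

lemma Sp_cell_closure: "carrier (Sp n) \<subseteq> cell_closure n"
  by (rule Sp_subset_row_closed[OF cell_closure_row_closed]) (use torus_cell_closure in auto)

lemma principal_minor_eq:
  assumes k: "k \<in> {1..n}" and g: "g \<in> carrier (Sp n)"
  shows "principal_minor n k g = lead_minor k g"
proof -
  have lp: "lead_minor k \<in> poly_funs (2*n)" using k by (intro lead_minor_poly_funs) auto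
  have "principal_minor n k = restrict (lead_minor k) (carrier (Sp n))"
    unfolding principal_minor_def
  proof (rule the_equality)
    have "restrict (lead_minor k) (carrier (Sp n)) (u * t * v) = fund_weight n k t"
      if "u \<in> Uminus n" "t \<in> torus n" "v \<in> Uplus n" for u t v
    proof -
      have "u * t * v \<in> carrier (Sp n)" using that Uminus_Sp Uplus_Sp torus_Sp Sp_mult_closed by blast
      then show ?thesis using lead_minor_big_cell[OF that k] fund_weight_eq[OF k] by simp
    qed
    then show "restrict (lead_minor k) (carrier (Sp n)) \<in> regular_funs n \<and>
      (\<forall>u \<in> Uminus n. \<forall>t \<in> torus n. \<forall>v \<in> Uplus n.
        restrict (lead_minor k) (carrier (Sp n)) (u * t * v) = fund_weight n k t)"
      using lp unfolding regular_funs_def by blast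
  next
    fix f assume f: "f \<in> regular_funs n \<and>
      (\<forall>u \<in> Uminus n. \<forall>t \<in> torus n. \<forall>v \<in> Uplus n. f (u * t * v) = fund_weight n k t)"
    then obtain p where p: "p \<in> poly_funs (2*n)" "f = restrict p (carrier (Sp n))"
      unfolding regular_funs_def by blast
    \<comment> \<open>Two candidates differ by a polynomial function that vanishes on the
      cell.\<close>
    have "(\<lambda>h. p h + (- 1) * lead_minor k h) \<in> poly_funs (2*n)"
      using p(1) lp by (intro poly_funs.add poly_funs.mult poly_funs.const)
    moreover have "p w + (- 1) * lead_minor k w = 0" if w: "w \<in> big_cell n" for w
    proof -
      obtain u t v where *: "w = u * t * v" "u \<in> Uminus n" "t \<in> torus n" "v \<in> Uplus n"
        using w unfolding big_cell_def by blast
      have "p w = f w" using p(2) big_cell_Sp[OF w] by simp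
      also have "\<dots> = fund_weight n k t" unfolding *(1) using f *(2-) by blast
      also have "\<dots> = lead_minor k w"
        unfolding *(1) fund_weight_eq[OF k] using lead_minor_big_cell[OF *(2-) k] by simp
      finally show ?thesis by simp
    qed
    ultimately have "p h + (- 1) * lead_minor k h = 0" if "h \<in> cell_closure n" for h
    proof -
      have "\<forall>q \<in> poly_funs (2*n). (\<forall>w \<in> big_cell n. q w = 0) \<longrightarrow> q h = 0"
        using that unfolding cell_closure_def by blast
      from bspec[OF this \<open>(\<lambda>h. p h + (- 1) * lead_minor k h) \<in> poly_funs (2*n)\<close>]
      show ?thesis using \<open>\<And>w. w \<in> big_cell n \<Longrightarrow> p w + (- 1) * lead_minor k w = 0\<close> by blast
    qed
    then have "p h = lead_minor k h" if "h \<in> carrier (Sp n)" for h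
      using Sp_cell_closure[of n] that by fastforce
    then show "f = restrict (lead_minor k) (carrier (Sp n))" unfolding p(2) by (intro restrict_ext)
  qed
  then show ?thesis using g by simp
qed

section \<open>The minors of the factorized matrix\<close>

lemma y_bold_carrier [simp]: "y_bold n i c \<in> carrier_mat (2*n) (2*n)"
  by (simp add: y_bold_def)

lemma y_bold_Sp: "i \<in> {1..n} \<Longrightarrow> c \<noteq> 0 \<Longrightarrow> y_bold n i c \<in> carrier (Sp n)"
  unfolding y_bold_def by (intro Sp_mult_closed y_elt_Sp torus_Sp coroot_torus) auto

lemma s_bar_Sp: "i \<in> {1..n} \<Longrightarrow> s_bar n i \<in> carrier (Sp n)"
  unfolding s_bar_def by (intro Sp_mult_closed x_elt_Sp y_elt_Sp)

text \<open>The torus factor divides row r - 1 by c before y_i(c) adds c times that row, so the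
  added row has coefficient one.\<close>

lemma y_bold_mult_index:
  assumes i: "i \<in> {1..n}" and c: "c \<noteq> 0" and M: "M \<in> carrier_mat (2*n) l" and rs: "r < 2*n" "s < l"
  shows "(y_bold n i c * M) $$ (r,s) = (if up n i r then M $$ (r,s) / c
    else if dn n i r then c * M $$ (r,s) + M $$ (r - 1,s) else M $$ (r,s))"
proof -
  let ?N = "coroot n i (inverse c) * M"
  have N: "?N \<in> carrier_mat (2*n) l" using M by (meson mult_carrier_mat coroot_carrier)
  have Ni: "?N $$ (r',s) = (if up n i r' then inverse c else if dn n i r' then c else 1) * M $$ (r',s)"
    if "r' < 2*n" for r'
    using coroot_mult_index[OF M that rs(2), of i "inverse c"] by simp
  have "y_bold n i c * M = y_elt n i c * ?N"
    unfolding y_bold_def by (rule assoc_mult_mat[OF y_elt_carrier coroot_carrier M])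
  then have *: "(y_bold n i c * M) $$ (r,s) = ?N $$ (r,s) + (if dn n i r then c * ?N $$ (r - 1,s) else 0)"
    using y_elt_mult_index[OF i N rs] by simp
  consider (up) "up n i r" | (dn) "dn n i r" | (none) "\<not> up n i r" "\<not> dn n i r" by blast
  then show ?thesis
  proof cases
    case up
    then show ?thesis unfolding * using up_not_dn[OF up] rs by (simp add: Ni divide_inverse mult.commute del: index_mult_mat(1))
  next
    case dn
    have "\<not> up n i r" "up n i (r - 1)" "r - 1 < 2*n" using dn up_not_dn up_pred[OF i dn] rs by auto
    then show ?thesis unfolding * using dn rs c by (simp add: Ni del: index_mult_mat(1))
  next
    case none
    then show ?thesis unfolding * using rs by (simp add: Ni del: index_mult_mat(1))
  qed
qed

text \<open>The starting index j is a parameter for the sake of an induction from n + 1 down to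
  1.\<close>

definition y_block :: "nat \<Rightarrow> (nat \<Rightarrow> complex) \<Rightarrow> nat \<Rightarrow> complex mat \<Rightarrow> complex mat" where
  "y_block n a j g = foldr (\<lambda>i h. y_bold n i (a i) * h) [j..<Suc n] g"

lemma y_block_last: "y_block n a (Suc n) g = g"
  by (simp add: y_block_def)

lemma y_block_step: "j \<le> n \<Longrightarrow> y_block n a j g = y_bold n j (a j) * y_block n a (Suc j) g"
  unfolding y_block_def by (subst upt_conv_Cons) auto

lemma y_block_carrier:
  assumes "g \<in> carrier_mat (2*n) (2*n)"
  shows "y_block n a j g \<in> carrier_mat (2*n) (2*n)"
proof -
  have "foldr (\<lambda>i h. y_bold n i (a i) * h) is g \<in> carrier_mat (2*n) (2*n)" for "is"
    using assms by (induction "is") auto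
  then show ?thesis by (simp add: y_block_def)
qed

text \<open>An upper row i is affected by the factors i + 1 and i only. In the lower half each row
  is handed on to the next one undivided, so the sums T i accumulate downwards. Row n - 1 enters
  through factor n, where the two halves meet.\<close>

lemma y_block_partial:
  assumes a: "\<And>i. i \<in> {1..n} \<Longrightarrow> a i \<noteq> 0" and g: "g \<in> carrier_mat (2*n) (2*n)" and s: "s < 2*n"
    and j: "1 \<le> j" "j \<le> Suc n" and i: "i < n"
  defines "T \<equiv> \<lambda>i. (\<Sum>t=i..<n. a (Suc t) * g $$ (2*n - Suc t,s)) + g $$ (n - 1,s)"
  shows "y_block n a j g $$ (i,s) =
      (if j \<le> i then a i / a (Suc i) * g $$ (i,s) + g $$ (i - 1,s)
       else if j = Suc i then g $$ (i,s) / a (Suc i) else g $$ (i,s))"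
    and "y_block n a j g $$ (2*n - Suc i,s) =
      (if j \<le> i then T i / a i else if j = Suc i then T i else g $$ (2*n - Suc i,s))"
proof -
  have "\<forall>i<n. y_block n a j g $$ (i,s) =
      (if j \<le> i then a i / a (Suc i) * g $$ (i,s) + g $$ (i - 1,s)
       else if j = Suc i then g $$ (i,s) / a (Suc i) else g $$ (i,s)) \<and>
    y_block n a j g $$ (2*n - Suc i,s) =
      (if j \<le> i then T i / a i else if j = Suc i then T i else g $$ (2*n - Suc i,s))"
    using j(2,1)
  proof (induction rule: inc_induct)
    case base
    then show ?case by (auto simp: y_block_last)
  next
    case (step j)
    let ?H = "y_block n a (Suc j) g"
    have j: "j \<in> {1..n}" "j \<le> n" using step by auto
    note aj = a[OF j(1)]
    have H: "?H \<in> carrier_mat (2*n) (2*n)" using g by (rule y_block_carrier)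
    have Y: "y_block n a j g $$ (r,s) = (if up n j r then ?H $$ (r,s) / a j
      else if dn n j r then a j * ?H $$ (r,s) + ?H $$ (r - 1,s) else ?H $$ (r,s))" if "r < 2*n" for r
      unfolding y_block_step[OF j(2)] using y_bold_mult_index[OF j(1) aj H that s] .
    have IH1: "?H $$ (i,s) = (if Suc j \<le> i then a i / a (Suc i) * g $$ (i,s) + g $$ (i - 1,s)
       else if j = i then g $$ (i,s) / a (Suc i) else g $$ (i,s))" if "i < n" for i
      using step.IH that by auto
    have IH2: "?H $$ (2*n - Suc i,s) =
      (if Suc j \<le> i then T i / a i else if j = i then T i else g $$ (2*n - Suc i,s))" if "i < n" for i
      using step.IH that by auto
    show ?case
    proof (intro allI impI conjI)
      fix i assume i: "i < n"
      have ud: "up n j i \<longleftrightarrow> j = Suc i" "dn n j i \<longleftrightarrow> j = i"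
        using i j unfolding up_def dn_def by auto
      have i2: "i < 2*n" using i by simp
      consider "j < i" | "j = i" | "j = Suc i" | "j > Suc i" by linarith
      then show "y_block n a j g $$ (i,s) =
        (if j \<le> i then a i / a (Suc i) * g $$ (i,s) + g $$ (i - 1,s)
         else if j = Suc i then g $$ (i,s) / a (Suc i) else g $$ (i,s))"
      proof cases
        case 2
        then have "i - 1 < n" "\<not> Suc j \<le> i - 1" "j \<noteq> i - 1" using i j by auto
        then show ?thesis unfolding Y[OF i2] ud using 2 IH1[OF i] IH1[of "i - 1"] by simp
      next
        case 1
        then show ?thesis unfolding Y[OF i2] ud using IH1[OF i] by simp
      next
        case 3
        then show ?thesis unfolding Y[OF i2] ud using IH1[OF i] by simp
      next
        case 4
        then show ?thesis unfolding Y[OF i2] ud using IH1[OF i] by simp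
      qed
      have ud': "up n j (2*n - Suc i) \<longleftrightarrow> j = i" "dn n j (2*n - Suc i) \<longleftrightarrow> j = Suc i"
        using up_mirror[OF j(1) i2] dn_mirror[OF j(1) i2] ud by auto
      have r2: "2*n - Suc i < 2*n" using i by simp
      consider "j < i" | "j = i" | "j = Suc i" | "j > Suc i" by linarith
      then show "y_block n a j g $$ (2*n - Suc i,s) =
        (if j \<le> i then T i / a i else if j = Suc i then T i else g $$ (2*n - Suc i,s))"
      proof cases
        case 3
        have e: "2*n - Suc i - 1 = 2*n - Suc (Suc i)" by simp
        \<comment> \<open>The row above holds the sum T (i + 1). For i + 1 = n it is row n - 1, and
          the sum over t is empty.\<close>
        have "?H $$ (2*n - Suc (Suc i),s) = T (Suc i)"
        proof (cases "Suc i < n")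
          case True
          then show ?thesis using IH2[OF True] 3 by simp
        next
          case False
          then have n: "n = Suc i" using i by simp
          have "2*n - Suc (Suc i) = n - 1" using n by simp
          then show ?thesis using IH1[of "n - 1"] 3 n by (simp add: T_def)
        qed
        moreover have "T i = a (Suc i) * g $$ (2*n - Suc i,s) + T (Suc i)"
          unfolding T_def using i by (simp add: sum.atLeast_Suc_lessThan)
        ultimately show ?thesis unfolding Y[OF r2] ud' e using 3 IH2[OF i] by simp
      next
        case 1
        then show ?thesis unfolding Y[OF r2] ud' using IH2[OF i] by simp
      next
        case 2
        then show ?thesis unfolding Y[OF r2] ud' using IH2[OF i] by simp
      next
        case 4
        then show ?thesis unfolding Y[OF r2] ud' using IH2[OF i] by simp
      qed
    qed
  qed
  then show "y_block n a j g $$ (i,s) =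
      (if j \<le> i then a i / a (Suc i) * g $$ (i,s) + g $$ (i - 1,s)
       else if j = Suc i then g $$ (i,s) / a (Suc i) else g $$ (i,s))"
    and "y_block n a j g $$ (2*n - Suc i,s) =
      (if j \<le> i then T i / a i else if j = Suc i then T i else g $$ (2*n - Suc i,s))"
    using i by auto
qed

section \<open>The products R_m of the last blocks\<close>

locale factorization_coords =
  fixes n :: nat and c :: "nat \<Rightarrow> nat \<Rightarrow> complex"
  assumes n: "n \<ge> 1"
    and nz: "\<And>m j. m \<in> {1..n} \<Longrightarrow> j \<in> {1..n} \<Longrightarrow> c m j \<noteq> 0"
    and c0: "\<And>m. m \<in> {1..n} \<Longrightarrow> c m 0 = 1"
begin

definition tail :: "nat \<Rightarrow> complex mat" where
  "tail m = foldr (\<lambda>m g. y_block n (c m) 1 g) [m..<Suc n] (1\<^sub>m (2*n))"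

lemma tail_last: "tail (Suc n) = 1\<^sub>m (2*n)"
  by (simp add: tail_def)

lemma tail_step: "m \<le> n \<Longrightarrow> tail m = y_block n (c m) 1 (tail (Suc m))"
  unfolding tail_def by (subst upt_conv_Cons) auto

lemma tail_carrier: "tail m \<in> carrier_mat (2*n) (2*n)"
proof -
  have "foldr (\<lambda>m g. y_block n (c m) 1 g) ms (1\<^sub>m (2*n)) \<in> carrier_mat (2*n) (2*n)" for ms
    by (induction ms) (auto simp: y_block_carrier)
  then show ?thesis by (simp add: tail_def)
qed

lemma nz': "m \<in> {1..n} \<Longrightarrow> j \<le> n \<Longrightarrow> c m j \<noteq> 0"
  using nz[of m j] c0[of m] by (cases "j = 0") auto

text \<open>With the convention c m 0 = 1, row 0, which is only divided by c m 1, fits the general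
  formula.\<close>

lemma tail_upper:
  assumes m: "m \<in> {1..n}" and i: "i < n" and s: "s < 2*n"
  shows "tail m $$ (i,s) = c m i / c m (Suc i) * tail (Suc m) $$ (i,s)
    + (if i = 0 then 0 else tail (Suc m) $$ (i - 1,s))"
  using y_block_partial(1)[where a = "c m" and g = "tail (Suc m)" and j = 1, OF nz[OF m] tail_carrier s _ _ i]
    tail_step[of m] m i c0[OF m] by (cases "i = 0") auto

lemma tail_lower:
  assumes m: "m \<in> {1..n}" and i: "i < n" and s: "s < 2*n"
  shows "tail m $$ (2*n - Suc i,s) = ((\<Sum>t=i..<n. c m (Suc t) * tail (Suc m) $$ (2*n - Suc t,s))
    + tail (Suc m) $$ (n - 1,s)) / c m i"
  using y_block_partial(2)[where a = "c m" and g = "tail (Suc m)" and j = 1, OF nz[OF m] tail_carrier s _ _ i]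
    tail_step[of m] m i c0[OF m] by (cases "i = 0") auto

text \<open>An entry is a sum over paths: at each of the n + 1 - m blocks the row index either
  stays, with a quotient of coordinates as weight, or drops by one with weight one. A drop of n + 1
  - m leaves a single path of weight one. A drop of n - m leaves the paths with one stay, at block t
  and in row i + m - t.\<close>

lemma tail_upper_eval:
  assumes m: "1 \<le> m" "m \<le> Suc n" and i: "i < n" and s: "s < 2*n"
  shows "s + Suc n < i + m \<Longrightarrow> tail m $$ (i,s) = 0"
    and "s + Suc n = i + m \<Longrightarrow> tail m $$ (i,s) = 1"
    and "s + n = i + m \<Longrightarrow> tail m $$ (i,s) = (\<Sum>t=m..n. c t (i + m - t) / c t (Suc (i + m - t)))"
proof -
  have "\<forall>i<n. (s + Suc n < i + m \<longrightarrow> tail m $$ (i,s) = 0) \<and>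
    (s + Suc n = i + m \<longrightarrow> tail m $$ (i,s) = 1) \<and>
    (s + n = i + m \<longrightarrow> tail m $$ (i,s) = (\<Sum>t=m..n. c t (i + m - t) / c t (Suc (i + m - t))))"
    using m(2,1)
  proof (induction rule: inc_induct)
    case base
    then show ?case using s by (auto simp: tail_last)
  next
    case (step m)
    have m: "m \<in> {1..n}" using step by auto
    show ?case
    proof (intro allI impI conjI)
      fix i assume i: "i < n" and "s + Suc n < i + m"
      then show "tail m $$ (i,s) = 0" using tail_upper[OF m i s] step.IH m by auto
    next
      fix i assume i: "i < n" and *: "s + Suc n = i + m"
      then have "i \<noteq> 0" "i - 1 < n" "s + Suc n = i - 1 + Suc m" using m by auto
      then show "tail m $$ (i,s) = 1" using tail_upper[OF m i s] step.IH * i by auto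
    next
      fix i assume i: "i < n" and *: "s + n = i + m"
      have 1: "tail (Suc m) $$ (i,s) = 1" using step.IH i * by auto
      have 2: "(if i = 0 then 0 else tail (Suc m) $$ (i - 1,s)) = (\<Sum>t=Suc m..n. c t (i + m - t) / c t (Suc (i + m - t)))"
      proof (cases "i = 0")
        case True
        then show ?thesis using * m by auto
      next
        case False
        then have "i - 1 < n" "s + n = i - 1 + Suc m" "i - 1 + Suc m = i + m" using * i by auto
        then show ?thesis using step.IH False by auto
      qed
      show "tail m $$ (i,s) = (\<Sum>t=m..n. c t (i + m - t) / c t (Suc (i + m - t)))"
        unfolding tail_upper[OF m i s] 1 2 using m by (simp add: sum.atLeast_Suc_atMost)
    qed
  qed
  then show "s + Suc n < i + m \<Longrightarrow> tail m $$ (i,s) = 0"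
    and "s + Suc n = i + m \<Longrightarrow> tail m $$ (i,s) = 1"
    and "s + n = i + m \<Longrightarrow> tail m $$ (i,s) = (\<Sum>t=m..n. c t (i + m - t) / c t (Suc (i + m - t)))"
    using i by auto
qed

text \<open>Lower rows of R_m come from lower rows of R_(m+1) and from its row n - 1, which starts
  with m - 1 zeros.\<close>

lemma tail_lower_zero:
  assumes m: "1 \<le> m" "m \<le> Suc n" and "i < n" "s < n" "Suc s < m"
  shows "tail m $$ (2*n - Suc i,s) = 0"
  using m(2,1) assms(3-5)
proof (induction arbitrary: i rule: inc_induct)
  case base
  then show ?case by (auto simp: tail_last)
next
  case (step m)
  have m: "m \<in> {1..n}" and s: "s < 2*n" using step by auto
  have "tail (Suc m) $$ (n - 1,s) = 0" using step m n by (intro tail_upper_eval(1)) auto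
  then show ?case unfolding tail_lower[OF m step.prems(2) s] using step by simp
qed

text \<open>In column m - 1 only row n - 1 of R_(m+1) contributes. Its entry there is one and is
  then divided by c m i.\<close>

lemma tail_lower_first:
  assumes m: "m \<in> {1..n}" and "i < n"
  shows "tail m $$ (2*n - Suc i,m - 1) = 1 / c m i"
proof -
  have s: "m - 1 < 2*n" using m by auto
  have "tail (Suc m) $$ (n - 1,m - 1) = 1" using m n by (intro tail_upper_eval(2)) auto
  moreover have "tail (Suc m) $$ (2*n - Suc t,m - 1) = 0" if "t < n" for t
    using m that by (intro tail_lower_zero) auto
  ultimately show ?thesis unfolding tail_lower[OF m assms(2) s] by simp
qed

definition answer :: "nat \<Rightarrow> complex" where
  "answer k = (if k = n then c n n else
     (\<Sum>j=1..n. c k j / c (k+1) (j-1)) + (\<Sum>j=k+1..n. c (n+k-j+1) (j-1) / c (n+k-j+1) j))"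

text \<open>For k < n the first sum of the answer comes from the lower rows of R_(k+1), whose
  entries in column k are reciprocals of coordinates; the second sum comes from its row n - 1. For k
  = n the matrix R_(n+1) is the identity and a single term survives.\<close>

lemma tail_last_row:
  assumes k: "k \<in> {1..n}"
  shows "s < k - 1 \<Longrightarrow> tail k $$ (2*n - 1,s) = 0"
    and "tail k $$ (2*n - 1,k - 1) = 1"
    and "tail k $$ (2*n - 1,k) = answer k"
proof -
  show "tail k $$ (2*n - 1,s) = 0" if "s < k - 1"
    using tail_lower_zero[of k 0 s] that k by auto
  show "tail k $$ (2*n - 1,k - 1) = 1"
    using tail_lower_first[OF k, of 0] k c0[OF k] by auto
  have 0: "tail k $$ (2*n - 1,k) = (\<Sum>t=0..<n. c k (Suc t) * tail (Suc k) $$ (2*n - Suc t,k)) + tail (Suc k) $$ (n - 1,k)"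
    using tail_lower[OF k, of 0 k] k c0[OF k] by auto
  show "tail k $$ (2*n - 1,k) = answer k"
  proof (cases "k = n")
    case True
    have "(\<Sum>t=0..<n. c k (Suc t) * tail (Suc k) $$ (2*n - Suc t,k)) = (\<Sum>t<n. if t = n - 1 then c n n else 0)"
      unfolding lessThan_atLeast0 using True by (intro sum.cong refl) (auto simp: tail_last)
    then show ?thesis unfolding 0 using True n by (auto simp: tail_last answer_def)
  next
    case False
    then have k': "Suc k \<in> {1..n}" using k by auto
    have "(\<Sum>t=0..<n. c k (Suc t) * tail (Suc k) $$ (2*n - Suc t,k)) = (\<Sum>t=0..<n. c k (Suc t) / c (Suc k) t)"
      using tail_lower_first[OF k'] by (intro sum.cong refl) auto
    also have "\<dots> = (\<Sum>j=1..n. c k j / c (k+1) (j-1))"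
      by (rule sum.reindex_bij_witness[of _ "\<lambda>j. j - 1" Suc]) auto
    moreover have "tail (Suc k) $$ (n - 1,k) = (\<Sum>t=Suc k..n. c t (n - 1 + Suc k - t) / c t (Suc (n - 1 + Suc k - t)))"
      using k' by (intro tail_upper_eval(3)) auto
    moreover have "\<dots> = (\<Sum>j=k+1..n. c (n+k-j+1) (j-1) / c (n+k-j+1) j)"
    \<comment> \<open>t numbers the block and j the coordinate in it; they are tied by t + j = n + k
      + 1.\<close>
    proof (rule sum.reindex_bij_witness[of _ "\<lambda>j. n + k + 1 - j" "\<lambda>t. n + k + 1 - t"])
      fix t assume t: "t \<in> {Suc k..n}"
      then have "n + k - (n + k + 1 - t) + 1 = t" "n - 1 + Suc k - t = n + k + 1 - t - 1"
        "Suc (n + k + 1 - t - 1) = n + k + 1 - t" by auto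
      then show "c (n+k-(n + k + 1 - t)+1) ((n + k + 1 - t)-1) / c (n+k-(n + k + 1 - t)+1) (n + k + 1 - t)
        = c t (n - 1 + Suc k - t) / c t (Suc (n - 1 + Suc k - t))" by simp
    qed auto
    ultimately show ?thesis unfolding 0 answer_def using False by simp
  qed
qed

text \<open>Two neighbouring lower rows of R_m are tail sums differing by one term, a multiple of a
  row of R_(m+1). Solving for the upper of the two rows produces a minus sign each time, which the
  factor (-1)^r absorbs.\<close>

lemma tail_bottom_rows:
  assumes "1 \<le> m" "m + r \<le> n"
  shows "\<exists>f. f r = 1 \<and> (\<forall>s<2*n. (-1)^r * tail m $$ (2*n - Suc r,s) = (\<Sum>j\<le>r. f j * tail (m + j) $$ (2*n - 1,s)))"
  using assms
proof (induction r arbitrary: m)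
  case 0
  show ?case by (rule exI[of _ "\<lambda>_. 1"]) simp
next
  case (Suc r)
  obtain f where f: "f r = 1" "\<And>s. s < 2*n \<Longrightarrow> (-1)^r * tail m $$ (2*n - Suc r,s) = (\<Sum>j\<le>r. f j * tail (m + j) $$ (2*n - 1,s))"
    using Suc.IH[of m] Suc.prems by auto
  obtain g where g: "g r = 1" "\<And>s. s < 2*n \<Longrightarrow> (-1)^r * tail (Suc m) $$ (2*n - Suc r,s) = (\<Sum>j\<le>r. g j * tail (Suc m + j) $$ (2*n - 1,s))"
    using Suc.IH[of "Suc m"] Suc.prems by auto
  define a where "a = c m r / c m (Suc r)"
  \<comment> \<open>The coefficients for R_(m+1) enter shifted by one block, and the leading one at
    r + 1 comes from them alone.\<close>
  define h where "h j = (if j \<le> r then - a * f j else 0) + (if j = 0 then 0 else g (j - 1))" for j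
  have m: "m \<in> {1..n}" and r: "r < n" "Suc r < n" using Suc.prems by auto
  have nzr: "c m r \<noteq> 0" "c m (Suc r) \<noteq> 0" using nz'[OF m] r by auto
  have "(-1)^Suc r * tail m $$ (2*n - Suc (Suc r),s) = (\<Sum>j\<le>Suc r. h j * tail (m + j) $$ (2*n - 1,s))"
    if s: "s < 2*n" for s
  proof -
    have "c m r * tail m $$ (2*n - Suc r,s) = c m (Suc r) * tail (Suc m) $$ (2*n - Suc r,s)
        + c m (Suc r) * tail m $$ (2*n - Suc (Suc r),s)"
      unfolding tail_lower[OF m r(1) s] tail_lower[OF m r(2) s] using nzr r
      by (simp add: sum.atLeast_Suc_lessThan)
    then have eq: "tail m $$ (2*n - Suc (Suc r),s) = a * tail m $$ (2*n - Suc r,s) - tail (Suc m) $$ (2*n - Suc r,s)"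
      using nzr unfolding a_def by (simp add: field_simps)
    have "(-1)^Suc r * tail m $$ (2*n - Suc (Suc r),s)
        = - a * ((-1)^r * tail m $$ (2*n - Suc r,s)) + (-1)^r * tail (Suc m) $$ (2*n - Suc r,s)"
      unfolding eq by (simp add: algebra_simps)
    also have "\<dots> = (\<Sum>j\<le>r. - a * f j * tail (m + j) $$ (2*n - 1,s)) + (\<Sum>j\<le>r. g j * tail (m + Suc j) $$ (2*n - 1,s))"
      unfolding f(2)[OF s] g(2)[OF s] by (simp add: sum_distrib_left mult.assoc)
    also have "(\<Sum>j\<le>r. - a * f j * tail (m + j) $$ (2*n - 1,s)) = (\<Sum>j\<le>Suc r. (if j \<le> r then - a * f j else 0) * tail (m + j) $$ (2*n - 1,s))"
      by simp
    also have "(\<Sum>j\<le>r. g j * tail (m + Suc j) $$ (2*n - 1,s)) = (\<Sum>j\<le>Suc r. (if j = 0 then 0 else g (j - 1)) * tail (m + j) $$ (2*n - 1,s))"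
      by (simp add: sum.atMost_Suc_shift del: sum.atMost_Suc)
    finally show ?thesis unfolding h_def by (simp add: sum.distrib distrib_right del: sum.atMost_Suc)
  qed
  moreover have "h (Suc r) = 1" using g(1) by (simp add: h_def)
  ultimately show ?case by blast
qed

lemma lead_minor_tail:
  assumes k: "k \<in> {1..n}"
  shows "lead_minor k (symp_form n * tail 1 * s_bar n k) = answer k"
proof -
  \<comment> \<open>Among the first k columns, right multiplication by the lift of s_k only replaces
    column k - 1 by column k, with positive sign.\<close>
  define \<sigma> where "\<sigma> s = (if s = k - 1 then k else s)" for s
  have "\<forall>r\<in>{..<n}. \<exists>f. f r = 1 \<and> (\<forall>s<2*n. (-1)^r * tail 1 $$ (2*n - Suc r,s) = (\<Sum>j\<le>r. f j * tail (1 + j) $$ (2*n - 1,s)))"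
    using tail_bottom_rows[of 1] by simp
  from bchoice[OF this] obtain F where F: "\<And>r. r < n \<Longrightarrow> F r r = 1"
    "\<And>r s. r < n \<Longrightarrow> s < 2*n \<Longrightarrow> (-1)^r * tail 1 $$ (2*n - Suc r,s) = (\<Sum>j\<le>r. F r j * tail (1 + j) $$ (2*n - 1,s))"
    by auto
  \<comment> \<open>J reverses the rows with sign (-1)^r, the very sign in
    \<open>tail_bottom_rows\<close>, so the diagonal of L is one.\<close>
  define L where "L = mat k k (\<lambda>(r,j). if j \<le> r then F r j else 0)"
  define U where "U = mat k k (\<lambda>(j,s). tail (Suc j) $$ (2*n - 1,\<sigma> s))"
  have LU: "L \<in> carrier_mat k k" "U \<in> carrier_mat k k" unfolding L_def U_def by auto
  have M: "symp_form n * tail 1 \<in> carrier_mat (2*n) (2*n)" using tail_carrier by simp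
  have "lead_mat k (symp_form n * tail 1 * s_bar n k) = L * U"
  proof (rule eq_matI)
    fix r s assume "r < dim_row (L * U)" "s < dim_col (L * U)"
    then have rs: "r < k" "s < k" using LU by auto
    then have rn: "r < n" "s < n" "r < 2*n" "s < 2*n" "\<sigma> s < 2*n" using k unfolding \<sigma>_def by auto
    have sb: "s_bar n k $$ (j,s) = (if j = \<sigma> s then 1 else 0)" if j: "j < 2*n" for j
    proof -
      have "s_bar n k $$ (j,s) = (s_bar n k * 1\<^sub>m (2*n)) $$ (j,s)"
        using right_mult_one_mat[OF s_bar_carrier] by metis
      also have "\<dots> = (if up n k j then - (1\<^sub>m (2*n)) $$ (Suc j,s) else if dn n k j then 1\<^sub>m (2*n) $$ (j - 1,s) else 1\<^sub>m (2*n) $$ (j,s))"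
        using rn j by (intro s_bar_mult_index[OF k, where l = "2*n"]) auto
      also have "\<dots> = (if j = \<sigma> s then 1 else 0)"
      proof -
        consider (up) "up n k j" | (dn) "dn n k j" | (none) "\<not> up n k j" "\<not> dn n k j" by blast
        then show ?thesis
        proof cases
          case up
          then have "Suc j < 2*n" "Suc j \<noteq> s" "j \<noteq> \<sigma> s"
            using up_less[OF k up] rs k rn unfolding up_def \<sigma>_def by auto presburger
          then show ?thesis using up rn by simp
        next
          case dn
          then have "j - 1 < 2*n" "\<not> up n k j" "0 < j" using j up_not_dn dn_pos[OF k j dn] by auto
          moreover have "j - 1 = s \<longleftrightarrow> j = \<sigma> s"
            using dn rs k rn \<open>0 < j\<close> unfolding dn_def \<sigma>_def by auto
          ultimately show ?thesis using dn rn by simp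
        next
          case none
          then have "j = s \<longleftrightarrow> j = \<sigma> s" using rs k unfolding up_def dn_def \<sigma>_def by auto
          then show ?thesis using none j rn by simp
        qed
      qed
      finally show ?thesis .
    qed
    have "lead_mat k (symp_form n * tail 1 * s_bar n k) $$ (r,s) = (symp_form n * tail 1 * s_bar n k) $$ (r,s)"
      using rs by (simp add: lead_mat_def)
    also have "\<dots> = (\<Sum>j<2*n. (symp_form n * tail 1) $$ (r,j) * s_bar n k $$ (j,s))"
      by (rule mult_index_sum[OF M s_bar_carrier rn(3,4)])
    also have "\<dots> = (symp_form n * tail 1) $$ (r,\<sigma> s) * s_bar n k $$ (\<sigma> s,s)"
      using rn sb by (intro sum_single_index) auto
    also have "\<dots> = (-1)^r * tail 1 $$ (2*n - Suc r,\<sigma> s)"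
      using rn sb symp_form_mult_index[OF tail_carrier rn(3,5), of 1] by simp
    also have "\<dots> = (\<Sum>j\<le>r. F r j * tail (1 + j) $$ (2*n - 1,\<sigma> s))" using F(2)[OF rn(1,5)] .
    also have "\<dots> = (\<Sum>j\<le>r. L $$ (r,j) * U $$ (j,s))"
      using rs by (intro sum.cong refl) (auto simp: L_def U_def)
    also have "\<dots> = (\<Sum>j<k. L $$ (r,j) * U $$ (j,s))"
      using rs by (intro sum.mono_neutral_left) (auto simp: L_def)
    also have "\<dots> = (L * U) $$ (r,s)" using rs LU by (intro mult_index_sum[symmetric]) auto
    finally show "lead_mat k (symp_form n * tail 1 * s_bar n k) $$ (r,s) = (L * U) $$ (r,s)" .
  qed (use LU in \<open>auto simp: lead_mat_def\<close>)
  then have "lead_minor k (symp_form n * tail 1 * s_bar n k) = det L * det U"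
    unfolding lead_minor_def using det_mult[OF LU] by simp
  moreover have "det L = 1"
  proof -
    have "det L = prod_list (diag_mat L)"
      by (rule det_lower_triangular[OF _ LU(1)]) (auto simp: L_def)
    also have "\<dots> = 1" unfolding prod_list_diag_prod using F(1) k by (intro prod.neutral) (auto simp: L_def)
    finally show ?thesis .
  qed
  moreover have "det U = answer k"
  proof -
    \<comment> \<open>Row j of U comes from R_(j+1), which starts with j zeros and a one; on the
      diagonal only the last row meets the exchanged column.\<close>
    have Ui: "U $$ (j,s) = (if s < j then 0 else if j = k - 1 then answer k else 1)" if js: "j < k" "s \<le> j" for j s
    proof -
      have j: "Suc j \<in> {1..n}" using js k by auto
      consider "s < j" | "s = j" "j = k - 1" | "s = j" "j < k - 1"
        using js by (cases "s < j"; cases "j = k - 1") auto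
      then show ?thesis
      proof cases
        case 1
        then have "\<sigma> s = s" using js unfolding \<sigma>_def by auto
        then show ?thesis using 1 js tail_last_row(1)[OF j, of s] by (simp add: U_def)
      next
        case 2
        then have "\<sigma> s = k" "Suc j = k" using k unfolding \<sigma>_def by auto
        then show ?thesis using 2 js tail_last_row(3)[OF k] by (simp add: U_def)
      next
        case 3
        then have "\<sigma> s = j" unfolding \<sigma>_def by auto
        then show ?thesis using 3 js tail_last_row(2)[OF j] by (simp add: U_def)
      qed
    qed
    have "upper_triangular U" using Ui LU by auto
    then have "det U = prod_list (diag_mat U)" using LU(2) by (rule det_upper_triangular)
    also have "\<dots> = (\<Prod>j<k. if j = k - 1 then answer k else 1)"
      unfolding prod_list_diag_prod lessThan_atLeast0 using LU Ui by (intro prod.cong) auto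
    also have "\<dots> = answer k" using k by (simp add: prod.delta)
    finally show ?thesis .
  qed
  ultimately show ?thesis by simp
qed

lemma y_block_Sp:
  assumes "g \<in> carrier (Sp n)" "m \<in> {1..n}"
  shows "y_block n (c m) 1 g \<in> carrier (Sp n)"
proof -
  have "foldr (\<lambda>i h. y_bold n i (c m i) * h) is g \<in> carrier (Sp n)" if "set is \<subseteq> {1..n}" for "is"
    using that by (induction "is") (auto simp: assms(1) intro!: Sp_mult_closed y_bold_Sp nz[OF assms(2)])
  moreover have "set [1..<Suc n] \<subseteq> {1..n}" by auto
  ultimately show ?thesis unfolding y_block_def by blast
qed

lemma tail_Sp: "tail 1 \<in> carrier (Sp n)"
proof -
  have "foldr (\<lambda>m g. y_block n (c m) 1 g) ms (1\<^sub>m (2*n)) \<in> carrier (Sp n)" if "set ms \<subseteq> {1..n}" for ms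
    using that by (induction ms) (auto simp: torus_Sp[OF torus_one] y_block_Sp simp del: One_nat_def)
  moreover have "set [1..<Suc n] \<subseteq> {1..n}" by auto
  ultimately show ?thesis unfolding tail_def by blast
qed

lemma Theta_minus_tail: "Theta_minus n (word_i0 n) (coord_list n c) = tail 1"
proof -
  let ?w = "[1..<Suc n]"
  have block: "foldr (\<lambda>(i,a) g. y_bold n i a * g) (zip w (map (c m) w)) g = foldr (\<lambda>i h. y_bold n i (c m i) * h) w g" for w m g
    by (induction w) auto
  \<comment> \<open>An arbitrary list of block numbers is allowed, so that the induction can split
    off one block.\<close>
  have "foldr (\<lambda>(i,a) g. y_bold n i a * g) (zip (concat (replicate (length ms) ?w)) (concat (map (\<lambda>m. map (c m) ?w) ms))) (1\<^sub>m (2*n))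
    = foldr (\<lambda>m g. y_block n (c m) 1 g) ms (1\<^sub>m (2*n))" for ms
  proof (induction ms)
    case (Cons m ms)
    have "zip (concat (replicate (length (m # ms)) ?w)) (concat (map (\<lambda>m. map (c m) ?w) (m # ms)))
      = zip ?w (map (c m) ?w) @ zip (concat (replicate (length ms) ?w)) (concat (map (\<lambda>m. map (c m) ?w) ms))"
      by (simp del: upt_Suc)
    then show ?case using Cons by (simp only: foldr_append block foldr.simps comp_def y_block_def)
  qed simp
  from this[of ?w] show ?thesis unfolding Theta_minus_def word_i0_def coord_list_def tail_def
    by (simp del: upt_Suc)
qed

lemma symp_form_Sp: "symp_form n \<in> carrier (Sp n)" "- symp_form n \<in> carrier (Sp n)"
proof -
  show J: "symp_form n \<in> carrier (Sp n)"
    by (simp add: carrier_Sp symp_form_transpose symp_form_square)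
  obtain h where h: "h \<in> carrier (Sp n)" "h * symp_form n = 1\<^sub>m (2*n)"
    using group.l_inv_ex[OF group_Sp J] by auto
  have "h * (symp_form n * symp_form n) = symp_form n"
    using h Sp_mat[OF h(1)] by (simp flip: assoc_mult_mat[of h "2*n" "2*n" "symp_form n" "2*n" "symp_form n" "2*n"])
  then have "- h = symp_form n" using Sp_mat[OF h(1)] by (simp add: symp_form_square)
  then have "h = - symp_form n" by (metis uminus_uminus_mat)
  then show "- symp_form n \<in> carrier (Sp n)" using h(1) by simp
qed

lemma gen_minor_Theta:
  assumes k: "k \<in> {1..n}"
  shows "gen_minor n (longest_elt n) (simple_refl n k) k (Theta_minus n (word_i0 n) (coord_list n c)) = answer k"
proof -
  \<comment> \<open>The lift of w_0 is -J, and J^2 = -1, so J itself appears on the left of the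
    product.\<close>
  have inv: "inv\<^bsub>Sp n\<^esub> (- symp_form n) = symp_form n"
    by (rule Sp_inv_eqI) (auto simp: symp_form_Sp symp_form_square)
  have "symp_form n * tail 1 * s_bar n k \<in> carrier (Sp n)"
    by (intro Sp_mult_closed symp_form_Sp tail_Sp s_bar_Sp k)
  then show ?thesis
    unfolding gen_minor_def weyl_lift_longest weyl_lift_simple_refl[OF k] Theta_minus_tail inv
    using principal_minor_eq[OF k] lead_minor_tail[OF k] by simp
qed

end

theorem theorem7p1:
  fixes n :: nat and c :: "nat \<Rightarrow> nat \<Rightarrow> complex"
  assumes "n \<ge> 2"
    and "\<And>m j. m \<in> {1..n} \<Longrightarrow> j \<in> {1..n} \<Longrightarrow> c m j \<noteq> 0"
    and "\<And>m. m \<in> {1..n} \<Longrightarrow> c m 0 = 1"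
  shows "(\<forall>k \<in> {1..n-1}.
            gen_minor n (longest_elt n) (simple_refl n k) k
              (Theta_minus n (word_i0 n) (coord_list n c))
            = (\<Sum>j=1..n. c k j / c (k+1) (j-1))
              + (\<Sum>j=k+1..n. c (n+k-j+1) (j-1) / c (n+k-j+1) j))
       \<and> gen_minor n (longest_elt n) (simple_refl n n) n
              (Theta_minus n (word_i0 n) (coord_list n c))
         = c n n"
proof -
  interpret factorization_coords n c using assms by unfold_locales auto
  have "gen_minor n (longest_elt n) (simple_refl n k) k (Theta_minus n (word_i0 n) (coord_list n c))
      = (\<Sum>j=1..n. c k j / c (k+1) (j-1)) + (\<Sum>j=k+1..n. c (n+k-j+1) (j-1) / c (n+k-j+1) j)"
    if "k \<in> {1..n-1}" for k
    using gen_minor_Theta[of k] that assms(1) unfolding answer_def by auto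
  then show ?thesis using gen_minor_Theta[of n] assms(1) unfolding answer_def by auto
qed

end
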